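(* Consider an interconnection of $n\ge 2$ hybrid subsystems with data $(f_i,g_i,C_i,D_i,\chi_i,U)$, $i=1,\dots,n$, with $D_i=D$ for all $i$, and the resulting overall hybrid system with data $(f,g,C,D,\chi,U)$. Assume that for each $x\in\chi$ and each $\epsilon>0$ the set $\{f(x,u):u\in U\cap\epsilon\bar{\mathbb{B}}\}$ is convex. Assume that all subsystems are ISS with nonlinear gains $\gamma_{ij},\gamma_i\in\mathcal{K}_\infty\cup\{0\}$, put $\gamma_{ii}\equiv 0$, and let $\Gamma_{\max}:\mathbb{R}^n_+\to\mathbb{R}^n_+$, $(\Gamma_{\max}(s))_i=\max_{j\neq i}\gamma_{ij}(s_j)$. If $$\Gamma_{\max}(s)\not\ge s\qquad\text{for all } s\in\mathbb{R}^n_+,\ s\ne 0,$$ then the overall system is ISS, i.e. there exist $\beta\in\mathcal{KLL}$ and $\gamma\in\mathcal{K}_\infty\cup\{0\}$ such that for all initial values $x_0$ every solution pair $(x,u)\in S_u(x_0)$ satisfies, for all $(t,k)\in\mathrm{dom}\,x$, $$|x(t,k)|\le\max\{\beta(|x_0|,t,k),\gamma(\|u\|_{(t,k)})\}.$$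
   Context: Notation. $\mathbb{R}_+=[0,\infty)$, $\mathbb{N}_+=\{0,1,2,\dots\}$, $\mathbb{R}^n_+=\{s\in\mathbb{R}^n: s_i\ge 0\ \forall i\}$; $\bar{\mathbb{B}}$ is the closed unit ball centered at the origin (here in $\mathbb{R}^M$). For $x,y\in\mathbb{R}^n$: $x\ge y$ means $x_i\ge y_i$ for all $i$; $x\not\ge y$ means there is $i$ with $x_i<y_i$. A function $\gamma:\mathbb{R}_+\to\mathbb{R}_+$ is of class $\mathcal{K}$ if it is continuous, strictly increasing and $\gamma(0)=0$; of class $\mathcal{K}_\infty$ if moreover unbounded. $\beta:\mathbb{R}_+\times\mathbb{R}_+\to\mathbb{R}_+$ is of class $\mathcal{KL}$ if $\beta(\cdot,t)\in\mathcal{K}$ for each fixed $t$ and, for each fixed $s$, $\beta(s,\cdot)$ is non-increasing and tends to zero as $t\to\infty$. $\beta:\mathbb{R}_+^3\to\mathbb{R}_+$ is of class $\mathcal{KLL}$ if for each fixed $r\ge0$, $\beta(\cdot,\cdot,r)\in\mathcal{KL}$ and $\beta(\cdot,r,\cdot)\in\mathcal{KL}$. $0$ in $\mathcal{K}_\infty\cup\{0\}$ is the zero function. Interconnected hybrid systems. Subsystem $i$ has state $x_i\in\chi_i\subset\mathbb{R}^{N_i}$, and there is an external input $u\in U\subset\mathbb{R}^M$. Let $\chi=\chi_1\times\dots\times\chi_n$, $x=(x_1^T,\dots,x_n^T)^T\in\chi\subset\mathbb{R}^N$, $N=\sum N_i$. Subsystem $i$ is $$\dot x_i=f_i(x_1,\dots,x_n,u),\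 (x,u)\in C_i;\qquad x_i^+=g_i(x_1,\dots,x_n,u),\ (x,u)\in D_i,$$ with $C_i,D_i\subset\chi\times U$, $f_i:C_i\to\mathbb{R}^{N_i}$, $g_i:D_i\to\chi_i$. Standing regularity assumptions: $\chi_i$ is open, $U$ is closed, $C_i,D_i$ are relatively closed in $\chi\times U$, and $f_i,g_i$ are continuous. Overall system: $\dot x=f(x,u)$ for $(x,u)\in C$, $x^+=g(x,u)$ for $(x,u)\in D$, where $C=\bigcap_i C_i$, $D=\bigcup_i D_i$, $f=(f_1^T,\dots,f_n^T)^T:C\to\mathbb{R}^N$, $g=(\tilde g_1^T,\dots,\tilde g_n^T)^T$ with $\tilde g_i(x,u)=g_i(x,u)$ if $(x,u)\in D_i$ and $\tilde g_i(x,u)=x_i$ otherwise. Since $f$ is defined on $C$, the set $\{f(x,u):u\in U\cap\epsilon\bar{\mathbb{B}}\}$ is understood over those $u$ with $(x,u)\in C$. Hybrid time domains and signals. A hybrid time domain is a subset of $\mathbb{R}_+\times\mathbb{N}_+$ that is a union of finitely or infinitely many intervals $[t_k,t_{k+1}]\times\{k\}$, where $0=t_0\le t_1\le\dots$ is a finite or infinite nondecreasing sequence of reals; the last interval, if it exists, may be of the form $[t_K,T)\times\{K\}$ with $T$ finite or $T=+\infty$. For elements of a hybrid time domain, $(s,l)\le(t,k)$ means $s+l\le t+k$. A hybrid signal is a function on a hybrid time domain. A hybrid input is a hybrid signal $u$ with $u(\cdot,k)$ Lebesgue measurable and locally essentially bounded for each $k$. A hybrid arc is a hybrid signal $x$ with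 $x(\cdot,k)$ locally absolutely continuous for each $k$. For a hybrid signal $u$ put $\Phi(u)=\{(s,l)\in\mathrm{dom}\,u:(s,l+1)\in\mathrm{dom}\,u\}$ and $$\|u\|_{(t,k)}=\max\Big\{\operatorname*{ess\,sup}_{(s,l)\in\mathrm{dom}\,u\setminus\Phi(u),\,(s,l)\le(t,k)}|u(s,l)|,\ \sup_{(s,l)\in\Phi(u),\,(s,l)\le(t,k)}|u(s,l)|\Big\}.$$ Solutions. For subsystem $i$ the input is $v_i=(x_1^T,\dots,x_{i-1}^T,x_{i+1}^T,\dots,x_n^T,u^T)^T$, made of hybrid inputs $x_j:\mathrm{dom}\,x_j\to\chi_j$ ($j\ne i$) and $u:\mathrm{dom}\,u\to U$. A pair $(x_i,v_i)$ with $x_i$ a hybrid arc with values in $\chi_i$ is a solution pair of subsystem $i$ if: (i) $\mathrm{dom}\,x_i=\mathrm{dom}\,u=\mathrm{dom}\,x_j$ for $j\ne i$, and $(x(0,0),u(0,0))\in C_i\cup D_i$; (ii) for all $k\in\mathbb{N}_+$ and almost all $t$ with $(t,k)\in\mathrm{dom}\,x_i$: $(x(t,k),u(t,k))\in C_i$ and $\dot x_i(t,k)=f_i(x(t,k),u(t,k))$; (iii) for all $(t,k)\in\mathrm{dom}\,x_i$ with $(t,k+1)\in\mathrm{dom}\,x_i$: $(x(t,k),u(t,k))\in D_i$ and $x_i(t,k+1)=g_i(x(t,k),u(t,k))$. Solution pairs $(x,u)$ of the overall system are defined in the same way with $f,g,C,D$. A solution pair is maximal if it cannot be extended. $S_{v_i}(x_{i0})$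 (resp. $S_u(x_0)$) is the set of maximal solution pairs of subsystem $i$ (resp. of the overall system) with $x_i(0,0)=x_{i0}$ (resp. $x(0,0)=x_0$). ISS. Subsystem $i$ is input-to-state stable (ISS) if there exist $\beta_i\in\mathcal{KLL}$ and $\gamma_{ij},\gamma_i\in\mathcal{K}_\infty\cup\{0\}$ (the nonlinear gains) such that for all initial values $x_{i0}$ each solution pair $(x_i,v_i)\in S_{v_i}(x_{i0})$ satisfies for all $(t,k)\in\mathrm{dom}\,x_i$ $$|x_i(t,k)|\le\max\{\beta_i(|x_{i0}|,t,k),\max_{j\ne i}\gamma_{ij}(\|x_j\|_{(t,k)}),\gamma_i(\|u\|_{(t,k)})\}.$$ *)

theory Defs
  imports "HOL-Analysis.Analysis" "HOL-Probability.Essential_Supremum"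
begin

section \<open>Comparison functions\<close>

text \<open>Comparison functions are represented by total functions on the reals of which only
  the values at nonnegative arguments matter.\<close>

definition class_K :: "(real \<Rightarrow> real) \<Rightarrow> bool" where
  "class_K \<gamma> \<longleftrightarrow> continuous_on {0..} \<gamma> \<and> strict_mono_on {0..} \<gamma> \<and> \<gamma> 0 = 0"

definition class_Kinf :: "(real \<Rightarrow> real) \<Rightarrow> bool" where
  "class_Kinf \<gamma> \<longleftrightarrow> class_K \<gamma> \<and> (\<forall>M. \<exists>s\<ge>0. M < \<gamma> s)"

definition class_Kinf0 :: "(real \<Rightarrow> real) \<Rightarrow> bool" where
  "class_Kinf0 \<gamma> \<longleftrightarrow> class_Kinf \<gamma> \<or> (\<forall>s\<ge>0. \<gamma> s = 0)"

definition class_KL :: "(real \<Rightarrow> real \<Rightarrow> real) \<Rightarrow> bool" where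
  "class_KL \<beta> \<longleftrightarrow>
     (\<forall>t\<ge>0. class_K (\<lambda>s. \<beta> s t)) \<and>
     (\<forall>s\<ge>0. antimono_on {0..} (\<beta> s) \<and> (\<beta> s \<longlongrightarrow> 0) at_top)"

definition class_KLL :: "(real \<Rightarrow> real \<Rightarrow> real \<Rightarrow> real) \<Rightarrow> bool" where
  "class_KLL \<beta> \<longleftrightarrow>
     (\<forall>r\<ge>0. class_KL (\<lambda>s t. \<beta> s t r) \<and> class_KL (\<lambda>s t. \<beta> s r t))"

section \<open>Hybrid time domains and hybrid signals\<close>

text \<open>A finite sequence of switching times is continued arbitrarily to an infinite
  nondecreasing one; \<open>K\<close> is the index of the last interval, if there is one. The condition
  \<open>\<tau> K < T\<close> keeps a half-open last interval nonempty.\<close>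

definition hybrid_time_domain :: "(real \<times> nat) set \<Rightarrow> bool" where
  "hybrid_time_domain E \<longleftrightarrow>
     (\<exists>\<tau>::nat \<Rightarrow> real. \<tau> 0 = 0 \<and> mono \<tau> \<and>
        (E = (\<Union>k. {\<tau> k..\<tau> (Suc k)} \<times> {k}) \<or>
         (\<exists>K L. E = (\<Union>k<K. {\<tau> k..\<tau> (Suc k)} \<times> {k}) \<union> L \<times> {K} \<and>
            (L = {\<tau> K..\<tau> (Suc K)} \<or> (\<exists>T>\<tau> K. L = {\<tau> K..<T}) \<or> L = {\<tau> K..}))))"

type_synonym 'a hsignal = "real \<times> nat \<rightharpoonup> 'a"

definition hval :: "'a hsignal \<Rightarrow> real \<Rightarrow> nat \<Rightarrow> 'a" where
  "hval u t k = the (u (t, k))"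

definition hsection :: "'a hsignal \<Rightarrow> nat \<Rightarrow> real set" where
  "hsection u k = {t. (t, k) \<in> dom u}"

definition hybrid_signal :: "'a hsignal \<Rightarrow> bool" where
  "hybrid_signal u \<longleftrightarrow> hybrid_time_domain (dom u)"

definition hybrid_input :: "'a::euclidean_space hsignal \<Rightarrow> bool" where
  "hybrid_input u \<longleftrightarrow> hybrid_signal u \<and>
     (\<forall>k. (\<lambda>t. hval u t k) \<in> borel_measurable (lebesgue_on (hsection u k)) \<and>
          (\<forall>S. compact S \<and> S \<subseteq> hsection u k \<longrightarrow>
             (\<exists>c. AE t in lebesgue_on S. norm (hval u t k) \<le> c)))"

definition abs_continuous_on :: "real set \<Rightarrow> (real \<Rightarrow> 'a::real_normed_vector) \<Rightarrow> bool" where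
  "abs_continuous_on S h \<longleftrightarrow>
     (\<forall>\<epsilon>>0. \<exists>\<delta>>0. \<forall>P. finite P \<and> (\<forall>(a, b)\<in>P. a \<le> b \<and> {a..b} \<subseteq> S) \<and>
        disjoint_family_on (\<lambda>(a, b). {a<..<b}) P \<and> (\<Sum>(a, b)\<in>P. b - a) < \<delta> \<longrightarrow>
        (\<Sum>(a, b)\<in>P. norm (h b - h a)) < \<epsilon>)"

definition hybrid_arc :: "'a::euclidean_space hsignal \<Rightarrow> bool" where
  "hybrid_arc x \<longleftrightarrow> hybrid_signal x \<and>
     (\<forall>k a b. {a..b} \<subseteq> hsection x k \<longrightarrow> abs_continuous_on {a..b} (\<lambda>t. hval x t k))"

definition jump_times :: "'a hsignal \<Rightarrow> (real \<times> nat) set" where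
  "jump_times u = {(s, l). (s, l) \<in> dom u \<and> (s, Suc l) \<in> dom u}"

text \<open>The essential supremum refers to Lebesgue measure on each level \<open>l\<close> of the hybrid time
  domain. Suprema are formed in \<^typ>\<open>ennreal\<close>, so that those over empty or null sets are 0;
  they are finite for hybrid inputs and hybrid arcs at points of their domain.\<close>

definition hnorm :: "'a::euclidean_space hsignal \<Rightarrow> real \<Rightarrow> nat \<Rightarrow> real" where
  "hnorm u t k = enn2real (max
     (SUP l. esssup
        (lebesgue_on {s. (s, l) \<in> dom u - jump_times u \<and> s + real l \<le> t + real k})
        (\<lambda>s. ennreal (norm (hval u s l))))
     (SUP (s, l)\<in>{(s, l). (s, l) \<in> jump_times u \<and> s + real l \<le> t + real k}.
        ennreal (norm (hval u s l))))"

section \<open>Interconnected hybrid systems\<close>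

text \<open>The subsystems are indexed by \<open>'n\<close> and the coordinates of the overall state space
  \<open>real ^ 'c\<close> by \<open>'c\<close>; \<open>block\<close> assigns to each coordinate the subsystem it belongs to. The state
  space of dimension \<open>N\<^sub>i\<close> of subsystem \<open>i\<close> is rendered isometrically as the coordinate subspace
  of \<open>real ^ 'c\<close> spanned by the coordinates of block \<open>i\<close>, so that \<open>N\<^sub>i\<close> is the number of
  coordinates \<open>c\<close> with \<open>block c = i\<close>, and stacking the vectors \<open>x\<^sub>i\<close> amounts to adding them.\<close>

record ('n, 'c::finite, 'm::finite) interconnection =
  block :: "'c \<Rightarrow> 'n"
  state_set :: "'n \<Rightarrow> (real ^ 'c) set"
  input_set :: "(real ^ 'm) set"
  flow_set :: "'n \<Rightarrow> ((real ^ 'c) \<times> (real ^ 'm)) set"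
  jump_set :: "'n \<Rightarrow> ((real ^ 'c) \<times> (real ^ 'm)) set"
  flow_map :: "'n \<Rightarrow> (real ^ 'c) \<times> (real ^ 'm) \<Rightarrow> real ^ 'c"
  jump_map :: "'n \<Rightarrow> (real ^ 'c) \<times> (real ^ 'm) \<Rightarrow> real ^ 'c"

definition block_space :: "('n, 'c::finite, 'm::finite) interconnection \<Rightarrow> 'n \<Rightarrow> (real ^ 'c) set" where
  "block_space H i = {x. \<forall>c. block H c \<noteq> i \<longrightarrow> x $ c = 0}"

definition block_proj ::
  "('n, 'c::finite, 'm::finite) interconnection \<Rightarrow> 'n \<Rightarrow> real ^ 'c \<Rightarrow> real ^ 'c" where
  "block_proj H i x = (\<chi> c. if block H c = i then x $ c else 0)"

definition overall_state_set :: "('n, 'c::finite, 'm::finite) interconnection \<Rightarrow> (real ^ 'c) set" where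
  "overall_state_set H = {x. \<forall>i. block_proj H i x \<in> state_set H i}"

definition overall_flow_set ::
  "('n, 'c::finite, 'm::finite) interconnection \<Rightarrow> ((real ^ 'c) \<times> (real ^ 'm)) set" where
  "overall_flow_set H = (\<Inter>i. flow_set H i)"

definition overall_jump_set ::
  "('n, 'c::finite, 'm::finite) interconnection \<Rightarrow> ((real ^ 'c) \<times> (real ^ 'm)) set" where
  "overall_jump_set H = (\<Union>i. jump_set H i)"

definition overall_flow_map ::
  "('n::finite, 'c::finite, 'm::finite) interconnection \<Rightarrow> (real ^ 'c) \<times> (real ^ 'm) \<Rightarrow> real ^ 'c" where
  "overall_flow_map H p = (\<Sum>i\<in>UNIV. flow_map H i p)"

definition overall_jump_map ::
  "('n::finite, 'c::finite, 'm::finite) interconnection \<Rightarrow> (real ^ 'c) \<times> (real ^ 'm) \<Rightarrow> real ^ 'c" where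
  "overall_jump_map H p =
     (\<Sum>i\<in>UNIV. if p \<in> jump_set H i then jump_map H i p else block_proj H i (fst p))"

definition regular_interconnection ::
  "('n::finite, 'c::finite, 'm::finite) interconnection \<Rightarrow> bool" where
  "regular_interconnection H \<longleftrightarrow>
     closed (input_set H) \<and>
     (\<forall>i. openin (top_of_set (block_space H i)) (state_set H i) \<and>
          closedin (top_of_set (overall_state_set H \<times> input_set H)) (flow_set H i) \<and>
          closedin (top_of_set (overall_state_set H \<times> input_set H)) (jump_set H i) \<and>
          flow_map H i ` flow_set H i \<subseteq> block_space H i \<and>
          jump_map H i ` jump_set H i \<subseteq> state_set H i \<and>
          continuous_on (flow_set H i) (flow_map H i) \<and>
          continuous_on (jump_set H i) (jump_map H i))"

section \<open>Solution pairs of subsystems\<close>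

definition stack :: "('n::finite \<Rightarrow> (real ^ 'c) hsignal) \<Rightarrow> real \<Rightarrow> nat \<Rightarrow> real ^ 'c" where
  "stack xs t k = (\<Sum>j\<in>UNIV. hval (xs j) t k)"

text \<open>The solution pair \<open>(x\<^sub>i, v\<^sub>i)\<close> of subsystem \<open>i\<close> is given by \<open>x\<^sub>i = xs i\<close> and
  \<open>v\<^sub>i = ((xs j)\<^sub>j, u)\<close> with \<open>j \<noteq> i\<close>.\<close>

definition sub_solution_pair ::
  "('n::finite, 'c::finite, 'm::finite) interconnection \<Rightarrow> 'n \<Rightarrow>
   ('n \<Rightarrow> (real ^ 'c) hsignal) \<Rightarrow> (real ^ 'm) hsignal \<Rightarrow> bool" where
  "sub_solution_pair H i xs u \<longleftrightarrow>
     hybrid_arc (xs i) \<and> ran (xs i) \<subseteq> state_set H i \<and>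
     (\<forall>j. j \<noteq> i \<longrightarrow> hybrid_input (xs j) \<and> ran (xs j) \<subseteq> state_set H j) \<and>
     hybrid_input u \<and> ran u \<subseteq> input_set H \<and>
     dom (xs i) = dom u \<and> (\<forall>j. j \<noteq> i \<longrightarrow> dom (xs j) = dom u) \<and>
     (stack xs 0 0, hval u 0 0) \<in> flow_set H i \<union> jump_set H i \<and>
     (\<forall>k. AE t in lebesgue. (t, k) \<in> dom (xs i) \<longrightarrow>
        (stack xs t k, hval u t k) \<in> flow_set H i \<and>
        ((\<lambda>s. hval (xs i) s k) has_vector_derivative flow_map H i (stack xs t k, hval u t k))
          (at t within hsection (xs i) k)) \<and>
     (\<forall>t k. (t, k) \<in> dom (xs i) \<and> (t, Suc k) \<in> dom (xs i) \<longrightarrow>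
        (stack xs t k, hval u t k) \<in> jump_set H i \<and>
        hval (xs i) t (Suc k) = jump_map H i (stack xs t k, hval u t k))"

definition maximal_sub_solution_pair ::
  "('n::finite, 'c::finite, 'm::finite) interconnection \<Rightarrow> 'n \<Rightarrow>
   ('n \<Rightarrow> (real ^ 'c) hsignal) \<Rightarrow> (real ^ 'm) hsignal \<Rightarrow> bool" where
  "maximal_sub_solution_pair H i xs u \<longleftrightarrow> sub_solution_pair H i xs u \<and>
     \<not> (\<exists>xs' u'. sub_solution_pair H i xs' u' \<and> (\<forall>j. xs j \<subseteq>\<^sub>m xs' j) \<and> u \<subseteq>\<^sub>m u' \<and> dom u \<subset> dom u')"

section \<open>Solution pairs of the overall system\<close>

definition solution_pair ::
  "('n::finite, 'c::finite, 'm::finite) interconnection \<Rightarrow>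
   (real ^ 'c) hsignal \<Rightarrow> (real ^ 'm) hsignal \<Rightarrow> bool" where
  "solution_pair H x u \<longleftrightarrow>
     hybrid_arc x \<and> ran x \<subseteq> overall_state_set H \<and>
     hybrid_input u \<and> ran u \<subseteq> input_set H \<and>
     dom x = dom u \<and>
     (hval x 0 0, hval u 0 0) \<in> overall_flow_set H \<union> overall_jump_set H \<and>
     (\<forall>k. AE t in lebesgue. (t, k) \<in> dom x \<longrightarrow>
        (hval x t k, hval u t k) \<in> overall_flow_set H \<and>
        ((\<lambda>s. hval x s k) has_vector_derivative overall_flow_map H (hval x t k, hval u t k))
          (at t within hsection x k)) \<and>
     (\<forall>t k. (t, k) \<in> dom x \<and> (t, Suc k) \<in> dom x \<longrightarrow>
        (hval x t k, hval u t k) \<in> overall_jump_set H \<and>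
        hval x t (Suc k) = overall_jump_map H (hval x t k, hval u t k))"

definition maximal_solution_pair ::
  "('n::finite, 'c::finite, 'm::finite) interconnection \<Rightarrow>
   (real ^ 'c) hsignal \<Rightarrow> (real ^ 'm) hsignal \<Rightarrow> bool" where
  "maximal_solution_pair H x u \<longleftrightarrow> solution_pair H x u \<and>
     \<not> (\<exists>x' u'. solution_pair H x' u' \<and> x \<subseteq>\<^sub>m x' \<and> u \<subseteq>\<^sub>m u' \<and> dom u \<subset> dom u')"

section \<open>Input-to-state stability\<close>

text \<open>The inner maximum ranges over a nonempty set if there are at least two subsystems.\<close>

definition sub_ISS ::
  "('n::finite, 'c::finite, 'm::finite) interconnection \<Rightarrow> 'n \<Rightarrow>
   ('n \<Rightarrow> real \<Rightarrow> real) \<Rightarrow> (real \<Rightarrow> real) \<Rightarrow> bool" where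
  "sub_ISS H i \<gamma> \<gamma>u \<longleftrightarrow>
     (\<forall>j. j \<noteq> i \<longrightarrow> class_Kinf0 (\<gamma> j)) \<and> class_Kinf0 \<gamma>u \<and>
     (\<exists>\<beta>. class_KLL \<beta> \<and>
        (\<forall>xi0 xs u. maximal_sub_solution_pair H i xs u \<and> hval (xs i) 0 0 = xi0 \<longrightarrow>
           (\<forall>(t, k)\<in>dom (xs i).
              norm (hval (xs i) t k) \<le>
                Max {\<beta> (norm xi0) t (real k),
                     Max ((\<lambda>j. \<gamma> j (hnorm (xs j) t k)) ` (UNIV - {i})),
                     \<gamma>u (hnorm u t k)})))"

definition overall_ISS :: "('n::finite, 'c::finite, 'm::finite) interconnection \<Rightarrow> bool" where
  "overall_ISS H \<longleftrightarrow>
     (\<exists>\<beta> \<gamma>. class_KLL \<beta> \<and> class_Kinf0 \<gamma> \<and>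
        (\<forall>x0 x u. maximal_solution_pair H x u \<and> hval x 0 0 = x0 \<longrightarrow>
           (\<forall>(t, k)\<in>dom x.
              norm (hval x t k) \<le> max (\<beta> (norm x0) t (real k)) (\<gamma> (hnorm u t k)))))"

definition Gamma_max :: "('n::finite \<Rightarrow> 'n \<Rightarrow> real \<Rightarrow> real) \<Rightarrow> real ^ 'n \<Rightarrow> real ^ 'n" where
  "Gamma_max \<gamma> s = (\<chi> i. Max ((\<lambda>j. \<gamma> i j (s $ j)) ` (UNIV - {i})))"

end

(* Fix a solution of the overall system. Its blocks solve the subsystems; they need not be maximal
   there, but a maximal extension has the same norms on the common domain unless the solution
   stops at a point of the jump set, which maximality of the overall solution excludes. So the ISS
   estimates hold along the solution, also after a restart at any of its points in C or D.

   Applied from time 0, they say that the vector M of the norms of the blocks satisfies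
   M <= max(r, Gamma_max M), where r bounds the transients and the contributions of the input. By
   the small-gain condition M <= Q(r), where Q(r) is the n-th iterate of s |-> max(r, Gamma_max s)
   from (r,...,r). This is global stability. Applied from later and later restart points, they
   improve a bound b to max(delta, Gamma_max b, input gain), and the iterates of Gamma_max from a
   vector V with Gamma_max V <= V tend to 0, which gives attractivity uniformly in bounded
   initial values. A class KL bound is then built from the two properties. *)

theory Submission
  imports Defs
begin

section \<open>Hybrid time domains\<close>

text \<open>The norms ignore the value at a single time unless a jump occurs there. Hence the end
  point of a solution may be invisible in its norm and become visible once an extension jumps from
  it; this is the case that maximality has to exclude. Equality of the jump sets is what makes each
  block a solution: at a jump of the overall system every subsystem jumps by its own map and none
  keeps its state. A restarted solution must begin in C or D, but the flow condition holds only for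
  almost all times. A suitable point is therefore searched in a window of length 2 of t + k, and
  every improvement of the bound costs this delay in addition to the decay time of the transients.
  Decay times exist only for a level delta > 0. The improvements thus level off at Q(max(delta,
  input gain)), and delta is chosen so small that Q(delta) is below the prescribed accuracy. All
  bounds are maxima of nondecreasing functions, so Q(max(a, b)) = max(Q(a), Q(b)), which separates
  the initial value from the input.\<close>

lemma hybrid_time_domainD:
  assumes "hybrid_time_domain E"
  shows htd_zero: "(0, 0) \<in> E"
    and htd_nonneg: "\<And>t k. (t, k) \<in> E \<Longrightarrow> 0 \<le> t"
    and htd_convex: "\<And>r s t k. (s, k) \<in> E \<Longrightarrow> (t, k) \<in> E \<Longrightarrow> s \<le> r \<Longrightarrow> r \<le> t \<Longrightarrow> (r, k) \<in> E"
    and htd_pred: "\<And>t k. (t, Suc k) \<in> E \<Longrightarrow> \<exists>s. (s, k) \<in> E \<and> (s, Suc k) \<in> E"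
    and htd_step: "\<And>s t k. (t, k) \<in> E \<Longrightarrow> (s, Suc k) \<in> E \<Longrightarrow> t \<le> s"
proof -
  obtain \<tau> :: "nat \<Rightarrow> real" where \<tau>: "\<tau> 0 = 0" "mono \<tau>"
    and E: "E = (\<Union>k. {\<tau> k..\<tau> (Suc k)} \<times> {k}) \<or>
         (\<exists>K L. E = (\<Union>k<K. {\<tau> k..\<tau> (Suc k)} \<times> {k}) \<union> L \<times> {K} \<and>
            (L = {\<tau> K..\<tau> (Suc K)} \<or> (\<exists>T>\<tau> K. L = {\<tau> K..<T}) \<or> L = {\<tau> K..}))"
    using assms unfolding hybrid_time_domain_def by blast
  have le: "\<tau> k \<le> \<tau> (Suc k)" for k
    using \<tau>(2) by (simp add: monoD)
  have nonneg: "0 \<le> \<tau> k" for k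
    using \<tau> monoD[of \<tau> 0 k] by simp
  define S where "S = (\<lambda>k. {t. (t, k) \<in> E})"
  \<comment> \<open>\<open>N\<close> is the set of levels in use, either all of them or
    \<open>{..K}\<close>. Only the last level can fail to be a closed interval, so these facts cover
    all shapes of domains at once.\<close>
  obtain N :: "nat set" where N: "0 \<in> N" "\<And>k. Suc k \<in> N \<Longrightarrow> k \<in> N" "\<And>k. k \<notin> N \<Longrightarrow> S k = {}"
    and S: "\<And>k. Suc k \<in> N \<Longrightarrow> S k = {\<tau> k..\<tau> (Suc k)}"
    and S': "\<And>k. k \<in> N \<Longrightarrow> \<tau> k \<in> S k \<and> S k \<subseteq> {\<tau> k..} \<and> is_interval (S k)"
  proof (cases "E = (\<Union>k. {\<tau> k..\<tau> (Suc k)} \<times> {k})")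
    case True
    have "S k = {\<tau> k..\<tau> (Suc k)}" for k
      unfolding S_def by (subst True) auto
    with le show ?thesis
      by (intro that[of UNIV]) (auto simp: is_interval_cc)
  next
    case False
    then obtain K L where E': "E = (\<Union>k<K. {\<tau> k..\<tau> (Suc k)} \<times> {k}) \<union> L \<times> {K}"
      and L: "L = {\<tau> K..\<tau> (Suc K)} \<or> (\<exists>T>\<tau> K. L = {\<tau> K..<T}) \<or> L = {\<tau> K..}"
      using E by auto
    have "S k = {\<tau> k..\<tau> (Suc k)}" if "k < K" for k
      unfolding S_def E' using that by auto
    moreover have "S K = L"
      unfolding S_def E' by auto
    moreover have "S k = {}" if "k > K" for k
      unfolding S_def E' using that by auto
    moreover have "\<tau> K \<in> L" "L \<subseteq> {\<tau> K..}" "is_interval L"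
      using L le[of K] by (auto simp: is_interval_cc is_interval_co is_interval_ci)
    ultimately show ?thesis
      using le by (intro that[of "{..K}"]) (auto simp: is_interval_cc le_less)
  qed
  have inN: "k \<in> N" if "(t, k) \<in> E" for t k
    using N(3)[of k] that by (auto simp: S_def)
  show "(0, 0) \<in> E"
    using S'[OF N(1)] \<tau> by (simp add: S_def)
  show "0 \<le> t" if "(t, k) \<in> E" for t k
    using S'[OF inN[OF that]] that nonneg[of k] by (auto simp: S_def subset_eq intro: order_trans)
  show "(r, k) \<in> E" if "(s, k) \<in> E" "(t, k) \<in> E" "s \<le> r" "r \<le> t" for r s t k
    using S'[OF inN[OF that(1)]] that unfolding S_def is_interval_1 by blast
  show "\<exists>s. (s, k) \<in> E \<and> (s, Suc k) \<in> E" if "(t, Suc k) \<in> E" for t k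
  proof
    show "(\<tau> (Suc k), k) \<in> E \<and> (\<tau> (Suc k), Suc k) \<in> E"
      using S[OF inN[OF that]] S'[OF inN[OF that]] le[of k] by (auto simp: S_def)
  qed
  show "t \<le> s" if "(t, k) \<in> E" "(s, Suc k) \<in> E" for s t k
  proof -
    have "t \<in> S k" "s \<in> S (Suc k)" using that by (auto simp: S_def)
    then show ?thesis
      using S[OF inN[OF that(2)]] S'[OF inN[OF that(2)]] by force
  qed
qed

text \<open>The number \<open>c\<close> serves as the switching time after the last level. It is the
  right end in the closed case; in the other cases only \<open>a \<le> c\<close> matters.\<close>

lemma interval_with_least:
  fixes L :: "real set"
  assumes "a \<in> L" "L \<subseteq> {a..}" "is_interval L"
  obtains c where "a \<le> c" "L = {a..c} \<or> (\<exists>T>a. L = {a..<T}) \<or> L = {a..}"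
proof (cases "bdd_above L")
  case False
  have "{a..} \<subseteq> L"
  proof
    fix t assume "t \<in> {a..}"
    moreover obtain s where "s \<in> L" "t < s"
      using False unfolding bdd_above_def by (meson linorder_not_le)
    ultimately show "t \<in> L"
      using assms(1,3) unfolding is_interval_1 by (meson atLeast_iff less_imp_le)
  qed
  then show ?thesis
    using that[of a] assms(2) by auto
next
  case True
  let ?b = "Sup L"
  have ub: "t \<le> ?b" if "t \<in> L" for t
    using True that by (rule cSup_upper[rotated])
  have mem: "t \<in> L" if "a \<le> t" "t < ?b" for t
    using less_cSupD[of L t] that assms(1,3) unfolding is_interval_1
    by (metis empty_iff less_imp_le)
  show ?thesis
  proof (cases "?b \<in> L")
    case True
    then have "L = {a..?b}"
      using ub mem assms(2) by (auto simp: le_less)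
    then show ?thesis using that[of ?b] ub assms(1) by auto
  next
    case False
    then have "L = {a..<?b}"
      using ub mem assms(2) by (auto simp: less_le)
    moreover from this have "?b > a" using assms(1) by auto
    ultimately show ?thesis using that[of a] by auto
  qed
qed

text \<open>Converse of \<open>hybrid_time_domainD\<close>. The five conditions mention no switching
  times, so they can be checked directly for unions of chains, appended jumps and tails. The
  switching times are recovered as the least elements of the levels.\<close>

lemma hybrid_time_domainI:
  assumes zero: "(0, 0) \<in> E"
    and nonneg: "\<And>t k. (t, k) \<in> E \<Longrightarrow> 0 \<le> t"
    and convex: "\<And>r s t k. (s, k) \<in> E \<Longrightarrow> (t, k) \<in> E \<Longrightarrow> s \<le> r \<Longrightarrow> r \<le> t \<Longrightarrow> (r, k) \<in> E"
    and pred: "\<And>t k. (t, Suc k) \<in> E \<Longrightarrow> \<exists>s. (s, k) \<in> E \<and> (s, Suc k) \<in> E"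
    and step: "\<And>s t k. (t, k) \<in> E \<Longrightarrow> (s, Suc k) \<in> E \<Longrightarrow> t \<le> s"
  shows "hybrid_time_domain E"
proof -
  define S where "S = (\<lambda>k. {t. (t, k) \<in> E})"
  have "\<exists>a. S k \<noteq> {} \<longrightarrow> a \<in> S k \<and> S k \<subseteq> {a..}" for k
  proof (cases k)
    case 0
    then show ?thesis using zero nonneg by (auto simp: S_def)
  next
    case (Suc m)
    then show ?thesis using pred step by (fastforce simp: S_def)
  qed
  then obtain a where a: "\<And>k. S k \<noteq> {} \<Longrightarrow> a k \<in> S k \<and> S k \<subseteq> {a k..}"
    by metis
  have int: "is_interval (S k)" for k
    unfolding is_interval_1 S_def using convex by blast
  have a0: "a 0 = 0"
    using a[of 0] zero nonneg by (force simp: S_def)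
  have down: "S k \<noteq> {}" if "S (Suc k) \<noteq> {}" for k
    using that pred by (auto simp: S_def)
  have SSuc: "S k = {a k..a (Suc k)} \<and> a k \<le> a (Suc k)" if ne: "S (Suc k) \<noteq> {}" for k
  proof -
    \<comment> \<open>A point shared by two consecutive levels is, by \<open>step\<close>, both the
      greatest point of the lower and the least of the upper one.\<close>
    have "\<exists>s. s \<in> S k \<and> s \<in> S (Suc k)"
      using ne pred by (auto simp: S_def)
    then obtain s where s: "s \<in> S k" "s \<in> S (Suc k)" by blast
    have "s \<le> a (Suc k)"
      using s(1) a[OF ne] step by (auto simp: S_def)
    moreover have "a (Suc k) \<le> s"
      using s(2) a[OF ne] by auto
    ultimately have "s = a (Suc k)" by simp
    with s have 1: "a (Suc k) \<in> S k" by simp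
    have "t \<in> S k \<longleftrightarrow> t \<in> {a k..a (Suc k)}" for t
    proof
      assume t: "t \<in> S k"
      then have "t \<le> a (Suc k)"
        using step[of t k "a (Suc k)"] a[OF ne] by (simp add: S_def)
      with t show "t \<in> {a k..a (Suc k)}" using a[OF down[OF ne]] by auto
    next
      assume "t \<in> {a k..a (Suc k)}"
      then show "t \<in> S k"
        using convex[of "a k" k "a (Suc k)" t] 1 a[OF down[OF ne]] by (simp add: S_def)
    qed
    then have "S k = {a k..a (Suc k)}" by blast
    with 1 show ?thesis by auto
  qed
  show ?thesis
  proof (cases "\<forall>k. S k \<noteq> {}")
    case True
    have "mono a"
      using SSuc True by (auto simp: mono_iff_le_Suc)
    moreover have "E = (\<Union>k. {a k..a (Suc k)} \<times> {k})"
    proof -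
      have "(t, k) \<in> E \<longleftrightarrow> t \<in> {a k..a (Suc k)}" for t k
        using SSuc[of k] True by (auto simp: S_def)
      then show ?thesis by auto
    qed
    ultimately show ?thesis
      unfolding hybrid_time_domain_def using a0 by blast
  next
    case False
    then have ex: "\<exists>k. S k = {}" by blast
    define J where "J = (LEAST k. S k = {})"
    have J: "S J = {}"
      unfolding J_def using ex by (rule LeastI_ex)
    have Jle: "J \<le> k" if "S k = {}" for k
      unfolding J_def using that by (rule Least_le)
    have "J \<noteq> 0"
    proof
      assume "J = 0"
      with J zero show False by (auto simp: S_def)
    qed
    then obtain K where K: "J = Suc K" by (cases J) auto
    have ne: "S k \<noteq> {}" if "k \<le> K" for k
      using Jle[of k] that K by auto
    have emp: "S k = {}" if "k > K" for k
      using that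
    proof (induction k)
      case (Suc k)
      then show ?case using J K down[of k] by (cases "k = K") auto
    qed simp
    obtain c where c: "a K \<le> c"
      and L: "S K = {a K..c} \<or> (\<exists>T>a K. S K = {a K..<T}) \<or> S K = {a K..}"
      using interval_with_least[of "a K" "S K"] a[OF ne[of K]] int[of K] by auto
    \<comment> \<open>Beyond \<open>K\<close> only monotonicity and, for a closed last level, the
      value \<open>c\<close> at \<open>Suc K\<close> matter, so a constant continuation is
      enough.\<close>
    define \<tau> where "\<tau> k = (if k \<le> K then a k else c)" for k
    have "mono \<tau>"
      unfolding mono_iff_le_Suc
    proof
      fix k
      show "\<tau> k \<le> \<tau> (Suc k)"
        using SSuc[OF ne[of "Suc k"]] c by (cases "k = K") (auto simp: \<tau>_def)
    qed
    moreover have "E = (\<Union>k<K. {\<tau> k..\<tau> (Suc k)} \<times> {k}) \<union> S K \<times> {K}"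
    proof -
      have "(t, k) \<in> E \<longleftrightarrow> (k < K \<and> t \<in> {\<tau> k..\<tau> (Suc k)}) \<or> (k = K \<and> t \<in> S K)" for t k
        using SSuc[of k] ne[of "Suc k"] emp[of k] by (cases k K rule: linorder_cases) (auto simp: S_def \<tau>_def)
      then show ?thesis by auto
    qed
    moreover have "S K = {\<tau> K..\<tau> (Suc K)} \<or> (\<exists>T>\<tau> K. S K = {\<tau> K..<T}) \<or> S K = {\<tau> K..}"
      using L by (simp add: \<tau>_def)
    moreover have "\<tau> 0 = 0" by (simp add: \<tau>_def a0)
    ultimately show ?thesis
      unfolding hybrid_time_domain_def by blast
  qed
qed

lemma htd_less:
  assumes E: "hybrid_time_domain E" and "(t, k) \<in> E" "(s, l) \<in> E" "k < l"
  shows "t \<le> s"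
  using assms(3,4)
proof (induction l arbitrary: s)
  case (Suc l)
  obtain r where r: "(r, l) \<in> E" "(r, Suc l) \<in> E"
    using htd_pred[OF E Suc.prems(1)] by blast
  show ?case
  proof (cases "k = l")
    case True
    then show ?thesis using htd_step[OF E] assms(2) Suc.prems by blast
  next
    case False
    then show ?thesis
      using Suc.IH[OF r(1)] Suc.prems htd_step[OF E r(1) Suc.prems(1)] by linarith
  qed
qed simp

text \<open>If l > k, then \<open>htd_less\<close> gives t \<le> s and hence t + k < s + l. So
  comparing sums, as the norms do, amounts to comparing both components.\<close>

lemma htd_order:
  assumes "hybrid_time_domain E" "(s, l) \<in> E" "(t, k) \<in> E" "s + real l \<le> t + real k"
  shows "s \<le> t" "l \<le> k"
proof -
  show "l \<le> k"
  proof (rule ccontr)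
    assume "\<not> l \<le> k"
    then show False using htd_less[OF assms(1,3,2)] assms(4) by simp
  qed
  then show "s \<le> t"
    using htd_less[OF assms(1,2,3)] assms(4) by (cases "l = k") auto
qed

text \<open>The disjunction says that \<open>a\<close> is the time at which level \<open>l\<close>
  is entered. It is preferred to minimality because it passes to any larger domain, where
  \<open>htd_least_le\<close> turns it into minimality again.\<close>

lemma htd_least:
  assumes E: "hybrid_time_domain E" and "(t, k) \<in> E" "l \<le> k"
  obtains a where "(a, l) \<in> E" "l = 0 \<and> a = 0 \<or> (\<exists>m. l = Suc m \<and> (a, m) \<in> E)"
proof -
  have "\<exists>t. (t, l) \<in> E"
    using assms(3,2)
  proof (induction l rule: inc_induct)
    case (step n)
    then show ?case using htd_pred[OF E] by blast
  qed blast
  then obtain r where r: "(r, l) \<in> E" by blast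
  show ?thesis
  proof (cases l)
    case 0
    then show ?thesis using that[of 0] htd_zero[OF E] by simp
  next
    case (Suc m)
    then show ?thesis using that htd_pred[OF E] r by blast
  qed
qed

lemma htd_least_le:
  assumes "hybrid_time_domain E" "(s, l) \<in> E" "l = 0 \<and> a = 0 \<or> (\<exists>m. l = Suc m \<and> (a, m) \<in> E)"
  shows "a \<le> s"
  using assms(3)
proof (elim disjE exE conjE)
  assume "l = 0" "a = 0"
  then show ?thesis using htd_nonneg[OF assms(1,2)] by simp
next
  fix m assume "l = Suc m" "(a, m) \<in> E"
  then show ?thesis using htd_step[OF assms(1)] assms(2) by simp
qed

lemma htd_jump:
  assumes E: "hybrid_time_domain E" and "(t, k) \<in> E" "l < k"
  obtains b where "(b, l) \<in> E" "(b, Suc l) \<in> E"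
proof -
  obtain a where "(a, Suc l) \<in> E"
    using htd_least[OF E assms(2), of "Suc l"] assms(3) by auto
  from htd_pred[OF E this] that show ?thesis by blast
qed

text \<open>The part of a level up to time \<open>t\<close> is compact even if the level itself is
  half-open, so local essential boundedness applies to it.\<close>

lemma htd_section:
  assumes E: "hybrid_time_domain E" and tk: "(t, k) \<in> E" "l \<le> k"
  obtains a b where "a \<le> b" "b \<le> t" "{s. (s, l) \<in> E \<and> s \<le> t} = {a..b}"
proof -
  obtain a where a: "(a, l) \<in> E" "l = 0 \<and> a = 0 \<or> (\<exists>m. l = Suc m \<and> (a, m) \<in> E)"
    using htd_least[OF assms] .
  obtain b where b: "(b, l) \<in> E" "b \<le> t" "\<And>s. (s, l) \<in> E \<Longrightarrow> s \<le> t \<Longrightarrow> s \<le> b"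
  proof (cases "l = k")
    case True
    show ?thesis by (rule that[of t]) (use tk True in auto)
  next
    case False
    then have l: "l < k" using tk by simp
    obtain b where b: "(b, l) \<in> E" "(b, Suc l) \<in> E"
      using htd_jump[OF E tk(1) l] .
    show ?thesis
      by (rule that[OF b(1) htd_less[OF E b(1) tk(1) l] htd_step[OF E _ b(2)]])
  qed
  have "{s. (s, l) \<in> E \<and> s \<le> t} = {a..b}"
  proof (intro equalityI subsetI)
    fix s assume "s \<in> {s. (s, l) \<in> E \<and> s \<le> t}"
    then show "s \<in> {a..b}" using htd_least_le[OF E _ a(2), of s] b(3) by simp
  next
    fix s assume "s \<in> {a..b}"
    then show "s \<in> {s. (s, l) \<in> E \<and> s \<le> t}"
      using b(2) htd_convex[OF E a(1) b(1), of s] by simp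
  qed
  moreover have "a \<le> b" using htd_least_le[OF E b(1) a(2)] .
  ultimately show ?thesis using that[of a b] b(2) by blast
qed

text \<open>A level l < k of \<open>E\<close> ends with a jump, which is also a jump of
  \<open>E'\<close>, so \<open>htd_step\<close> in \<open>E'\<close> stops the level at the same
  time. Hence an extension adds points only after those of \<open>E\<close>.\<close>

lemma htd_prefix:
  assumes E: "hybrid_time_domain E" and E': "hybrid_time_domain E'" and "E \<subseteq> E'"
    and tk: "(t, k) \<in> E" and sl: "(s, l) \<in> E'" and le: "s \<le> t" "l \<le> k"
  shows "(s, l) \<in> E"
proof -
  obtain a where a: "(a, l) \<in> E" "l = 0 \<and> a = 0 \<or> (\<exists>m. l = Suc m \<and> (a, m) \<in> E)"
    using htd_least[OF E tk le(2)] .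
  have as: "a \<le> s"
    by (rule htd_least_le[OF E' sl]) (use a(2) assms(3) in blast)
  show ?thesis
  proof (cases "l = k")
    case True
    then show ?thesis using htd_convex[OF E a(1) _ as le(1)] tk by simp
  next
    case False
    then obtain b where b: "(b, l) \<in> E" "(b, Suc l) \<in> E"
      using htd_jump[OF E tk, of l] le by auto
    have "s \<le> b" using htd_step[OF E' sl] b(2) assms(3) by blast
    then show ?thesis using htd_convex[OF E a(1) b(1) as] by blast
  qed
qed

section \<open>Norms of hybrid signals\<close>

lemma AE_lebesgue_translation:
  fixes a :: real
  assumes "AE t in lebesgue. P t"
  shows "AE t in lebesgue. P (a + t)"
proof -
  have "{t. \<not> P (a + t)} = (+) (- a) ` {t. \<not> P t}"
    by force
  then show ?thesis
    using assms null_sets_translation[of "{t. \<not> P t}" "a"]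
      negligible_translation[of "{t. \<not> P t}" "- a"]
    by (simp add: completion.AE_iff_null_sets negligible_iff_null_sets)
qed

lemma abs_continuous_on_imp_continuous_on:
  assumes "abs_continuous_on {a..b} h"
  shows "continuous_on {a..b} h"
  unfolding continuous_on_iff
proof (intro ballI allI impI)
  fix t and \<epsilon> :: real
  assume t: "t \<in> {a..b}" and "0 < \<epsilon>"
  then obtain \<delta> where \<delta>: "\<delta> > 0" and
    P: "\<And>P. finite P \<and> (\<forall>(c, d)\<in>P. c \<le> d \<and> {c..d} \<subseteq> {a..b}) \<and>
        disjoint_family_on (\<lambda>(c, d). {c<..<d}) P \<and> (\<Sum>(c, d)\<in>P. d - c) < \<delta> \<Longrightarrow>
        (\<Sum>(c, d)\<in>P. norm (h d - h c)) < \<epsilon>"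
    using assms unfolding abs_continuous_on_def by meson
  have close: "norm (h d - h c) < \<epsilon>" if "c \<in> {a..b}" "d \<in> {a..b}" "c \<le> d" "d - c < \<delta>" for c d
    using P[of "{(c, d)}"] that by (auto simp: disjoint_family_on_def)
  show "\<exists>d>0. \<forall>s\<in>{a..b}. dist s t < d \<longrightarrow> dist (h s) (h t) < \<epsilon>"
  proof (intro exI[of _ \<delta>] conjI ballI impI \<delta>)
    fix s assume "s \<in> {a..b}" "dist s t < \<delta>"
    then show "dist (h s) (h t) < \<epsilon>"
      using close[of s t] close[of t s] t
      by (cases "s \<le> t") (auto simp: dist_norm norm_minus_commute abs_if split: if_splits)
  qed
qed

lemma is_interval_hsection:
  assumes "hybrid_signal u"
  shows "is_interval (hsection u k)"
  using htd_convex[OF assms[unfolded hybrid_signal_def]]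
  unfolding is_interval_1 hsection_def by blast

lemma hsection_measurable:
  assumes "hybrid_signal u"
  shows "hsection u k \<in> sets lebesgue"
  by (rule sets_completionI_sets)
     (simp add: real_interval_borel_measurable[OF is_interval_hsection[OF assms]])

lemma jump_time_unique:
  assumes "hybrid_signal u" "(s, l) \<in> jump_times u" "(t, l) \<in> jump_times u"
  shows "s = t"
  using htd_step[OF assms(1)[unfolded hybrid_signal_def], of s l t]
    htd_step[OF assms(1)[unfolded hybrid_signal_def], of t l s] assms(2,3)
  by (auto simp: jump_times_def)

text \<open>For a hybrid input and \<open>(t, k)\<close> in its domain, this is \<open>hnorm u t k \<le> c\<close> without reference to
  the essential supremum.\<close>

definition hbound :: "'a::euclidean_space hsignal \<Rightarrow> real \<Rightarrow> nat \<Rightarrow> real \<Rightarrow> bool" where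
  "hbound u t k c \<longleftrightarrow>
     (\<forall>l. AE s in lebesgue. (s, l) \<in> dom u - jump_times u \<and> s + real l \<le> t + real k \<longrightarrow>
        norm (hval u s l) \<le> c) \<and>
     (\<forall>(s, l)\<in>jump_times u. s + real l \<le> t + real k \<longrightarrow> norm (hval u s l) \<le> c)"

lemma flow_times_measurable:
  assumes "hybrid_signal u"
  shows "{s. (s, l) \<in> dom u - jump_times u \<and> s + real l \<le> r} \<in> sets lebesgue"
proof -
  have "{s. (s, l) \<in> dom u - jump_times u \<and> s + real l \<le> r} =
      (hsection u l - hsection u (Suc l)) \<inter> {..r - real l}"
    by (auto simp: hsection_def jump_times_def)
  moreover have "{..r - real l} \<in> sets lebesgue"
    by (rule sets_completionI_sets) simp
  ultimately show ?thesis
    using hsection_measurable[OF assms] by auto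
qed

lemma AE_flow_times_iff:
  assumes "hybrid_signal u"
  shows "(AE s in lebesgue_on {s. (s, l) \<in> dom u - jump_times u \<and> s + real l \<le> r}. P s) \<longleftrightarrow>
    (AE s in lebesgue. (s, l) \<in> dom u - jump_times u \<and> s + real l \<le> r \<longrightarrow> P s)"
  using flow_times_measurable[OF assms] by (subst AE_restrict_space_iff) auto

lemma hnorm_le:
  assumes u: "hybrid_input u" and "0 \<le> c" and b: "hbound u t k c"
  shows "hnorm u t k \<le> c"
  unfolding hnorm_def
proof (intro enn2real_leI max.boundedI SUP_least)
  have hs: "hybrid_signal u" using u by (simp add: hybrid_input_def)
  fix l
  let ?S = "{s. (s, l) \<in> dom u - jump_times u \<and> s + real l \<le> t + real k}"
  \<comment> \<open>\<open>esssup\<close> of a non-measurable function is top, so measurability has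
    to be carried over to the flow times.\<close>
  have "(\<lambda>s. hval u s l) \<in> borel_measurable (lebesgue_on (hsection u l))"
    using u by (simp add: hybrid_input_def)
  then have "(\<lambda>s. hval u s l) \<in> borel_measurable (lebesgue_on ?S)"
    by (rule measurable_restrict_mono) (auto simp: hsection_def)
  then have "(\<lambda>s. ennreal (norm (hval u s l))) \<in> borel_measurable (lebesgue_on ?S)"
    by measurable
  moreover have "AE s in lebesgue_on ?S. ennreal (norm (hval u s l)) \<le> ennreal c"
    unfolding AE_flow_times_iff[OF hs] using b \<open>0 \<le> c\<close> by (simp add: hbound_def)
  ultimately show "esssup (lebesgue_on ?S) (\<lambda>s. ennreal (norm (hval u s l))) \<le> ennreal c"
    by (rule esssup_I)
next
  fix p assume "p \<in> {(s, l). (s, l) \<in> jump_times u \<and> s + real l \<le> t + real k}"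
  then show "(case p of (s, l) \<Rightarrow> ennreal (norm (hval u s l))) \<le> ennreal c"
    using b \<open>0 \<le> c\<close> by (auto simp: hbound_def ennreal_leI)
qed fact

lemma hnorm_nonneg: "0 \<le> hnorm u t k"
  by (simp add: hnorm_def)

text \<open>Up to (t, k) there are finitely many levels, each with a compact part and at most one
  jump time. The maximum of the local essential bounds and the values at the jumps is a
  bound.\<close>

lemma hbound_exists:
  assumes u: "hybrid_input u" and tk: "(t, k) \<in> dom u"
  shows "\<exists>c\<ge>0. hbound u t k c"
proof -
  have hs: "hybrid_signal u" and E: "hybrid_time_domain (dom u)"
    using u by (auto simp: hybrid_input_def hybrid_signal_def)
  have "\<exists>c. AE s in lebesgue. (s, l) \<in> dom u \<and> s + real l \<le> t + real k \<longrightarrow> norm (hval u s l) \<le> c"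
    (is "\<exists>c. ?P l c") for l
  proof (cases "l \<le> k")
    case True
    obtain a b where ab: "{s. (s, l) \<in> dom u \<and> s \<le> t} = {a..b}"
      using htd_section[OF E tk True] by metis
    then have "{a..b} \<subseteq> hsection u l" by (auto simp: hsection_def)
    then obtain c where "AE s in lebesgue_on {a..b}. norm (hval u s l) \<le> c"
      using u unfolding hybrid_input_def by (meson compact_Icc)
    then have "AE s in lebesgue. s \<in> {a..b} \<longrightarrow> norm (hval u s l) \<le> c"
      by (subst (asm) AE_restrict_space_iff) auto
    moreover have "s \<in> {a..b}" if "(s, l) \<in> dom u" "s + real l \<le> t + real k" for s
      using htd_order(1)[OF E that(1) tk that(2)] that(1) ab by blast
    ultimately show ?thesis by (intro exI[of _ c]) auto
  next
    case False
    then have "\<not> ((s, l) \<in> dom u \<and> s + real l \<le> t + real k)" for s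
      using htd_order(2)[OF E _ tk] by blast
    then show ?thesis by auto
  qed
  then obtain c where
    c: "\<And>l. AE s in lebesgue. (s, l) \<in> dom u \<and> s + real l \<le> t + real k \<longrightarrow> norm (hval u s l) \<le> c l"
    using choice[of ?P] by blast
  let ?J = "{(s, l). (s, l) \<in> jump_times u \<and> s + real l \<le> t + real k}"
  have Jk: "l \<le> k" if "(s, l) \<in> ?J" for s l
    using htd_order(2)[OF E _ tk] that by (auto simp: jump_times_def)
  have "inj_on snd ?J"
    using jump_time_unique[OF hs] by (auto simp: inj_on_def)
  moreover have "snd ` ?J \<subseteq> {..k}" using Jk by auto
  ultimately have fin: "finite ?J"
    using finite_imageD finite_subset by blast
  define C where "C = Max (insert 0 (c ` {..k} \<union> (\<lambda>(s, l). norm (hval u s l)) ` ?J))"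
  have fin': "finite (insert 0 (c ` {..k} \<union> (\<lambda>(s, l). norm (hval u s l)) ` ?J))"
    using fin by simp
  have C: "y \<le> C" if "y \<in> insert 0 (c ` {..k} \<union> (\<lambda>(s, l). norm (hval u s l)) ` ?J)" for y
    unfolding C_def using fin' that by (rule Max_ge)
  have "hbound u t k C"
    unfolding hbound_def
  proof (intro conjI allI ballI)
    fix l
    show "AE s in lebesgue. (s, l) \<in> dom u - jump_times u \<and> s + real l \<le> t + real k \<longrightarrow> norm (hval u s l) \<le> C"
      using c[of l]
    proof (rule eventually_mono)
      fix s assume *: "(s, l) \<in> dom u \<and> s + real l \<le> t + real k \<longrightarrow> norm (hval u s l) \<le> c l"
      show "(s, l) \<in> dom u - jump_times u \<and> s + real l \<le> t + real k \<longrightarrow> norm (hval u s l) \<le> C"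
      proof
        assume s: "(s, l) \<in> dom u - jump_times u \<and> s + real l \<le> t + real k"
        then have "l \<le> k" using htd_order(2)[OF E _ tk] by blast
        then have "c l \<le> C" by (intro C) auto
        with s * show "norm (hval u s l) \<le> C" by simp
      qed
    qed
  next
    fix p assume "p \<in> jump_times u"
    then show "case p of (s, l) \<Rightarrow> s + real l \<le> t + real k \<longrightarrow> norm (hval u s l) \<le> C"
      by (auto intro!: C)
  qed
  moreover have "0 \<le> C" by (rule C) simp
  ultimately show ?thesis by blast
qed

text \<open>\<open>enn2real\<close> sends infinity to 0, so finiteness of the supremum must be
  secured by \<open>hbound_exists\<close> before \<open>hnorm\<close> can be used as a
  bound.\<close>

lemma hbound_hnorm:
  assumes u: "hybrid_input u" and tk: "(t, k) \<in> dom u"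
  shows "hbound u t k (hnorm u t k)"
proof -
  have hs: "hybrid_signal u" using u by (simp add: hybrid_input_def)
  let ?S = "\<lambda>l. {s. (s, l) \<in> dom u - jump_times u \<and> s + real l \<le> t + real k}"
  let ?J = "{(s, l). (s, l) \<in> jump_times u \<and> s + real l \<le> t + real k}"
  let ?e = "\<lambda>l. esssup (lebesgue_on (?S l)) (\<lambda>s. ennreal (norm (hval u s l)))"
  let ?j = "SUP (s, l)\<in>?J. ennreal (norm (hval u s l))"
  define m where "m = max (SUP l. ?e l) ?j"
  have hn: "hnorm u t k = enn2real m" by (simp add: hnorm_def m_def)
  obtain c where c: "0 \<le> c" "hbound u t k c" using hbound_exists[OF assms] by blast
  have "(SUP l. ?e l) \<le> ennreal c"
  proof (intro SUP_least esssup_I)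
    fix l
    have "(\<lambda>s. hval u s l) \<in> borel_measurable (lebesgue_on (hsection u l))"
      using u by (simp add: hybrid_input_def)
    then have "(\<lambda>s. hval u s l) \<in> borel_measurable (lebesgue_on (?S l))"
      by (rule measurable_restrict_mono) (auto simp: hsection_def)
    then show "(\<lambda>s. ennreal (norm (hval u s l))) \<in> borel_measurable (lebesgue_on (?S l))"
      by measurable
    show "AE s in lebesgue_on (?S l). ennreal (norm (hval u s l)) \<le> ennreal c"
      unfolding AE_flow_times_iff[OF hs] using c by (simp add: hbound_def)
  qed
  moreover have "?j \<le> ennreal c"
    using c by (auto intro!: SUP_least ennreal_leI simp: hbound_def)
  ultimately have "m \<le> ennreal c"
    unfolding m_def by (rule max.boundedI)
  then have m: "m = ennreal (hnorm u t k)"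
    unfolding hn by (metis ennreal_enn2real ennreal_less_top le_less_trans)
  show ?thesis
    unfolding hbound_def
  proof (intro conjI allI ballI)
    fix l
    have "AE s in lebesgue_on (?S l). ennreal (norm (hval u s l)) \<le> ?e l"
      by (rule esssup_AE)
    moreover have "?e l \<le> m"
      unfolding m_def by (intro max.coboundedI1 SUP_upper) simp
    ultimately have "AE s in lebesgue_on (?S l). ennreal (norm (hval u s l)) \<le> m"
      by (auto elim: eventually_mono intro: order_trans)
    then show "AE s in lebesgue. (s, l) \<in> dom u - jump_times u \<and> s + real l \<le> t + real k \<longrightarrow>
        norm (hval u s l) \<le> hnorm u t k"
      unfolding AE_flow_times_iff[OF hs] m by (simp add: hnorm_nonneg)
  next
    fix p assume p: "p \<in> jump_times u"
    show "case p of (s, l) \<Rightarrow> s + real l \<le> t + real k \<longrightarrow> norm (hval u s l) \<le> hnorm u t k"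
    proof (clarify)
      fix s l assume "p = (s, l)" "s + real l \<le> t + real k"
      then have "(case (s, l) of (s, l) \<Rightarrow> ennreal (norm (hval u s l))) \<le> ?j"
        using p by (intro SUP_upper) auto
      also have "?j \<le> m" by (simp add: m_def)
      finally show "norm (hval u s l) \<le> hnorm u t k"
        unfolding m by (simp add: hnorm_nonneg)
    qed
  qed
qed

section \<open>Extension to maximal solution pairs\<close>

text \<open>Without a greatest element, choose for each rational that lies below some element of
  \<open>S\<close> an element of \<open>S\<close> above it.\<close>

lemma countable_cofinal_real:
  fixes S :: "real set"
  obtains Q where "Q \<subseteq> S" "countable Q" "\<And>t. t \<in> S \<Longrightarrow> \<exists>q\<in>Q. t \<le> q"
proof (cases "\<exists>m\<in>S. \<forall>t\<in>S. t \<le> m")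
  case True
  then obtain m where "m \<in> S" "\<And>t. t \<in> S \<Longrightarrow> t \<le> m" by blast
  then show ?thesis using that[of "{m}"] by simp
next
  case False
  define R where "R = {r\<in>\<rat>. \<exists>t\<in>S. r < t}"
  define q where "q r = (SOME t. t \<in> S \<and> r < t)" for r
  have q: "q r \<in> S \<and> r < q r" if "r \<in> R" for r
    unfolding q_def by (rule someI_ex) (use that in \<open>auto simp: R_def\<close>)
  show ?thesis
  proof (rule that[of "q ` R"])
    show "q ` R \<subseteq> S" using q by auto
    have "countable R"
      unfolding R_def by (rule countable_subset[OF _ countable_rat]) auto
    then show "countable (q ` R)" by simp
    fix t assume "t \<in> S"
    with False obtain t' where t': "t' \<in> S" "t < t'" by (meson linorder_not_le)
    then obtain r where r: "r \<in> \<rat>" "t < r" "r < t'" using Rats_dense_in_real by blast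
    then have "r \<in> R" using t' by (auto simp: R_def)
    then show "\<exists>p\<in>q ` R. t \<le> p" using q r by force
  qed
qed

lemma htd_Union_chain:
  assumes "C \<noteq> {}" and E: "\<And>c. c \<in> C \<Longrightarrow> hybrid_time_domain (E c)"
    and chain: "\<And>c d. c \<in> C \<Longrightarrow> d \<in> C \<Longrightarrow> E c \<subseteq> E d \<or> E d \<subseteq> E c"
  shows "hybrid_time_domain (\<Union>c\<in>C. E c)"
proof (rule hybrid_time_domainI)
  have pair: "\<exists>c\<in>C. p \<in> E c \<and> q \<in> E c" if "p \<in> (\<Union>c\<in>C. E c)" "q \<in> (\<Union>c\<in>C. E c)" for p q
    using that chain by blast
  show "(0, 0) \<in> (\<Union>c\<in>C. E c)"
    using assms(1) htd_zero[OF E] by blast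
  show "0 \<le> t" if "(t, k) \<in> (\<Union>c\<in>C. E c)" for t k
    using that htd_nonneg[OF E] by blast
  show "(r, k) \<in> (\<Union>c\<in>C. E c)"
    if "(s, k) \<in> (\<Union>c\<in>C. E c)" "(t, k) \<in> (\<Union>c\<in>C. E c)" "s \<le> r" "r \<le> t" for r s t k
    using pair[OF that(1,2)] htd_convex[OF E _ _ that(3,4)] by blast
  show "\<exists>s. (s, k) \<in> (\<Union>c\<in>C. E c) \<and> (s, Suc k) \<in> (\<Union>c\<in>C. E c)"
    if "(t, Suc k) \<in> (\<Union>c\<in>C. E c)" for t k
    using that htd_pred[OF E] by blast
  show "t \<le> s" if "(t, k) \<in> (\<Union>c\<in>C. E c)" "(s, Suc k) \<in> (\<Union>c\<in>C. E c)" for s t k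
    using pair[OF that] htd_step[OF E] by blast
qed

text \<open>A chain may be uncountable, but null sets and measurability survive only countable
  unions. By \<open>htd_prefix\<close> a member containing (q, k) contains all earlier points of
  level \<open>k\<close>, so members for countably many cofinal \<open>q\<close> suffice.\<close>

lemma htd_level_countable_cover:
  assumes E: "\<And>c. c \<in> C \<Longrightarrow> hybrid_time_domain (E c)"
    and chain: "\<And>c d. c \<in> C \<Longrightarrow> d \<in> C \<Longrightarrow> E c \<subseteq> E d \<or> E d \<subseteq> E c"
  obtains D where "D \<subseteq> C" "countable D"
    "{t. (t, k) \<in> (\<Union>c\<in>C. E c)} = (\<Union>c\<in>D. {t. (t, k) \<in> E c})"
proof -
  let ?S = "{t. (t, k) \<in> (\<Union>c\<in>C. E c)}"
  obtain Q where Q: "Q \<subseteq> ?S" "countable Q" "\<And>t. t \<in> ?S \<Longrightarrow> \<exists>q\<in>Q. t \<le> q"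
    using countable_cofinal_real[of ?S] by blast
  have "\<exists>c. c \<in> C \<and> (q, k) \<in> E c" if "q \<in> Q" for q
    using that Q(1) by auto
  then obtain m where m: "\<And>q. q \<in> Q \<Longrightarrow> m q \<in> C \<and> (q, k) \<in> E (m q)"
    by metis
  show ?thesis
  proof (rule that[of "m ` Q"])
    show "m ` Q \<subseteq> C" using m by auto
    show "countable (m ` Q)" using Q by simp
    show "?S = (\<Union>c\<in>m ` Q. {t. (t, k) \<in> E c})"
    proof (intro equalityI subsetI)
      fix t assume t: "t \<in> ?S"
      then obtain q where q: "q \<in> Q" "t \<le> q" using Q(3) by blast
      have htd: "hybrid_time_domain (\<Union>c\<in>C. E c)"
        using t by (intro htd_Union_chain E chain) auto
      have "E (m q) \<subseteq> (\<Union>c\<in>C. E c)" using m[OF q(1)] by blast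
      then have "(t, k) \<in> E (m q)"
        using htd_prefix[OF E htd, of "m q" q k t k] m[OF q(1)] q(2) t by simp
      then show "t \<in> (\<Union>c\<in>m ` Q. {t. (t, k) \<in> E c})" using q by auto
    qed (use m in auto)
  qed
qed

section \<open>Gluing chains of signals\<close>

text \<open>On a chain the members agree wherever they are defined, so the choice does not matter.
  Defined for any set of maps, it has its domain and range computed without the chain
  property.\<close>

definition map_Union :: "('a \<rightharpoonup> 'b) set \<Rightarrow> ('a \<rightharpoonup> 'b)" where
  "map_Union F p = (if \<exists>f\<in>F. p \<in> dom f then (SOME f. f \<in> F \<and> p \<in> dom f) p else None)"

lemma dom_map_Union: "dom (map_Union F) = (\<Union>f\<in>F. dom f)"
proof -
  have "p \<in> dom (map_Union F) \<longleftrightarrow> (\<exists>f\<in>F. p \<in> dom f)" for p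
  proof (cases "\<exists>f\<in>F. p \<in> dom f")
    case True
    then have "\<exists>f. f \<in> F \<and> p \<in> dom f" by blast
    define g where "g = (SOME f. f \<in> F \<and> p \<in> dom f)"
    have "p \<in> dom g"
      unfolding g_def using someI_ex[OF \<open>\<exists>f. f \<in> F \<and> p \<in> dom f\<close>] by blast
    moreover have "map_Union F p = g p"
      unfolding map_Union_def g_def using True by (rule if_P)
    ultimately have "p \<in> dom (map_Union F)" by (simp add: domIff)
    with True show ?thesis by blast
  qed (auto simp: map_Union_def dom_def)
  then show ?thesis by (intro set_eqI) simp
qed

lemma map_le_map_Union:
  assumes chain: "\<And>f g. f \<in> F \<Longrightarrow> g \<in> F \<Longrightarrow> f \<subseteq>\<^sub>m g \<or> g \<subseteq>\<^sub>m f" and f: "f \<in> F"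
  shows "f \<subseteq>\<^sub>m map_Union F"
  unfolding map_le_def
proof
  fix p assume p: "p \<in> dom f"
  define g where "g = (SOME f. f \<in> F \<and> p \<in> dom f)"
  have g: "g \<in> F \<and> p \<in> dom g" unfolding g_def by (rule someI[of _ f]) (use f p in simp)
  then have "f p = g p"
    using chain[OF f conjunct1[OF g]] p by (elim disjE) (simp_all add: map_le_def)
  moreover have "map_Union F p = g p"
    using f p unfolding map_Union_def g_def by (subst if_P) auto
  ultimately show "f p = map_Union F p" by simp
qed

lemma ran_map_Union_subset:
  assumes "\<And>f. f \<in> F \<Longrightarrow> ran f \<subseteq> S"
  shows "ran (map_Union F) \<subseteq> S"
proof
  fix y assume "y \<in> ran (map_Union F)"
  then obtain p where p: "map_Union F p = Some y" by (auto simp: ran_def)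
  then have ex: "\<exists>f. f \<in> F \<and> p \<in> dom f" by (auto simp: map_Union_def split: if_splits)
  define g where "g = (SOME f. f \<in> F \<and> p \<in> dom f)"
  have g: "g \<in> F" unfolding g_def using someI_ex[OF ex] by blast
  have "g p = Some y"
    using p ex unfolding map_Union_def g_def by (simp split: if_splits)
  then have "y \<in> ran g" by (rule ranI)
  then show "y \<in> S" using assms[OF g] by blast
qed

lemma hval_map_le: "f \<subseteq>\<^sub>m g \<Longrightarrow> (t, k) \<in> dom f \<Longrightarrow> hval g t k = hval f t k"
  by (simp add: hval_def map_le_def)

lemma hsection_map_le: "f \<subseteq>\<^sub>m g \<Longrightarrow> hsection f k \<subseteq> hsection g k"
  unfolding hsection_def by (blast dest: map_le_implies_dom_le)

lemma map_le_hsection_prefix: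
  assumes "hybrid_signal f" "hybrid_signal g" "f \<subseteq>\<^sub>m g" "q \<in> hsection f k"
    "s \<in> hsection g k" "s \<le> q"
  shows "s \<in> hsection f k"
  using htd_prefix[of "dom f" "dom g" q k s k] assms map_le_implies_dom_le[OF assms(3)]
  by (simp add: hybrid_signal_def hsection_def)

lemma hybrid_signal_map_Union:
  assumes "F \<noteq> {}" "\<And>f. f \<in> F \<Longrightarrow> hybrid_signal f"
    and chain: "\<And>f g. f \<in> F \<Longrightarrow> g \<in> F \<Longrightarrow> f \<subseteq>\<^sub>m g \<or> g \<subseteq>\<^sub>m f"
  shows "hybrid_signal (map_Union F)"
  unfolding hybrid_signal_def dom_map_Union
proof (rule htd_Union_chain[OF assms(1)])
  show "hybrid_time_domain (dom f)" if "f \<in> F" for f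
    using assms(2)[OF that] by (simp add: hybrid_signal_def)
  show "dom f \<subseteq> dom g \<or> dom g \<subseteq> dom f" if "f \<in> F" "g \<in> F" for f g
    using chain[OF that] map_le_implies_dom_le by blast
qed

text \<open>Measurability is pieced together from countably many members. A compact set has a
  greatest element, and the member containing that element contains the whole set, hence supplies
  the essential bound.\<close>

lemma hybrid_input_map_Union:
  fixes F :: "'a::euclidean_space hsignal set"
  assumes ne: "F \<noteq> {}" and F: "\<And>f. f \<in> F \<Longrightarrow> hybrid_input f"
    and chain: "\<And>f g. f \<in> F \<Longrightarrow> g \<in> F \<Longrightarrow> f \<subseteq>\<^sub>m g \<or> g \<subseteq>\<^sub>m f"
  shows "hybrid_input (map_Union F)"
  unfolding hybrid_input_def
proof (intro conjI allI impI)
  have sig: "hybrid_signal f" if "f \<in> F" for f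
    using F[OF that] by (simp add: hybrid_input_def)
  show hs: "hybrid_signal (map_Union F)"
    by (rule hybrid_signal_map_Union[OF ne sig chain])
  note le = map_le_map_Union[OF chain]
  fix k
  let ?S = "hsection (map_Union F) k"
  have S: "?S = {t. (t, k) \<in> (\<Union>f\<in>F. dom f)}"
    by (simp add: hsection_def dom_map_Union)
  show "(\<lambda>t. hval (map_Union F) t k) \<in> borel_measurable (lebesgue_on ?S)"
  proof -
    obtain D where D: "D \<subseteq> F" "countable D"
      and SD: "{t. (t, k) \<in> (\<Union>f\<in>F. dom f)} = (\<Union>f\<in>D. {t. (t, k) \<in> dom f})"
    proof (rule htd_level_countable_cover[of F dom k])
      show "hybrid_time_domain (dom f)" if "f \<in> F" for f
        using sig[OF that] by (simp add: hybrid_signal_def)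
      show "dom f \<subseteq> dom g \<or> dom g \<subseteq> dom f" if "f \<in> F" "g \<in> F" for f g
        using chain[OF that] map_le_implies_dom_le by blast
    qed blast
    show ?thesis
    proof (rule measurable_piecewise_restrict[where C = "(\<lambda>f. hsection f k) ` D"])
      show "countable ((\<lambda>f. hsection f k) ` D)" using D by simp
      show "space (lebesgue_on ?S) \<subseteq> \<Union> ((\<lambda>f. hsection f k) ` D)"
        using S SD by (auto simp: hsection_def)
      fix \<Omega> assume "\<Omega> \<in> (\<lambda>f. hsection f k) ` D"
      then obtain f where f: "f \<in> D" "\<Omega> = hsection f k" by blast
      then have fF: "f \<in> F" using D by blast
      have sub: "\<Omega> \<subseteq> ?S" using hsection_map_le[OF le[OF _ _ fF]] f by blast
      have m: "\<Omega> \<in> sets lebesgue" using hsection_measurable[OF sig[OF fF]] f by simp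
      show "\<Omega> \<inter> space (lebesgue_on ?S) \<in> sets (lebesgue_on ?S)"
        using m sub by (auto simp: sets_restrict_space)
      have "restrict_space (lebesgue_on ?S) \<Omega> = lebesgue_on \<Omega>"
        using sub m hsection_measurable[OF hs, of k]
        by (subst restrict_restrict_space) (auto simp: Int_absorb1)
      moreover have "(\<lambda>t. hval (map_Union F) t k) \<in> borel_measurable (lebesgue_on \<Omega>)"
      proof (subst measurable_cong)
        fix t assume "t \<in> space (lebesgue_on \<Omega>)"
        then show "hval (map_Union F) t k = hval f t k"
          using hval_map_le[OF le[OF _ _ fF]] f by (simp add: hsection_def)
      next
        show "(\<lambda>t. hval f t k) \<in> borel_measurable (lebesgue_on \<Omega>)"
          using F[OF fF] f by (simp add: hybrid_input_def)
      qed
      ultimately show "(\<lambda>t. hval (map_Union F) t k) \<in> borel_measurable (restrict_space (lebesgue_on ?S) \<Omega>)"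
        by simp
    qed
  qed
  fix K :: "real set" assume K: "compact K \<and> K \<subseteq> ?S"
  show "\<exists>c. AE t in lebesgue_on K. norm (hval (map_Union F) t k) \<le> c"
  proof (cases "K = {}")
    case True
    then show ?thesis by (simp add: AE_restrict_space_iff)
  next
    case False
    then obtain q where q: "q \<in> K" "\<And>t. t \<in> K \<Longrightarrow> t \<le> q"
      using K compact_attains_sup by metis
    have "q \<in> ?S" using K q(1) by blast
    then obtain f where f: "f \<in> F" "q \<in> hsection f k"
      unfolding S by (auto simp: hsection_def)
    have sub: "K \<subseteq> hsection f k"
      using map_le_hsection_prefix[OF sig[OF f(1)] hs le[OF _ _ f(1)] f(2)] K q(2) by blast
    then obtain c where c: "AE t in lebesgue_on K. norm (hval f t k) \<le> c"
      using F[OF f(1)] K unfolding hybrid_input_def by meson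
    have "AE t in lebesgue_on K. norm (hval (map_Union F) t k) \<le> c"
      using AE_space c
    proof eventually_elim
      case (elim t)
      then have "(t, k) \<in> dom f" using sub by (auto simp: hsection_def)
      from hval_map_le[OF le[OF _ _ f(1)] this] elim show ?case by simp
    qed
    then show ?thesis by blast
  qed
qed

text \<open>Covers block projections, functions that agree on \<open>S\<close>, and functions on a
  single point.\<close>

lemma abs_continuous_on_dominated:
  assumes dom: "\<And>s t. s \<in> S \<Longrightarrow> t \<in> S \<Longrightarrow> norm (g t - g s) \<le> norm (h t - h s)"
    and h: "abs_continuous_on S h"
  shows "abs_continuous_on S g"
  unfolding abs_continuous_on_def
proof (intro allI impI)
  fix \<epsilon> :: real assume "\<epsilon> > 0"
  then obtain \<delta> where \<delta>: "\<delta> > 0" and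
    P: "\<And>P. finite P \<and> (\<forall>(c, d)\<in>P. c \<le> d \<and> {c..d} \<subseteq> S) \<and>
        disjoint_family_on (\<lambda>(c, d). {c<..<d}) P \<and> (\<Sum>(c, d)\<in>P. d - c) < \<delta> \<Longrightarrow>
        (\<Sum>(c, d)\<in>P. norm (h d - h c)) < \<epsilon>"
    using h unfolding abs_continuous_on_def by meson
  have "(\<Sum>(c, d)\<in>P. norm (g d - g c)) < \<epsilon>"
    if P': "finite P \<and> (\<forall>(c, d)\<in>P. c \<le> d \<and> {c..d} \<subseteq> S) \<and>
        disjoint_family_on (\<lambda>(c, d). {c<..<d}) P \<and> (\<Sum>(c, d)\<in>P. d - c) < \<delta>" for P
  proof -
    have "(\<Sum>(c, d)\<in>P. norm (g d - g c)) \<le> (\<Sum>(c, d)\<in>P. norm (h d - h c))"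
    proof (rule sum_mono)
      fix p assume "p \<in> P"
      obtain c d where p: "p = (c, d)" by (cases p)
      with \<open>p \<in> P\<close> P' have "c \<le> d" "{c..d} \<subseteq> S" by auto
      then have "c \<in> S" "d \<in> S" by auto
      then show "(case p of (c, d) \<Rightarrow> norm (g d - g c)) \<le> (case p of (c, d) \<Rightarrow> norm (h d - h c))"
        using dom p by simp
    qed
    with P[OF P'] show ?thesis by simp
  qed
  with \<delta> show "\<exists>\<delta>>0. \<forall>P. finite P \<and> (\<forall>(a, b)\<in>P. a \<le> b \<and> {a..b} \<subseteq> S) \<and>
        disjoint_family_on (\<lambda>(a, b). {a<..<b}) P \<and> (\<Sum>(a, b)\<in>P. b - a) < \<delta> \<longrightarrow>
        (\<Sum>(a, b)\<in>P. norm (g b - g a)) < \<epsilon>" by blast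
qed

lemma abs_continuous_on_cong:
  assumes "\<And>t. t \<in> S \<Longrightarrow> g t = h t" "abs_continuous_on S h"
  shows "abs_continuous_on S g"
  using assms by (intro abs_continuous_on_dominated[of S g h]) auto

lemma abs_continuous_on_const: "abs_continuous_on S (\<lambda>t. c)"
  by (auto simp: abs_continuous_on_def case_prod_unfold intro: exI[of _ 1])

text \<open>Absolute continuity is required only on compact intervals, and such an interval lies in
  any member that contains its right end.\<close>

lemma hybrid_arc_map_Union:
  fixes F :: "'a::euclidean_space hsignal set"
  assumes ne: "F \<noteq> {}" and F: "\<And>f. f \<in> F \<Longrightarrow> hybrid_arc f"
    and chain: "\<And>f g. f \<in> F \<Longrightarrow> g \<in> F \<Longrightarrow> f \<subseteq>\<^sub>m g \<or> g \<subseteq>\<^sub>m f"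
  shows "hybrid_arc (map_Union F)"
  unfolding hybrid_arc_def
proof (intro conjI allI impI)
  have sig: "hybrid_signal f" if "f \<in> F" for f
    using F[OF that] by (simp add: hybrid_arc_def)
  show hs: "hybrid_signal (map_Union F)"
    by (rule hybrid_signal_map_Union[OF ne sig chain])
  note le = map_le_map_Union[OF chain]
  fix k and a b :: real
  assume ab: "{a..b} \<subseteq> hsection (map_Union F) k"
  show "abs_continuous_on {a..b} (\<lambda>t. hval (map_Union F) t k)"
  proof (cases "a \<le> b")
    case True
    then have "b \<in> hsection (map_Union F) k" using ab by auto
    then obtain f where f: "f \<in> F" "b \<in> hsection f k"
      by (auto simp: hsection_def dom_map_Union)
    have sub: "{a..b} \<subseteq> hsection f k"
      using map_le_hsection_prefix[OF sig[OF f(1)] hs le[OF _ _ f(1)] f(2)] ab by auto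
    show ?thesis
    proof (rule abs_continuous_on_cong)
      show "hval (map_Union F) t k = hval f t k" if "t \<in> {a..b}" for t
      proof (rule hval_map_le[OF le[OF _ _ f(1)]])
        show "(t, k) \<in> dom f" using sub that unfolding hsection_def by blast
      qed
      show "abs_continuous_on {a..b} (\<lambda>t. hval f t k)"
        using F[OF f(1)] sub by (simp add: hybrid_arc_def)
    qed
  qed (auto intro: abs_continuous_on_cong abs_continuous_on_const[of _ 0])
qed

lemma stack_map_le:
  assumes "\<And>j. xs j \<subseteq>\<^sub>m ys j" "\<And>j. (t, k) \<in> dom (xs j)"
  shows "stack ys t k = stack xs t k"
  unfolding stack_def using hval_map_le[OF assms] by simp

lemma countable_imp_AE_lebesgue_not_in:
  fixes N :: "real set"
  assumes "countable N"
  shows "AE t in lebesgue. t \<notin> N"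
  using countable_imp_null_set_lborel[OF assms]
  by (intro AE_not_in null_sets_completionI)

section \<open>Upper bounds of chains and Zorn's lemma\<close>

lemma sub_solution_pair_dom:
  "sub_solution_pair H i xs u \<Longrightarrow> dom (xs j) = dom u"
  unfolding sub_solution_pair_def by (cases "j = i") auto

text \<open>Provides the upper bounds for Zorn's lemma. All conditions but the one on flows concern
  one or two points, which lie in a common member of the chain; the flow condition needs a countable
  subfamily.\<close>

lemma sub_solution_pair_map_Union:
  fixes C :: "(('n::finite \<Rightarrow> (real ^ 'c) hsignal) \<times> (real ^ 'm) hsignal) set"
    and H :: "('n, 'c::finite, 'm::finite) interconnection"
  defines "X \<equiv> \<lambda>j. map_Union ((\<lambda>p. fst p j) ` C)" and "U \<equiv> map_Union (snd ` C)"
  assumes ne: "C \<noteq> {}" and C: "\<And>p. p \<in> C \<Longrightarrow> sub_solution_pair H i (fst p) (snd p)"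
    and chain: "\<And>p q. p \<in> C \<Longrightarrow> q \<in> C \<Longrightarrow>
      ((\<forall>j. fst p j \<subseteq>\<^sub>m fst q j) \<and> snd p \<subseteq>\<^sub>m snd q) \<or> ((\<forall>j. fst q j \<subseteq>\<^sub>m fst p j) \<and> snd q \<subseteq>\<^sub>m snd p)"
  shows "sub_solution_pair H i X U" "\<And>p j. p \<in> C \<Longrightarrow> fst p j \<subseteq>\<^sub>m X j" "\<And>p. p \<in> C \<Longrightarrow> snd p \<subseteq>\<^sub>m U"
proof -
  have chX: "f \<subseteq>\<^sub>m g \<or> g \<subseteq>\<^sub>m f" if "f \<in> (\<lambda>p. fst p j) ` C" "g \<in> (\<lambda>p. fst p j) ` C" for f g j
    using that chain by blast
  have chU: "f \<subseteq>\<^sub>m g \<or> g \<subseteq>\<^sub>m f" if "f \<in> snd ` C" "g \<in> snd ` C" for f g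
    using that chain by blast
  show leX: "fst p j \<subseteq>\<^sub>m X j" if "p \<in> C" for p j
    unfolding X_def by (rule map_le_map_Union[OF chX]) (use that in auto)
  show leU: "snd p \<subseteq>\<^sub>m U" if "p \<in> C" for p
    unfolding U_def by (rule map_le_map_Union[OF chU]) (use that in auto)
  have dp: "dom (fst p j) = dom (snd p)" if "p \<in> C" for p j
    by (rule sub_solution_pair_dom[OF C[OF that]])
  have dU: "dom U = (\<Union>p\<in>C. dom (snd p))"
    by (simp add: U_def dom_map_Union)
  have dX: "dom (X j) = dom U" for j
    using dp by (simp add: X_def dU dom_map_Union)
  have htdp: "hybrid_time_domain (dom (snd p))" if "p \<in> C" for p
    using C[OF that] by (simp add: sub_solution_pair_def hybrid_input_def hybrid_signal_def)
  have chd: "dom (snd p) \<subseteq> dom (snd q) \<or> dom (snd q) \<subseteq> dom (snd p)" if "p \<in> C" "q \<in> C" for p q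
    using chain[OF that] map_le_implies_dom_le by blast
  have htdU: "hybrid_time_domain (dom U)"
    unfolding dU by (rule htd_Union_chain[OF ne htdp chd])
  have stk: "stack X t k = stack (fst p) t k" and hvU: "hval U t k = hval (snd p) t k"
    and hvX: "hval (X j) t k = hval (fst p j) t k"
    if "p \<in> C" "(t, k) \<in> dom (snd p)" for p t k j
  proof -
    show "stack X t k = stack (fst p) t k"
      by (rule stack_map_le[OF leX[OF that(1)]]) (use dp that in simp)
    show "hval U t k = hval (snd p) t k"
      by (rule hval_map_le[OF leU[OF that(1)] that(2)])
    show "hval (X j) t k = hval (fst p j) t k"
      by (rule hval_map_le[OF leX[OF that(1)]]) (use dp that in simp)
  qed
  have pair: "\<exists>p\<in>C. a \<in> dom (snd p) \<and> b \<in> dom (snd p)" if ab: "a \<in> dom U" "b \<in> dom U" for a b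
  proof -
    obtain p q where pq: "p \<in> C" "q \<in> C" "a \<in> dom (snd p)" "b \<in> dom (snd q)"
      using ab unfolding dU by blast
    from chd[OF pq(1,2)] pq show ?thesis by blast
  qed
  show "sub_solution_pair H i X U"
    unfolding sub_solution_pair_def
  proof (intro conjI allI impI)
    show "hybrid_arc (X i)"
      unfolding X_def using C ne chX by (intro hybrid_arc_map_Union) (auto simp: sub_solution_pair_def)
    show "ran (X i) \<subseteq> state_set H i"
    proof -
      have "ran (fst p i) \<subseteq> state_set H i" if "p \<in> C" for p
        using C[OF that] by (simp add: sub_solution_pair_def)
      then show ?thesis unfolding X_def by (intro ran_map_Union_subset) blast
    qed
    show "hybrid_input (X j)" if "j \<noteq> i" for j
      unfolding X_def using C ne chX that by (intro hybrid_input_map_Union) (auto simp: sub_solution_pair_def)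
    show "ran (X j) \<subseteq> state_set H j" if "j \<noteq> i" for j
    proof -
      have "ran (fst p j) \<subseteq> state_set H j" if "p \<in> C" for p
        using C[OF that] \<open>j \<noteq> i\<close> by (simp add: sub_solution_pair_def)
      then show ?thesis unfolding X_def by (intro ran_map_Union_subset) blast
    qed
    show "hybrid_input U"
      unfolding U_def using C ne chU by (intro hybrid_input_map_Union) (auto simp: sub_solution_pair_def)
    show "ran U \<subseteq> input_set H"
    proof -
      have "ran (snd p) \<subseteq> input_set H" if "p \<in> C" for p
        using C[OF that] by (simp add: sub_solution_pair_def)
      then show ?thesis unfolding U_def by (intro ran_map_Union_subset) blast
    qed
    show "dom (X i) = dom U" "\<And>j. dom (X j) = dom U" by (rule dX)+
    show "(stack X 0 0, hval U 0 0) \<in> flow_set H i \<union> jump_set H i"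
    proof -
      obtain p where p: "p \<in> C" using ne by blast
      then have "(0, 0) \<in> dom (snd p)" using htd_zero[OF htdp] by blast
      with C[OF p] show ?thesis
        unfolding stk[OF p \<open>(0, 0) \<in> dom (snd p)\<close>] hvU[OF p \<open>(0, 0) \<in> dom (snd p)\<close>]
        by (simp add: sub_solution_pair_def)
    qed
    show "(stack X t k, hval U t k) \<in> jump_set H i"
      and "hval (X i) t (Suc k) = jump_map H i (stack X t k, hval U t k)"
      if tk: "(t, k) \<in> dom (X i) \<and> (t, Suc k) \<in> dom (X i)" for t k
    proof -
      obtain p where p: "p \<in> C" "(t, k) \<in> dom (snd p)" "(t, Suc k) \<in> dom (snd p)"
        using pair[of "(t, k)" "(t, Suc k)"] tk unfolding dX by blast
      have "(stack (fst p) t k, hval (snd p) t k) \<in> jump_set H i \<and>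
        hval (fst p i) t (Suc k) = jump_map H i (stack (fst p) t k, hval (snd p) t k)"
        using C[OF p(1)] p dp[OF p(1)] unfolding sub_solution_pair_def by blast
      then show "(stack X t k, hval U t k) \<in> jump_set H i"
        "hval (X i) t (Suc k) = jump_map H i (stack X t k, hval U t k)"
        unfolding stk[OF p(1,2)] hvU[OF p(1,2)] hvX[OF p(1,3)] by auto
    qed
    fix k
    obtain D where D: "D \<subseteq> C" "countable D"
      and cov: "{t. (t, k) \<in> (\<Union>p\<in>C. dom (snd p))} = (\<Union>p\<in>D. {t. (t, k) \<in> dom (snd p)})"
      using htd_level_countable_cover[of C "\<lambda>p. dom (snd p)" k, OF htdp chd] by blast
    \<comment> \<open>At the greatest time of a level of a member the derivative is taken within a
      section that ends there, while the union may continue. These times are excluded; there is at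
      most one for each of the countably many members.\<close>
    define N where "N = (\<Union>p\<in>D. {t. (t, k) \<in> dom (snd p) \<and> (\<forall>s. (s, k) \<in> dom (snd p) \<longrightarrow> s \<le> t)})"
    have "countable N"
      unfolding N_def
    proof (rule countable_UN[OF D(2)])
      fix p :: "('n \<Rightarrow> (real ^ 'c) hsignal) \<times> (real ^ 'm) hsignal"
      let ?M = "{t. (t, k) \<in> dom (snd p) \<and> (\<forall>s. (s, k) \<in> dom (snd p) \<longrightarrow> s \<le> t)}"
      have sub: "?M \<subseteq> {t}" if "t \<in> ?M" for t
      proof
        fix s assume "s \<in> ?M"
        with that have "s \<le> t" "t \<le> s" by blast+
        then have "s = t" by (rule order_antisym)
        then show "s \<in> {t}" by simp
      qed
      show "countable ?M"
      proof (cases "?M = {}")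
        case True
        then show ?thesis by (simp only: countable_empty)
      next
        case False
        then obtain t where "t \<in> ?M" by blast
        from countable_subset[OF sub[OF this]] show ?thesis by simp
      qed
    qed
    then have AEN: "AE t in lebesgue. t \<notin> N"
      by (rule countable_imp_AE_lebesgue_not_in)
    let ?Q = "\<lambda>p t. (t, k) \<in> dom (fst p i) \<longrightarrow>
        (stack (fst p) t k, hval (snd p) t k) \<in> flow_set H i \<and>
        ((\<lambda>s. hval (fst p i) s k) has_vector_derivative flow_map H i (stack (fst p) t k, hval (snd p) t k))
          (at t within hsection (fst p i) k)"
    have "AE t in lebesgue. \<forall>p\<in>D. ?Q p t"
      using C D by (subst AE_ball_countable) (auto simp: sub_solution_pair_def)
    with AEN show "AE t in lebesgue. (t, k) \<in> dom (X i) \<longrightarrow>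
        (stack X t k, hval U t k) \<in> flow_set H i \<and>
        ((\<lambda>s. hval (X i) s k) has_vector_derivative flow_map H i (stack X t k, hval U t k))
          (at t within hsection (X i) k)"
    proof eventually_elim
      case (elim t)
      show ?case
      proof
        assume "(t, k) \<in> dom (X i)"
        then have "t \<in> {t. (t, k) \<in> (\<Union>p\<in>C. dom (snd p))}"
          unfolding dX dU by (rule CollectI)
        then obtain p where p: "p \<in> D" "(t, k) \<in> dom (snd p)"
          unfolding cov by blast
        then have pC: "p \<in> C" using D by blast
        have Q: "(stack (fst p) t k, hval (snd p) t k) \<in> flow_set H i"
          "((\<lambda>s. hval (fst p i) s k) has_vector_derivative flow_map H i (stack (fst p) t k, hval (snd p) t k))
          (at t within hsection (fst p i) k)"
          using elim(2) p dp[OF pC] by auto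
        have "\<not> (\<forall>s. (s, k) \<in> dom (snd p) \<longrightarrow> s \<le> t)"
          using elim(1) p unfolding N_def by blast
        then obtain s where s: "(s, k) \<in> dom (snd p)" "t < s"
          using not_le by blast
        have tin: "t \<in> hsection (fst p i) k"
          using p dp[OF pC] by (simp add: hsection_def)
        \<comment> \<open>The member goes on until s > t, and below \<open>s\<close> the union adds
          nothing to it, so both sections agree near \<open>t\<close>.\<close>
        have eqS: "hsection (X i) k \<inter> {..<s} = hsection (fst p i) k \<inter> {..<s}"
        proof -
          have "(r, k) \<in> dom (X i) \<longleftrightarrow> (r, k) \<in> dom (fst p i)" if "r < s" for r
            using htd_prefix[OF htdp[OF pC] htdU _ s(1), of r k] that dX[of i] dp[OF pC, of i]
              map_le_implies_dom_le[OF leU[OF pC]] by auto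
          then show ?thesis by (auto simp: hsection_def)
        qed
        have at: "at t within hsection (X i) k = at t within hsection (fst p i) k"
          by (rule at_within_nhd[of t "{..<s}"]) (use s eqS in auto)
        have "((\<lambda>s. hval (X i) s k) has_vector_derivative flow_map H i (stack (fst p) t k, hval (snd p) t k))
          (at t within hsection (fst p i) k)"
        proof (rule has_vector_derivative_transform[OF tin _ Q(2)])
          show "hval (X i) r k = hval (fst p i) r k" if "r \<in> hsection (fst p i) k" for r
            by (rule hvX[OF pC]) (use that dp[OF pC] in \<open>simp add: hsection_def\<close>)
        qed
        with Q(1) show "(stack X t k, hval U t k) \<in> flow_set H i \<and>
          ((\<lambda>s. hval (X i) s k) has_vector_derivative flow_map H i (stack X t k, hval U t k))
          (at t within hsection (X i) k)"
          unfolding at stk[OF pC p(2)] hvU[OF pC p(2)] by simp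
      qed
    qed
  qed
qed

text \<open>Zorn's lemma for the solution pairs that extend \<open>(xs, u)\<close>, ordered by
  extension of all components. It makes the ISS estimates, stated for maximal pairs, accessible to
  arbitrary ones.\<close>

lemma maximal_sub_solution_pair_exists:
  assumes sol: "sub_solution_pair H i xs u"
  obtains ys v where "maximal_sub_solution_pair H i ys v" "\<And>j. xs j \<subseteq>\<^sub>m ys j" "u \<subseteq>\<^sub>m v"
proof -
  define le :: "('a \<Rightarrow> (real ^ 'b) hsignal) \<times> (real ^ 'c) hsignal \<Rightarrow> _ \<Rightarrow> bool"
    where "le p q \<longleftrightarrow> (\<forall>j. fst p j \<subseteq>\<^sub>m fst q j) \<and> snd p \<subseteq>\<^sub>m snd q" for p q
  define A where "A = {p. sub_solution_pair H i (fst p) (snd p) \<and> le (xs, u) p}"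
  have refl: "le p p" for p by (simp add: le_def)
  have trans: "le p r" if "le p q" "le q r" for p q r
    using that unfolding le_def by (meson map_le_trans)
  have antisym: "p = q" if "le p q" "le q p" for p q
  proof (rule prod_eqI)
    show "fst p = fst q"
      using that unfolding le_def by (intro ext[of "fst p"]) (meson map_le_antisym)
    show "snd p = snd q"
      using that unfolding le_def by (meson map_le_antisym)
  qed
  have "\<exists>m\<in>A. \<forall>a\<in>A. le m a \<longrightarrow> a = m"
  proof (rule predicate_Zorn)
    show "partial_order_on A (relation_of le A)"
      using refl trans antisym by (intro partial_order_on_relation_ofI) blast+
    fix C assume "C \<in> Chains (relation_of le A)"
    then have ch: "p \<in> A \<and> q \<in> A \<and> (le p q \<or> le q p)" if "p \<in> C" "q \<in> C" for p q
      using that unfolding Chains_def relation_of_def by blast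
    show "\<exists>b\<in>A. \<forall>a\<in>C. le a b"
    proof (cases "C = {}")
      case True
      then show ?thesis using sol refl by (intro bexI[of _ "(xs, u)"]) (auto simp: A_def)
    next
      case False
      let ?b = "(\<lambda>j. map_Union ((\<lambda>p. fst p j) ` C), map_Union (snd ` C))"
      have C: "sub_solution_pair H i (fst p) (snd p)" if "p \<in> C" for p
        using ch[OF that that] by (simp add: A_def)
      have chain: "((\<forall>j. fst p j \<subseteq>\<^sub>m fst q j) \<and> snd p \<subseteq>\<^sub>m snd q) \<or> ((\<forall>j. fst q j \<subseteq>\<^sub>m fst p j) \<and> snd q \<subseteq>\<^sub>m snd p)"
        if "p \<in> C" "q \<in> C" for p q
        using ch[OF that] by (simp add: le_def)
      have U: "sub_solution_pair H i (\<lambda>j. map_Union ((\<lambda>p. fst p j) ` C)) (map_Union (snd ` C))"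
        by (rule sub_solution_pair_map_Union(1)[OF False C chain])
      have up: "le p ?b" if "p \<in> C" for p
        unfolding le_def fst_conv snd_conv
      proof (intro conjI allI)
        show "fst p j \<subseteq>\<^sub>m map_Union ((\<lambda>p. fst p j) ` C)" for j
          by (rule sub_solution_pair_map_Union(2)[OF False C chain that])
        show "snd p \<subseteq>\<^sub>m map_Union (snd ` C)"
          by (rule sub_solution_pair_map_Union(3)[OF False C chain that])
      qed
      obtain p where p: "p \<in> C" using False by blast
      have "le (xs, u) ?b"
        using trans[OF _ up[OF p]] ch[OF p p] by (simp add: A_def)
      then have "?b \<in> A" using U by (simp add: A_def)
      with up show ?thesis by blast
    qed
  qed
  then obtain m where m: "m \<in> A" "\<And>a. a \<in> A \<Longrightarrow> le m a \<Longrightarrow> a = m" by blast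
  show ?thesis
  proof (rule that[of "fst m" "snd m"])
    show "xs j \<subseteq>\<^sub>m fst m j" for j using m(1) by (simp add: A_def le_def)
    show "u \<subseteq>\<^sub>m snd m" using m(1) by (simp add: A_def le_def)
    show "maximal_sub_solution_pair H i (fst m) (snd m)"
      unfolding maximal_sub_solution_pair_def
    proof (intro conjI notI)
      show "sub_solution_pair H i (fst m) (snd m)" using m(1) by (simp add: A_def)
      assume "\<exists>xs' u'. sub_solution_pair H i xs' u' \<and> (\<forall>j. fst m j \<subseteq>\<^sub>m xs' j) \<and> snd m \<subseteq>\<^sub>m u' \<and> dom (snd m) \<subset> dom u'"
      then obtain xs' u' where e: "sub_solution_pair H i xs' u'"
        "(\<forall>j. fst m j \<subseteq>\<^sub>m xs' j) \<and> snd m \<subseteq>\<^sub>m u'" "dom (snd m) \<subset> dom u'"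
        by blast
      have le': "le m (xs', u')" using e(2) by (simp add: le_def)
      with e(1) have "(xs', u') \<in> A" using trans[of "(xs, u)" m "(xs', u')"] m(1) by (simp add: A_def)
      from m(2)[OF this le'] e(3) show False by auto
    qed
  qed
qed

section \<open>The small-gain condition\<close>

lemma class_K_mono:
  assumes "class_K \<gamma>" "0 \<le> a" "a \<le> b"
  shows "\<gamma> a \<le> \<gamma> b"
  using assms strict_mono_onD[of "{0..}" \<gamma> a b] by (cases "a = b") (auto simp: class_K_def)

lemma class_Kinf0_mono:
  assumes "class_Kinf0 \<gamma>" "0 \<le> a" "a \<le> b"
  shows "\<gamma> a \<le> \<gamma> b"
  using assms class_K_mono[of \<gamma> a b] by (auto simp: class_Kinf0_def class_Kinf_def)

lemma class_Kinf0_zero: "class_Kinf0 \<gamma> \<Longrightarrow> \<gamma> 0 = 0"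
  by (auto simp: class_Kinf0_def class_Kinf_def class_K_def)

lemma class_Kinf0_nonneg: "class_Kinf0 \<gamma> \<Longrightarrow> 0 \<le> a \<Longrightarrow> 0 \<le> \<gamma> a"
  using class_Kinf0_mono[of \<gamma> 0 a] class_Kinf0_zero[of \<gamma>] by simp

lemma class_Kinf0_continuous: "class_Kinf0 \<gamma> \<Longrightarrow> continuous_on {0..} \<gamma>"
proof -
  assume "class_Kinf0 \<gamma>"
  moreover have "continuous_on {0..} \<gamma>" if "\<forall>s\<ge>0. \<gamma> s = 0"
    using that by (intro continuous_on_eq[OF continuous_on_const[of "{0..}" "0::real"]]) auto
  ultimately show ?thesis
    by (auto simp: class_Kinf0_def class_Kinf_def class_K_def)
qed

lemma continuous_on_Max:
  fixes f :: "'a \<Rightarrow> 'b::topological_space \<Rightarrow> real"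
  assumes "finite J" "J \<noteq> {}" "\<And>j. j \<in> J \<Longrightarrow> continuous_on S (f j)"
  shows "continuous_on S (\<lambda>x. Max ((\<lambda>j. f j x) ` J))"
  using assms
proof (induction J rule: finite_ne_induct)
  case (insert j J)
  have "Max ((\<lambda>j. f j x) ` insert j J) = max (f j x) (Max ((\<lambda>j. f j x) ` J))" for x
    using insert by simp
  with insert show ?case by (auto intro!: continuous_on_max)
qed simp

text \<open>Ensures that the \<open>Max\<close> in \<open>Gamma_max\<close> and in the ISS estimates
  ranges over a nonempty set.\<close>

lemma others_nonempty:
  assumes "CARD('n::finite) \<ge> 2"
  shows "UNIV - {i :: 'n} \<noteq> {}"
proof
  assume "UNIV - {i} = {}"
  then have "UNIV = {i}" by blast
  then have "CARD('n) = card {i}" by metis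
  with assms show False by simp
qed

context
  fixes \<gamma> :: "'n::finite \<Rightarrow> 'n \<Rightarrow> real \<Rightarrow> real"
  assumes card: "CARD('n) \<ge> 2"
    and Kinf0: "\<And>i j. j \<noteq> i \<Longrightarrow> class_Kinf0 (\<gamma> i j)"
begin

lemma Gamma_max_le_iff:
  "Gamma_max \<gamma> s $ i \<le> c \<longleftrightarrow> (\<forall>j. j \<noteq> i \<longrightarrow> \<gamma> i j (s $ j) \<le> c)"
  using others_nonempty[OF card, of i] by (auto simp: Gamma_max_def)

lemma Gamma_max_ge: "j \<noteq> i \<Longrightarrow> \<gamma> i j (s $ j) \<le> Gamma_max \<gamma> s $ i"
  using Gamma_max_le_iff by blast

lemma Gamma_max_attained:
  obtains j where "j \<noteq> i" "Gamma_max \<gamma> s $ i = \<gamma> i j (s $ j)"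
proof -
  have "Max ((\<lambda>j. \<gamma> i j (s $ j)) ` (UNIV - {i})) \<in> (\<lambda>j. \<gamma> i j (s $ j)) ` (UNIV - {i})"
    using others_nonempty[OF card, of i] by (intro Max_in) auto
  with that show ?thesis by (auto simp: Gamma_max_def)
qed

lemma Gamma_max_mono:
  assumes "\<And>j. 0 \<le> s $ j" "\<And>j. s $ j \<le> s' $ j"
  shows "Gamma_max \<gamma> s $ i \<le> Gamma_max \<gamma> s' $ i"
  unfolding Gamma_max_le_iff
  using class_Kinf0_mono[OF Kinf0 assms(1,2)] Gamma_max_ge by (blast intro: order_trans)

lemma Gamma_max_nonneg:
  assumes "\<And>j. 0 \<le> s $ j"
  shows "0 \<le> Gamma_max \<gamma> s $ i"
proof -
  obtain j where "j \<noteq> i" "Gamma_max \<gamma> s $ i = \<gamma> i j (s $ j)"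
    by (rule Gamma_max_attained)
  then show ?thesis using class_Kinf0_nonneg[OF Kinf0 assms] by simp
qed

lemma Gamma_max_continuous:
  assumes "\<And>j. continuous_on S (\<lambda>x. F x $ j)" "\<And>x j. x \<in> S \<Longrightarrow> 0 \<le> F x $ j"
  shows "continuous_on S (\<lambda>x. Gamma_max \<gamma> (F x) $ i)"
  unfolding Gamma_max_def vec_lambda_beta
proof (rule continuous_on_Max)
  fix j assume "j \<in> UNIV - {i}"
  then have "continuous_on {0..} (\<gamma> i j)" using class_Kinf0_continuous[OF Kinf0] by simp
  then show "continuous_on S (\<lambda>x. \<gamma> i j (F x $ j))"
    by (rule continuous_on_compose2[OF _ assms(1)]) (use assms(2) in auto)
qed (use others_nonempty[OF card] in auto)

text \<open>For r \<ge> 0, component \<open>i\<close> is the largest result of applying to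
  \<open>r\<close> at most \<open>m\<close> gains along a path of indices that leads to
  \<open>i\<close>.\<close>

primrec gain_iter :: "nat \<Rightarrow> real \<Rightarrow> real ^ 'n" where
  "gain_iter 0 r = (\<chi> i. r)"
| "gain_iter (Suc m) r = (\<chi> i. max r (Gamma_max \<gamma> (gain_iter m r) $ i))"

lemma gain_iter_ge: "r \<le> gain_iter m r $ i"
  by (cases m) auto

lemma gain_iter_nonneg: "0 \<le> r \<Longrightarrow> 0 \<le> gain_iter m r $ i"
  using gain_iter_ge order_trans by blast

lemma gain_iter_Suc_ge:
  assumes "0 \<le> r"
  shows "gain_iter m r $ i \<le> gain_iter (Suc m) r $ i"
proof (induction m arbitrary: i)
  case (Suc m)
  have "Gamma_max \<gamma> (gain_iter m r) $ i \<le> Gamma_max \<gamma> (gain_iter (Suc m) r) $ i"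
    by (rule Gamma_max_mono[OF gain_iter_nonneg[OF assms] Suc.IH])
  then show ?case by auto
qed simp

lemma gain_iter_mono_index:
  assumes "0 \<le> r" "m \<le> m'"
  shows "gain_iter m r $ i \<le> gain_iter m' r $ i"
  by (rule lift_Suc_mono_le[of "\<lambda>m. gain_iter m r $ i", OF gain_iter_Suc_ge[OF assms(1)] assms(2)])

lemma gain_iter_mono:
  assumes "0 \<le> r" "r \<le> r'"
  shows "gain_iter m r $ i \<le> gain_iter m r' $ i"
proof (induction m arbitrary: i)
  case 0
  then show ?case using assms by simp
next
  case (Suc m)
  have "Gamma_max \<gamma> (gain_iter m r) $ i \<le> Gamma_max \<gamma> (gain_iter m r') $ i"
    by (rule Gamma_max_mono[OF gain_iter_nonneg[OF assms(1)] Suc.IH])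
  then show ?case using assms by auto
qed

lemma gain_iter_zero: "gain_iter m 0 = 0"
proof (induction m)
  case (Suc m)
  have "Gamma_max \<gamma> 0 $ i = 0" for i
  proof -
    obtain j where "j \<noteq> i" "Gamma_max \<gamma> 0 $ i = \<gamma> i j (0 $ j)"
      by (rule Gamma_max_attained)
    then show ?thesis using class_Kinf0_zero[OF Kinf0] by simp
  qed
  then show ?case unfolding gain_iter.simps Suc by (simp add: vec_eq_iff)
qed (simp add: vec_eq_iff)

lemma gain_iter_continuous: "continuous_on {0..} (\<lambda>r. gain_iter m r $ i)"
proof (induction m arbitrary: i)
  case (Suc m)
  have "continuous_on {0..} (\<lambda>r. Gamma_max \<gamma> (gain_iter m r) $ i)"
    by (rule Gamma_max_continuous[OF Suc.IH]) (simp add: gain_iter_nonneg)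
  then show ?case by (auto intro!: continuous_on_max continuous_intros)
qed simp

text \<open>A strict increase at step \<open>m\<close> is caused by a strict increase of another component at the
  step before. Tracing it back through \<open>CARD('n)\<close> steps repeats an index, and the values along
  this cycle violate the small-gain condition.\<close>

lemma gain_iter_stable:
  assumes small_gain: "\<And>s. (\<forall>i. s $ i \<ge> 0) \<Longrightarrow> s \<noteq> 0 \<Longrightarrow> \<exists>i. Gamma_max \<gamma> s $ i < s $ i"
    and r: "0 \<le> r"
  shows "gain_iter (Suc CARD('n)) r $ i = gain_iter (CARD('n)) r $ i"
proof (rule ccontr)
  let ?B = "\<lambda>m i. gain_iter m r $ i"
  let ?n = "CARD('n)"
  define inc where "inc m i \<longleftrightarrow> ?B m i < ?B (Suc m) i" for m i
  assume "?B (Suc ?n) i \<noteq> ?B ?n i"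
  then have top: "inc ?n i"
    using gain_iter_Suc_ge[OF r, of ?n i] by (simp add: inc_def)
  have pre: "\<exists>j. j \<noteq> i \<and> inc m j \<and> ?B (Suc (Suc m)) i = \<gamma> i j (?B (Suc m) j)" if i: "inc (Suc m) i" for m i
  proof -
    obtain j where j: "j \<noteq> i" "Gamma_max \<gamma> (gain_iter (Suc m) r) $ i = \<gamma> i j (?B (Suc m) j)"
      by (rule Gamma_max_attained)
    have gt: "r < Gamma_max \<gamma> (gain_iter (Suc m) r) $ i" "?B (Suc m) i < Gamma_max \<gamma> (gain_iter (Suc m) r) $ i"
      using i gain_iter_ge[of r "Suc m" i] by (auto simp: inc_def simp del: gain_iter.simps(2) simp: gain_iter.simps(2)[of "Suc m"])
    \<comment> \<open>Had component \<open>j\<close> not grown, its contribution to \<open>i\<close>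
      would already be contained in the previous iterate.\<close>
    have "inc m j"
    proof (rule ccontr)
      assume "\<not> inc m j"
      then have "?B (Suc m) j = ?B m j"
        using gain_iter_Suc_ge[OF r, of m j] by (simp add: inc_def del: gain_iter.simps(2))
      then have "\<gamma> i j (?B (Suc m) j) \<le> Gamma_max \<gamma> (gain_iter m r) $ i"
        using Gamma_max_ge[OF j(1), of "gain_iter m r"] by (simp del: gain_iter.simps(2))
      also have "\<dots> \<le> ?B (Suc m) i" by simp
      finally show False using gt j(2) by linarith
    qed
    moreover have "?B (Suc (Suc m)) i = \<gamma> i j (?B (Suc m) j)"
      using gt(1) j(2) by (simp del: gain_iter.simps(2) add: gain_iter.simps(2)[of "Suc m"])
    ultimately show ?thesis using j(1) by blast
  qed
  then obtain nxt where nxt: "\<And>m i. inc (Suc m) i \<Longrightarrow>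
      nxt m i \<noteq> i \<and> inc m (nxt m i) \<and> ?B (Suc (Suc m)) i = \<gamma> i (nxt m i) (?B (Suc m) (nxt m i))"
    by metis
  \<comment> \<open>\<open>idx d\<close> is the index reached after \<open>d\<close> steps back from
    level n = \<open>CARD('n)\<close>; \<open>k m\<close> below is the same sequence numbered by
    levels.\<close>
  define idx where "idx = rec_nat i (\<lambda>d i. nxt (?n - Suc d) i)"
  have idx0: "idx 0 = i" and idxS: "idx (Suc d) = nxt (?n - Suc d) (idx d)" for d
    by (simp_all add: idx_def)
  have incd: "inc (?n - d) (idx d)" if "d \<le> ?n" for d
    using that
  proof (induction d)
    case 0
    then show ?case using top idx0 by simp
  next
    case (Suc d)
    then have "inc (Suc (?n - Suc d)) (idx d)" by (simp add: Suc_diff_Suc)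
    then show ?case using nxt idxS by metis
  qed
  define k where "k m = idx (?n - m)" for m
  have inck: "inc m (k m)" if "m \<le> ?n" for m
    using incd[of "?n - m"] that by (simp add: k_def)
  have step: "k m \<noteq> k (Suc m) \<and> ?B (Suc (Suc m)) (k (Suc m)) = \<gamma> (k (Suc m)) (k m) (?B (Suc m) (k m))"
    if "Suc m \<le> ?n" for m
  proof -
    have eq: "?n - m = Suc (?n - Suc m)" "?n - Suc (?n - Suc m) = m" using that by auto
    have "k m = nxt m (k (Suc m))"
      unfolding k_def eq(1) idxS eq(2) ..
    with nxt[OF inck[OF that]] show ?thesis by metis
  qed
  \<comment> \<open>There are n + 1 levels 0, ..., n but only n indices.\<close>
  have "\<not> inj_on k {..?n}"
    using card_inj_on_le[of k "{..?n}" UNIV] by fastforce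
  then obtain a b where ab: "a < b" "b \<le> ?n" "k a = k b"
    unfolding inj_on_def by (metis atMost_iff linorder_neqE_nat)
  \<comment> \<open>The vector \<open>s\<close> takes for each index of the cycle its largest value
    at the levels a < m \<le> b, and 0 off the cycle. Level \<open>a\<close> can be left out because
    \<open>k a = k b\<close> and the iterates increase. So each of these values has its predecessor
    at a level from \<open>a\<close> on, where \<open>s\<close> still dominates.\<close>
  let ?V = "\<lambda>i. (\<lambda>m. ?B (Suc m) i) ` {m. a < m \<and> m \<le> b \<and> k m = i}"
  define s :: "real ^ 'n" where "s = (\<chi> i. Max (insert 0 (?V i)))"
  have fin: "finite (insert 0 (?V i))" for i by simp
  have s_ge: "?B (Suc m) (k m) \<le> s $ k m" if "a \<le> m" "m \<le> b" for m
  proof (cases "m = a")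
    case True
    have "?B (Suc m) (k m) \<le> ?B (Suc b) (k b)"
      using gain_iter_mono_index[OF r, of "Suc m" "Suc b" "k b"] True ab by simp
    also have "\<dots> \<le> s $ k b"
      unfolding s_def vec_lambda_beta using ab by (intro Max_ge[OF fin]) auto
    finally show ?thesis using True ab by simp
  next
    case False
    then show ?thesis
      unfolding s_def vec_lambda_beta using that by (intro Max_ge[OF fin]) auto
  qed
  have s0: "0 \<le> s $ i" for i
    unfolding s_def vec_lambda_beta by (intro Max_ge[OF fin]) auto
  have "0 < ?B (Suc b) (k b)"
    using inck[OF ab(2)] gain_iter_nonneg[OF r, of b "k b"] by (simp add: inc_def del: gain_iter.simps(2))
  then have "s $ k b > 0" using s_ge[of b] ab by (simp del: gain_iter.simps(2))
  then have "s \<noteq> 0" by auto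
  then obtain l where l: "Gamma_max \<gamma> s $ l < s $ l"
    using small_gain s0 by blast
  have "s $ l \<in> insert 0 (?V l)"
    unfolding s_def vec_lambda_beta by (rule Max_in[OF fin]) simp
  then show False
  proof
    assume "s $ l = 0"
    then show False using l Gamma_max_nonneg[OF s0, of l] by simp
  next
    assume "s $ l \<in> ?V l"
    then obtain m where m: "a < m" "m \<le> b" "k m = l" "s $ l = ?B (Suc m) l" by auto
    then obtain m' where m': "m = Suc m'" by (cases m) auto
    have ne: "k m' \<noteq> l" using step[of m'] m ab m' by auto
    have "s $ l = \<gamma> l (k m') (?B (Suc m') (k m'))"
      using step[of m'] m ab m' by auto
    also have "\<dots> \<le> \<gamma> l (k m') (s $ k m')"
      by (rule class_Kinf0_mono[OF Kinf0[OF ne] gain_iter_nonneg[OF r] s_ge]) (use m m' in auto)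
    also have "\<dots> \<le> Gamma_max \<gamma> s $ l" by (rule Gamma_max_ge[OF ne])
    finally show False using l by simp
  qed
qed

text \<open>Stability makes the iterate a fixed point of s \<mapsto> max(r, \<open>Gamma_max\<close>
  s). This yields the vectors from which the iteration of \<open>Gamma_max\<close>
  decreases.\<close>

lemma Gamma_max_gain_iter_le:
  assumes small_gain: "\<And>s. (\<forall>i. s $ i \<ge> 0) \<Longrightarrow> s \<noteq> 0 \<Longrightarrow> \<exists>i. Gamma_max \<gamma> s $ i < s $ i"
    and r: "0 \<le> r"
  shows "Gamma_max \<gamma> (gain_iter (CARD('n)) r) $ i \<le> gain_iter (CARD('n)) r $ i"
  using gain_iter_stable[OF assms, of i] by simp

text \<open>If \<open>Q\<close> is the bound, the components exceeding it form a vector \<open>s\<close> with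
  \<open>Gamma_max \<gamma> s \<ge> s\<close>.\<close>

lemma small_gain_bound:
  assumes small_gain: "\<And>s. (\<forall>i. s $ i \<ge> 0) \<Longrightarrow> s \<noteq> 0 \<Longrightarrow> \<exists>i. Gamma_max \<gamma> s $ i < s $ i"
    and r: "0 \<le> r" and M: "\<And>i. 0 \<le> M $ i" "\<And>i. M $ i \<le> max r (Gamma_max \<gamma> M $ i)"
  shows "M $ i \<le> gain_iter (CARD('n)) r $ i"
proof (rule ccontr)
  let ?Q = "gain_iter (CARD('n)) r"
  assume i: "\<not> M $ i \<le> ?Q $ i"
  define s :: "real ^ 'n" where "s = (\<chi> i. if M $ i > ?Q $ i then M $ i else 0)"
  have s0: "0 \<le> s $ i" for i using M(1) by (simp add: s_def)
  have "s $ i > 0" using i gain_iter_nonneg[OF r, of "CARD('n)" i] by (auto simp: s_def)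
  then have "s \<noteq> 0" by auto
  then obtain l where l: "Gamma_max \<gamma> s $ l < s $ l" using small_gain s0 by blast
  then have lQ: "M $ l > ?Q $ l" "s $ l = M $ l"
    using Gamma_max_nonneg[OF s0, of l] by (auto simp: s_def split: if_splits)
  obtain j where j: "j \<noteq> l" "Gamma_max \<gamma> M $ l = \<gamma> l j (M $ j)" by (rule Gamma_max_attained)
  \<comment> \<open>Since M at \<open>l\<close> exceeds Q at \<open>l\<close>, hence
    \<open>r\<close>, its bound must come from \<open>Gamma_max\<close>. The gain attaining it comes
    either from another exceeding component or from one below \<open>?Q\<close>; both are
    contradictory.\<close>
  have le: "M $ l \<le> \<gamma> l j (M $ j)"
    using M(2)[of l] j(2) lQ(1) gain_iter_ge[of r "CARD('n)" l] by auto
  show False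
  proof (cases "M $ j > ?Q $ j")
    case True
    then have "\<gamma> l j (M $ j) \<le> Gamma_max \<gamma> s $ l"
      using Gamma_max_ge[OF j(1), of s] by (simp add: s_def)
    with le l lQ show False by simp
  next
    case False
    then have "\<gamma> l j (M $ j) \<le> \<gamma> l j (?Q $ j)"
      by (intro class_Kinf0_mono[OF Kinf0[OF j(1)] M(1)]) simp
    also have "\<dots> \<le> Gamma_max \<gamma> ?Q $ l" by (rule Gamma_max_ge[OF j(1)])
    also have "\<dots> \<le> ?Q $ l" by (rule Gamma_max_gain_iter_le[OF small_gain r])
    finally show False using le lQ by simp
  qed
qed

text \<open>A gain at the maximum of two numbers is one of its two values there. This keeps the
  decaying and the stationary part of a bound apart during the iteration.\<close>

lemma Gamma_max_max:
  assumes "\<And>j. 0 \<le> a $ j" "\<And>j. 0 \<le> b $ j"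
  shows "Gamma_max \<gamma> (\<chi> j. max (a $ j) (b $ j)) $ i \<le> max (Gamma_max \<gamma> a $ i) (Gamma_max \<gamma> b $ i)"
  unfolding Gamma_max_le_iff
proof (intro allI impI)
  fix j assume j: "j \<noteq> i"
  show "\<gamma> i j ((\<chi> j. max (a $ j) (b $ j)) $ j) \<le> max (Gamma_max \<gamma> a $ i) (Gamma_max \<gamma> b $ i)"
    using Gamma_max_ge[OF j, of a] Gamma_max_ge[OF j, of b] by (auto simp: max_def)
qed

text \<open>The iterates decrease and are nonnegative, so they converge to some \<open>s\<close>.
  Continuity of the gains gives s \<le> \<open>Gamma_max\<close> s, and the small-gain condition
  leaves only s = 0.\<close>

lemma Gamma_max_funpow_tendsto_0:
  assumes small_gain: "\<And>s. (\<forall>i. s $ i \<ge> 0) \<Longrightarrow> s \<noteq> 0 \<Longrightarrow> \<exists>i. Gamma_max \<gamma> s $ i < s $ i"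
    and v: "\<And>i. 0 \<le> v $ i" "\<And>i. Gamma_max \<gamma> v $ i \<le> v $ i"
  shows "(\<lambda>m. (Gamma_max \<gamma> ^^ m) v $ i) \<longlonglongrightarrow> 0"
proof -
  let ?G = "\<lambda>m. (Gamma_max \<gamma> ^^ m) v"
  have pos: "0 \<le> ?G m $ i" for m i
    by (induction m arbitrary: i) (use v Gamma_max_nonneg in auto)
  have dec: "?G (Suc m) $ i \<le> ?G m $ i" for m i
  proof (induction m arbitrary: i)
    case (Suc m)
    show ?case using Gamma_max_mono[OF pos Suc.IH, of i] by simp
  qed (use v in simp)
  have "\<exists>L. (\<lambda>m. ?G m $ i) \<longlonglongrightarrow> L" for i
  proof -
    have "decseq (\<lambda>m. ?G m $ i)" using dec by (rule decseq_SucI)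
    then show ?thesis using decseq_convergent[of "\<lambda>m. ?G m $ i" 0] pos by metis
  qed
  then obtain L where L: "\<And>i. (\<lambda>m. ?G m $ i) \<longlonglongrightarrow> L i" by metis
  define s :: "real ^ 'n" where "s = (\<chi> i. L i)"
  have s0: "0 \<le> s $ i" for i
    unfolding s_def vec_lambda_beta by (rule LIMSEQ_le_const[OF L]) (use pos in auto)
  have "s $ i \<le> Gamma_max \<gamma> s $ i" for i
  proof -
    have "continuous_on {0..} (\<gamma> i j)" if "j \<noteq> i" for j
      using class_Kinf0_continuous[OF Kinf0[OF that]] .
    then have lim: "(\<lambda>m. \<gamma> i j (?G m $ j)) \<longlonglongrightarrow> \<gamma> i j (s $ j)" if "j \<noteq> i" for j
      using that L[of j] s0 pos
      by (intro continuous_on_tendsto_compose[of "{0..}" "\<gamma> i j"]) (auto simp: s_def)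
    have "L i \<le> Gamma_max \<gamma> s $ i + e" if e: "e > 0" for e
    proof -
      have "\<forall>\<^sub>F m in sequentially. \<forall>j\<in>UNIV - {i}. \<gamma> i j (?G m $ j) < Gamma_max \<gamma> s $ i + e"
      proof (intro eventually_ball_finite ballI)
        fix j assume j: "j \<in> UNIV - {i}"
        have "\<gamma> i j (s $ j) < Gamma_max \<gamma> s $ i + e"
          using Gamma_max_ge[of j i s] j e by simp
        with lim[of j] j show "\<forall>\<^sub>F m in sequentially. \<gamma> i j (?G m $ j) < Gamma_max \<gamma> s $ i + e"
          by (intro order_tendstoD(2)) auto
      qed simp
      then obtain m where m: "\<forall>j\<in>UNIV - {i}. \<gamma> i j (?G m $ j) < Gamma_max \<gamma> s $ i + e"
        using eventually_happens'[OF sequentially_bot] by blast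
      have "L i \<le> ?G (Suc m) $ i"
        by (rule decseq_ge[OF decseq_SucI[of "\<lambda>m. ?G m $ i", OF dec] L])
      also have "\<dots> \<le> Gamma_max \<gamma> s $ i + e"
        using m by (auto simp: Gamma_max_le_iff less_imp_le)
      finally show ?thesis .
    qed
    then show ?thesis by (simp add: s_def field_le_epsilon)
  qed
  then have "s = 0" using small_gain[of s] s0 by (meson not_less)
  then have "L i = 0" by (simp add: s_def vec_eq_iff)
  with L[of i] show ?thesis by simp
qed

end

section \<open>Class KL bounds\<close>

definition cutoff :: "real \<Rightarrow> real \<Rightarrow> real" where
  "cutoff s r = max 0 (min 1 (2 - r / s))"

lemma cutoff_bounds: "0 \<le> cutoff s r" "cutoff s r \<le> 1"
  by (auto simp: cutoff_def)

lemma cutoff_eq_1: "0 < s \<Longrightarrow> r \<le> s \<Longrightarrow> cutoff s r = 1"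
  by (simp add: cutoff_def field_simps)

lemma cutoff_eq_0: "0 < s \<Longrightarrow> 2 * s \<le> r \<Longrightarrow> cutoff s r = 0"
  by (simp add: cutoff_def field_simps)

lemma cutoff_mono:
  assumes "0 \<le> r" "0 < s" "s \<le> s'"
  shows "cutoff s r \<le> cutoff s' r"
proof -
  have "r / s' \<le> r / s" using assms by (intro divide_left_mono) auto
  then show ?thesis by (auto simp: cutoff_def)
qed

text \<open>Clamping to [0, 1] does not increase distances, so it is enough to estimate r / s' - r /
  s = r (s - s') / (s s'), where s s' is at least the square of \<delta>.\<close>

lemma cutoff_lipschitz:
  assumes "0 \<le> r" "r \<le> K" "0 < \<delta>" "\<delta> \<le> s" "\<delta> \<le> s'"
  shows "cutoff s r \<le> cutoff s' r + K / \<delta>\<^sup>2 * \<bar>s - s'\<bar>"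
proof -
  have pos: "0 < s" "0 < s'" using assms by auto
  have "r / s' - r / s = r * (s - s') / (s * s')"
    using pos by (simp add: field_simps)
  also have "\<dots> \<le> K * \<bar>s - s'\<bar> / (s * s')"
  proof (rule divide_right_mono)
    have "r * (s - s') \<le> r * \<bar>s - s'\<bar>" using assms by (intro mult_left_mono) auto
    also have "\<dots> \<le> K * \<bar>s - s'\<bar>" using assms by (intro mult_right_mono) auto
    finally show "r * (s - s') \<le> K * \<bar>s - s'\<bar>" .
  qed (use pos in simp)
  also have "\<dots> \<le> K * \<bar>s - s'\<bar> / \<delta>\<^sup>2"
  proof (rule divide_left_mono)
    show "\<delta>\<^sup>2 \<le> s * s'"
      unfolding power2_eq_square using assms pos by (intro mult_mono) auto
  qed (use assms pos in auto)
  finally have "r / s' - r / s \<le> K / \<delta>\<^sup>2 * \<bar>s - s'\<bar>" by simp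
  moreover have "0 \<le> K / \<delta>\<^sup>2 * \<bar>s - s'\<bar>" using assms by simp
  ultimately show ?thesis by (auto simp: cutoff_def)
qed

text \<open>The bound at \<open>s\<close> is the supremum of the recorded values \<open>y\<close>, weighted with a cutoff that is 1 for
  \<open>r \<le> s\<close> and vanishes for \<open>r \<ge> 2 s\<close>: the weight is Lipschitz in \<open>s\<close> uniformly in \<open>r\<close>, hence so is the
  supremum. Adding \<open>s * exp (- \<tau>)\<close> makes it strictly increasing.\<close>

lemma class_KL_from_uniform_attractivity:
  fixes P :: "real \<Rightarrow> real \<Rightarrow> real \<Rightarrow> bool"
  assumes \<sigma>: "class_K \<sigma>"
    and bound: "\<And>r \<tau> y. P r \<tau> y \<Longrightarrow> 0 \<le> r \<and> 0 \<le> \<tau> \<and> 0 \<le> y \<and> y \<le> \<sigma> r"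
    and attr: "\<And>r \<epsilon>. 0 \<le> r \<Longrightarrow> 0 < \<epsilon> \<Longrightarrow> \<exists>T. \<forall>r' \<tau> y. P r' \<tau> y \<and> r' \<le> r \<and> T \<le> \<tau> \<longrightarrow> y \<le> \<epsilon>"
  obtains \<beta> where "class_KL \<beta>" "\<And>r \<tau> y. P r \<tau> y \<Longrightarrow> y \<le> \<beta> r \<tau>"
proof -
  have \<sigma>0: "\<sigma> 0 = 0" and \<sigma>cont: "continuous_on {0..} \<sigma>"
    using \<sigma> by (auto simp: class_K_def)
  have \<sigma>mono: "\<sigma> a \<le> \<sigma> b" if "0 \<le> a" "a \<le> b" for a b
    using \<sigma> that strict_mono_onD[of "{0..}" \<sigma> a b] by (cases "a = b") (auto simp: class_K_def)
  \<comment> \<open>Collecting all later times makes the supremum nonincreasing in \<tau>. The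
    inserted 0 keeps the set nonempty and the supremum nonnegative.\<close>
  define V where "V s \<tau> = insert 0 {y * cutoff s r | r \<tau>' y. P r \<tau>' y \<and> \<tau> \<le> \<tau>'}" for s \<tau>
  \<comment> \<open>At s = 0 the convention r / 0 = 0 would give every value the weight 1, so the
    value 0 is prescribed.\<close>
  define B where "B s \<tau> = (if s \<le> 0 then 0 else Sup (V s \<tau>))" for s \<tau>
  have V0: "0 \<in> V s \<tau>" for s \<tau> by (simp add: V_def)
  have VI: "y * cutoff s r \<in> V s \<tau>" if "P r \<tau>' y" "\<tau> \<le> \<tau>'" for y s r \<tau> \<tau>'
    using that by (auto simp: V_def)
  have VE: "v \<le> c" if "v \<in> V s \<tau>" "0 \<le> c"
    "\<And>r \<tau>' y. P r \<tau>' y \<Longrightarrow> \<tau> \<le> \<tau>' \<Longrightarrow> y * cutoff s r \<le> c" for v s \<tau> c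
    using that by (auto simp: V_def)
  have le_if: "y * cutoff s r \<le> c" if "0 < s" "0 \<le> c" "P r \<tau>' y" "r \<le> 2 * s \<Longrightarrow> y \<le> c" for y s r \<tau>' c
  proof (cases "r \<le> 2 * s")
    case True
    have "y * cutoff s r \<le> y * 1"
      using bound[OF that(3)] cutoff_bounds[of s r] by (intro mult_left_mono) auto
    with that(4)[OF True] show ?thesis by simp
  qed (use that cutoff_eq_0 in simp)
  have V\<sigma>: "v \<le> \<sigma> (2 * s)" if s: "0 < s" and v: "v \<in> V s \<tau>" for v s \<tau>
  proof (rule VE[OF v])
    show nn: "0 \<le> \<sigma> (2 * s)" using \<sigma>mono[of 0 "2 * s"] \<sigma>0 s by simp
    show "y * cutoff s r \<le> \<sigma> (2 * s)" if "P r \<tau>' y" for r \<tau>' y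
      by (rule le_if[OF s nn that]) (use bound[OF that] \<sigma>mono[of r "2 * s"] in linarith)
  qed
  have bdd: "bdd_above (V s \<tau>)" if "0 < s" for s \<tau>
    using V\<sigma>[OF that] by (auto simp: bdd_above_def)
  have upper: "v \<le> B s \<tau>" if "0 < s" "v \<in> V s \<tau>" for v s \<tau>
    using that bdd[OF that(1)] by (simp add: B_def cSup_upper)
  have least: "B s \<tau> \<le> c" if "0 < s" "\<And>v. v \<in> V s \<tau> \<Longrightarrow> v \<le> c" for s \<tau> c
    using that V0[of s \<tau>] by (auto simp: B_def intro!: cSup_least)
  have Bnn: "0 \<le> B s \<tau>" for s \<tau>
    using upper[OF _ V0, of s \<tau>] by (cases "0 < s") (auto simp: B_def)
  have B\<sigma>: "B s \<tau> \<le> \<sigma> (2 * s)" if "0 \<le> s" for s \<tau>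
    using that least[OF _ V\<sigma>, of s \<tau>] \<sigma>0 by (cases "s = 0") (auto simp: B_def)
  have Bmono: "B s \<tau> \<le> B s' \<tau>" if "0 \<le> s" "s \<le> s'" for s s' \<tau>
  proof (cases "s = 0")
    case False
    then have s: "0 < s" "0 < s'" using that by auto
    show ?thesis
    proof (rule least[OF s(1)], rule VE)
      show "y * cutoff s r \<le> B s' \<tau>" if "P r \<tau>' y" "\<tau> \<le> \<tau>'" for r \<tau>' y
      proof -
        have "y * cutoff s r \<le> y * cutoff s' r"
          using bound[OF that(1)] cutoff_mono[of r s s'] s \<open>s \<le> s'\<close> by (intro mult_left_mono) auto
        also have "\<dots> \<le> B s' \<tau>" by (rule upper[OF s(2) VI[OF that]])
        finally show ?thesis .
      qed
    qed (use Bnn in auto)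
  qed (use Bnn in \<open>simp add: B_def\<close>)
  have Banti: "B s \<tau>' \<le> B s \<tau>" if "\<tau> \<le> \<tau>'" for s \<tau> \<tau>'
  proof (cases "0 < s")
    case True
    show ?thesis
    proof (rule least[OF True])
      fix v assume "v \<in> V s \<tau>'"
      moreover have "V s \<tau>' \<subseteq> V s \<tau>" using that by (force simp: V_def)
      ultimately show "v \<le> B s \<tau>" using upper[OF True] by blast
    qed
  qed (simp add: B_def)
  have Blim: "(B s \<longlongrightarrow> 0) at_top" if "0 \<le> s" for s
  proof (cases "s = 0")
    case False
    then have s: "0 < s" using that by simp
    show ?thesis
    proof (rule tendstoI)
      fix e :: real assume "e > 0"
      then obtain T where T: "\<And>r' \<tau> y. P r' \<tau> y \<Longrightarrow> r' \<le> 2 * s \<Longrightarrow> T \<le> \<tau> \<Longrightarrow> y \<le> e / 2"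
        using attr[of "2 * s" "e / 2"] s by auto
      have "dist (B s \<tau>) 0 < e" if "T \<le> \<tau>" for \<tau>
      proof -
        have "B s \<tau> \<le> e / 2"
        proof (rule least[OF s], rule VE)
          show "y * cutoff s r \<le> e / 2" if "P r \<tau>' y" "\<tau> \<le> \<tau>'" for r \<tau>' y
            by (rule le_if[OF s _ that(1)]) (use T[OF that(1)] \<open>T \<le> \<tau>\<close> that(2) \<open>e > 0\<close> in auto)
        qed (use \<open>e > 0\<close> in auto)
        then show ?thesis using Bnn[of s \<tau>] \<open>e > 0\<close> by (simp add: dist_norm)
      qed
      then show "\<forall>\<^sub>F \<tau> in at_top. dist (B s \<tau>) 0 < e"
        unfolding eventually_at_top_linorder by blast
    qed
  qed (simp add: B_def[abs_def])
  \<comment> \<open>Only r \<le> 2 s \<le> 2 K has positive weight at \<open>s\<close>, and there y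
    \<le> \<sigma>(2 K); this is multiplied by the Lipschitz constant of the cutoff for r \<le> 2
    K.\<close>
  have Blip: "B s \<tau> \<le> B s' \<tau> + \<sigma> (2 * K) * (2 * K / \<delta>\<^sup>2) * \<bar>s - s'\<bar>"
    if d: "0 < \<delta>" "\<delta> \<le> s" "\<delta> \<le> s'" "s \<le> K" "s' \<le> K" for s s' K \<delta> \<tau>
  proof -
    have s: "0 < s" "0 < s'" using d by auto
    have nn: "0 \<le> \<sigma> (2 * K)" using \<sigma>mono[of 0 "2 * K"] \<sigma>0 s d by simp
    have L: "0 \<le> \<sigma> (2 * K) * (2 * K / \<delta>\<^sup>2) * \<bar>s - s'\<bar>" using nn s d by simp
    show ?thesis
    proof (rule least[OF s(1)], rule VE)
      show "y * cutoff s r \<le> B s' \<tau> + \<sigma> (2 * K) * (2 * K / \<delta>\<^sup>2) * \<bar>s - s'\<bar>"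
        if P: "P r \<tau>' y" "\<tau> \<le> \<tau>'" for r \<tau>' y
      proof (cases "r \<le> 2 * s")
        case True
        have y: "0 \<le> y" "y \<le> \<sigma> (2 * K)" "0 \<le> r"
          using bound[OF P(1)] \<sigma>mono[of r "2 * K"] True d by auto
        have "y * cutoff s r \<le> y * (cutoff s' r + 2 * K / \<delta>\<^sup>2 * \<bar>s - s'\<bar>)"
          using True y d by (intro mult_left_mono cutoff_lipschitz) auto
        also have "\<dots> = y * cutoff s' r + y * (2 * K / \<delta>\<^sup>2 * \<bar>s - s'\<bar>)" by (simp add: distrib_left)
        also have "\<dots> \<le> B s' \<tau> + \<sigma> (2 * K) * (2 * K / \<delta>\<^sup>2 * \<bar>s - s'\<bar>)"
          using upper[OF s(2) VI[OF P]] y s d by (intro add_mono mult_right_mono) auto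
        finally show ?thesis by (simp add: mult.assoc)
      next
        case False
        then show ?thesis using cutoff_eq_0[of s r] s Bnn[of s' \<tau>] L by simp
      qed
    qed (use Bnn[of s' \<tau>] L in auto)
  qed
  have Bcont: "continuous_on {0..} (\<lambda>s. B s \<tau>)" for \<tau>
    unfolding continuous_on_eq_continuous_within
  proof
    fix s :: real assume "s \<in> {0..}"
    show "continuous (at s within {0..}) (\<lambda>s. B s \<tau>)"
    proof (cases "s = 0")
      case True
      \<comment> \<open>The Lipschitz constant blows up at 0; continuity there comes from squeezing
        \<open>B\<close> between 0 and \<sigma>(2 s).\<close>
      have "((\<lambda>s. \<sigma> (2 * s)) \<longlongrightarrow> \<sigma> (2 * 0)) (at 0 within {0..})"
        by (rule continuous_on_tendsto_compose[OF \<sigma>cont])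
           (auto intro!: tendsto_eq_intros simp: eventually_at_filter)
      then have lim: "((\<lambda>s. \<sigma> (2 * s)) \<longlongrightarrow> 0) (at 0 within {0..})" using \<sigma>0 by simp
      have "((\<lambda>s. B s \<tau>) \<longlongrightarrow> 0) (at 0 within {0..})"
        by (rule tendsto_sandwich[OF _ _ tendsto_const lim])
           (use Bnn B\<sigma> in \<open>auto simp: eventually_at_filter\<close>)
      moreover have "B 0 \<tau> = 0" by (simp add: B_def)
      ultimately show ?thesis using True by (simp add: continuous_within)
    next
      case False
      then have s: "0 < s" using \<open>s \<in> {0..}\<close> by simp
      \<comment> \<open>The constant of \<open>Blip\<close> on the interval from s / 2 to 2
        s.\<close>
      define L where "L = \<sigma> (2 * (2 * s)) * (2 * (2 * s) / (s / 2)\<^sup>2)"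
      have near: "\<bar>B s' \<tau> - B s \<tau>\<bar> \<le> L * \<bar>s' - s\<bar>" if "s' \<in> {s / 2<..<2 * s}" for s'
        using Blip[of "s / 2" s s' "2 * s" \<tau>] Blip[of "s / 2" s' s "2 * s" \<tau>] that s
        unfolding L_def by (auto simp: abs_le_iff abs_minus_commute)
      have "((\<lambda>s'. L * \<bar>s' - s\<bar>) \<longlongrightarrow> L * \<bar>s - s\<bar>) (at s)"
        by (intro tendsto_intros)
      then have lim: "((\<lambda>s'. L * \<bar>s' - s\<bar>) \<longlongrightarrow> 0) (at s)" by simp
      have "\<forall>\<^sub>F s' in at s. s' \<in> {s / 2<..<2 * s}"
        using s by (intro eventually_at_in_open') auto
      then have "\<forall>\<^sub>F s' in at s. norm (B s' \<tau> - B s \<tau>) \<le> L * \<bar>s' - s\<bar>"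
        by eventually_elim (use near in simp)
      then have "((\<lambda>s'. B s' \<tau> - B s \<tau>) \<longlongrightarrow> 0) (at s)"
        by (rule Lim_null_comparison[OF _ lim])
      then have "isCont (\<lambda>s. B s \<tau>) s"
        by (simp add: isCont_def LIM_zero_iff)
      then show ?thesis by (rule continuous_at_imp_continuous_within)
    qed
  qed
  define \<beta> where "\<beta> s \<tau> = B s \<tau> + s * exp (- \<tau>)" for s \<tau>
  show ?thesis
  proof (rule that[of \<beta>])
    show "class_KL \<beta>"
      unfolding class_KL_def
    proof (intro conjI allI impI)
      fix \<tau> :: real assume "0 \<le> \<tau>"
      show "class_K (\<lambda>s. \<beta> s \<tau>)"
        unfolding class_K_def
      proof (intro conjI)
        show "continuous_on {0..} (\<lambda>s. \<beta> s \<tau>)"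
          unfolding \<beta>_def by (intro continuous_intros Bcont)
        show "strict_mono_on {0..} (\<lambda>s. \<beta> s \<tau>)"
          unfolding \<beta>_def by (intro strict_mono_onI add_le_less_mono Bmono) auto
        show "\<beta> 0 \<tau> = 0" by (simp add: \<beta>_def B_def)
      qed
    next
      fix s :: real assume s: "0 \<le> s"
      show "antimono_on {0..} (\<beta> s)"
        unfolding \<beta>_def by (intro monotone_onI add_mono Banti mult_left_mono) (use s in auto)
      have "((\<lambda>\<tau>. s * exp (- \<tau>)) \<longlongrightarrow> s * 0) at_top"
        by (intro tendsto_intros filterlim_compose[OF exp_at_bot] filterlim_uminus_at_bot_at_top)
      from tendsto_add[OF Blim[OF s] this] show "(\<beta> s \<longlongrightarrow> 0) at_top"
        by (simp add: \<beta>_def[abs_def])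
    qed
    fix r \<tau> y assume P: "P r \<tau> y"
    note b = bound[OF P]
    show "y \<le> \<beta> r \<tau>"
    proof (cases "r = 0")
      case True
      then show ?thesis using b \<sigma>0 by (simp add: \<beta>_def B_def)
    next
      case False
      then have r: "0 < r" using b by simp
      have "y \<le> B r \<tau>"
        using upper[OF r VI[OF P order_refl]] cutoff_eq_1[OF r] by simp
      moreover have "0 \<le> r * exp (- \<tau>)" using r by simp
      ultimately show ?thesis unfolding \<beta>_def by linarith
    qed
  qed
qed

lemma class_KLL_of_class_KL:
  assumes "class_KL \<beta>"
  shows "class_KLL (\<lambda>s t k. \<beta> s (t + k))"
proof -
  have K: "class_K (\<lambda>s. \<beta> s t)" if "0 \<le> t" for t using assms that by (simp add: class_KL_def)
  have anti: "\<beta> s t' \<le> \<beta> s t" if "0 \<le> s" "0 \<le> t" "t \<le> t'" for s t t'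
    using assms that by (auto simp: class_KL_def monotone_on_def)
  have lim: "(\<beta> s \<longlongrightarrow> 0) at_top" if "0 \<le> s" for s
    using assms that by (simp add: class_KL_def)
  have "filterlim (\<lambda>t. t + r) at_top at_top" "filterlim (\<lambda>t. r + t) at_top at_top" for r :: real
    using filterlim_tendsto_add_at_top[OF tendsto_const[of r] filterlim_ident] by (simp_all add: add.commute)
  from filterlim_compose[OF lim this(1)] filterlim_compose[OF lim this(2)] show ?thesis
    unfolding class_KLL_def class_KL_def using K anti by (auto simp: monotone_on_def)
qed

section \<open>Blocks of an overall solution\<close>

lemma abs_continuous_on_translation:
  assumes "abs_continuous_on ((+) r ` S) h"
  shows "abs_continuous_on S (\<lambda>t. h (r + t))"
  unfolding abs_continuous_on_def
proof (intro allI impI)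
  fix \<epsilon> :: real assume "\<epsilon> > 0"
  then obtain \<delta> where \<delta>: "\<delta> > 0" and
    P: "\<And>P. finite P \<and> (\<forall>(c, d)\<in>P. c \<le> d \<and> {c..d} \<subseteq> (+) r ` S) \<and>
        disjoint_family_on (\<lambda>(c, d). {c<..<d}) P \<and> (\<Sum>(c, d)\<in>P. d - c) < \<delta> \<Longrightarrow>
        (\<Sum>(c, d)\<in>P. norm (h d - h c)) < \<epsilon>"
    using assms unfolding abs_continuous_on_def by meson
  let ?f = "\<lambda>(c, d). (r + c, r + d)"
  have "inj_on ?f P" for P by (auto simp: inj_on_def)
  then have sum_eq: "(\<Sum>(c, d)\<in>?f ` P. G c d) = (\<Sum>(c, d)\<in>P. G (r + c) (r + d))" for P and G :: "_ \<Rightarrow> _ \<Rightarrow> real"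
    by (subst sum.reindex) (auto intro!: sum.cong)
  have "(\<Sum>(c, d)\<in>P. norm (h (r + d) - h (r + c))) < \<epsilon>"
    if P': "finite P \<and> (\<forall>(c, d)\<in>P. c \<le> d \<and> {c..d} \<subseteq> S) \<and>
        disjoint_family_on (\<lambda>(c, d). {c<..<d}) P \<and> (\<Sum>(c, d)\<in>P. d - c) < \<delta>" for P
  proof -
    have "(\<Sum>(c, d)\<in>?f ` P. norm (h d - h c)) < \<epsilon>"
    proof (rule P, intro conjI)
      show "finite (?f ` P)" using P' by simp
      have "{r + c..r + d} \<subseteq> (+) r ` S" if "{c..d} \<subseteq> S" for c d
        using image_mono[OF that, of "(+) r"] by (simp add: add.commute[of r])
      then show "\<forall>(c, d)\<in>?f ` P. c \<le> d \<and> {c..d} \<subseteq> (+) r ` S"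
        using P' by fastforce
      have ge: "{r + c<..<r + d} \<inter> {r + c'<..<r + d'} = {}"
        if "{c<..<d} \<inter> {c'<..<d'} = {}" for c d c' d'
      proof -
        have "x - r \<in> {c<..<d} \<inter> {c'<..<d'}" if "x \<in> {r + c<..<r + d} \<inter> {r + c'<..<r + d'}" for x
          using that by auto
        with that show ?thesis by blast
      qed
      show "disjoint_family_on (\<lambda>(c, d). {c<..<d}) (?f ` P)"
        unfolding disjoint_family_on_def
      proof (intro ballI impI)
        fix p q assume pq: "p \<in> ?f ` P" "q \<in> ?f ` P" "p \<noteq> q"
        then obtain c d c' d' where cd: "(c, d) \<in> P" "p = (r + c, r + d)" "(c', d') \<in> P" "q = (r + c', r + d')"
          by auto
        have "disjoint_family_on (\<lambda>(c, d). {c<..<d}) P" using P' by blast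
        from disjoint_family_onD[OF this cd(1,3)] have "{c<..<d} \<inter> {c'<..<d'} = {}"
          using pq(3) cd by auto
        then show "(case p of (c, d) \<Rightarrow> {c<..<d}) \<inter> (case q of (c, d) \<Rightarrow> {c<..<d}) = {}"
          using ge[of c d c' d'] cd by simp
      qed
      show "(\<Sum>(c, d)\<in>?f ` P. d - c) < \<delta>"
        using P' unfolding sum_eq by simp
    qed
    then show ?thesis unfolding sum_eq .
  qed
  with \<delta> show "\<exists>\<delta>>0. \<forall>P. finite P \<and> (\<forall>(a, b)\<in>P. a \<le> b \<and> {a..b} \<subseteq> S) \<and>
        disjoint_family_on (\<lambda>(a, b). {a<..<b}) P \<and> (\<Sum>(a, b)\<in>P. b - a) < \<delta> \<longrightarrow>
        (\<Sum>(a, b)\<in>P. norm (h (r + b) - h (r + a))) < \<epsilon>" by blast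
qed

text \<open>The other blocks enter a subsystem as inputs, and the facts on norms are stated for
  inputs.\<close>

lemma hybrid_arc_imp_hybrid_input:
  assumes x: "hybrid_arc x"
  shows "hybrid_input x"
  unfolding hybrid_input_def
proof (intro conjI allI impI)
  show hs: "hybrid_signal x" using x by (simp add: hybrid_arc_def)
  fix k
  let ?S = "hsection x k" and ?h = "\<lambda>t. hval x t k"
  have cont: "continuous_on ?S ?h"
    unfolding continuous_on_sequentially
  proof (intro allI ballI impI)
    fix \<sigma> t assume t: "t \<in> ?S" and \<sigma>: "(\<forall>n. \<sigma> n \<in> ?S) \<and> \<sigma> \<longlonglongrightarrow> t"
    \<comment> \<open>Continuity is known on compact intervals only. A convergent sequence together
      with its limit is compact, hence contained in such an interval.\<close>
    let ?K = "insert t (range \<sigma>)"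
    have K: "compact ?K" "?K \<noteq> {}" "?K \<subseteq> ?S"
      using compact_sequence_with_limit[of \<sigma> t] t \<sigma> by auto
    obtain a b where ab: "a \<in> ?K" "b \<in> ?K" "\<And>s. s \<in> ?K \<Longrightarrow> a \<le> s \<and> s \<le> b"
      using compact_attains_inf[OF K(1,2)] compact_attains_sup[OF K(1,2)] by metis
    then have "a \<in> ?S" "b \<in> ?S" using K(3) by blast+
    then have "{a..b} \<subseteq> ?S"
      using is_interval_hsection[OF hs, of k] unfolding is_interval_1 by (meson atLeastAtMost_iff subsetI)
    then have "continuous_on {a..b} ?h"
      using x by (intro abs_continuous_on_imp_continuous_on) (simp add: hybrid_arc_def)
    then show "(?h \<circ> \<sigma>) \<longlonglongrightarrow> ?h t"
      using ab(3) \<sigma> unfolding continuous_on_sequentially by simp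
  qed
  show "?h \<in> borel_measurable (lebesgue_on ?S)"
    by (rule continuous_imp_measurable_on_sets_lebesgue[OF cont hsection_measurable[OF hs]])
  fix K assume K: "compact K \<and> K \<subseteq> ?S"
  then have "compact (?h ` K)"
    using cont by (intro compact_continuous_image) (auto intro: continuous_on_subset)
  then obtain c where "\<And>t. t \<in> K \<Longrightarrow> norm (?h t) \<le> c"
    using compact_imp_bounded bounded_iff by (metis image_eqI)
  then show "\<exists>c. AE t in lebesgue_on K. norm (?h t) \<le> c"
    by (intro exI[of _ c] AE_I2) simp
qed

text \<open>Up to (t, k) the extension has the same points, and earlier jumps are the same. Only (t,
  k) itself can turn into a jump time, and then its value counts although it was a null set before;
  \<open>last\<close> rules this out.\<close>

lemma hbound_map_le:
  assumes f: "hybrid_signal f" and g: "hybrid_signal g" and le: "f \<subseteq>\<^sub>m g" and tk: "(t, k) \<in> dom f"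
    and last: "(t, k) \<in> jump_times g \<Longrightarrow> (t, Suc k) \<in> dom f"
    and b: "hbound f t k c"
  shows "hbound g t k c"
proof -
  have F: "hybrid_time_domain (dom f)" and G: "hybrid_time_domain (dom g)"
    using f g by (auto simp: hybrid_signal_def)
  have sub: "dom f \<subseteq> dom g" using le by (rule map_le_implies_dom_le)
  then have tkg: "(t, k) \<in> dom g" using tk by blast
  have pre: "(s, l) \<in> dom f" if "(s, l) \<in> dom g" "s + real l \<le> t + real k" for s l
    using htd_prefix[OF F G sub tk that(1)] htd_order[OF G that(1) tkg that(2)] by blast
  have jmp: "(s, l) \<in> jump_times f" if J: "(s, l) \<in> jump_times g" and le: "s + real l \<le> t + real k" for s l
  proof -
    have J': "(s, l) \<in> dom g" "(s, Suc l) \<in> dom g" using J by (auto simp: jump_times_def)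
    have "(s, Suc l) \<in> dom f"
    proof (cases "s + real (Suc l) \<le> t + real k")
      case True
      then show ?thesis using pre J' by blast
    next
      case False
      \<comment> \<open>(s, l) is not after (t, k) but its successor is, which forces both points to
        coincide.\<close>
      then have "t \<le> s" "s \<le> t" "l \<le> k"
        using htd_order[OF G tkg J'(2)] htd_order[OF G J'(1) tkg le] by auto
      with False have "s = t" "l = k" by auto
      then show ?thesis using last J by simp
    qed
    then show ?thesis using pre[OF J'(1) le] by (simp add: jump_times_def)
  qed
  have jmp': "jump_times f \<subseteq> jump_times g" using sub by (auto simp: jump_times_def)
  show ?thesis
    unfolding hbound_def
  proof (intro conjI allI ballI)
    fix l
    have "AE s in lebesgue. (s, l) \<in> dom f - jump_times f \<and> s + real l \<le> t + real k \<longrightarrow> norm (hval f s l) \<le> c"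
      using b by (simp add: hbound_def)
    then show "AE s in lebesgue. (s, l) \<in> dom g - jump_times g \<and> s + real l \<le> t + real k \<longrightarrow> norm (hval g s l) \<le> c"
      by (rule eventually_mono) (use pre jmp' hval_map_le[OF le] in auto)
  next
    fix p assume p: "p \<in> jump_times g"
    show "case p of (s, l) \<Rightarrow> s + real l \<le> t + real k \<longrightarrow> norm (hval g s l) \<le> c"
    proof (clarify)
      fix s l assume "p = (s, l)" and sl: "s + real l \<le> t + real k"
      then have J: "(s, l) \<in> jump_times f" using jmp p by simp
      then have "norm (hval f s l) \<le> c" using b sl by (auto simp: hbound_def)
      moreover have "(s, l) \<in> dom f" using J by (simp add: jump_times_def)
      ultimately show "norm (hval g s l) \<le> c" using hval_map_le[OF le] by simp
    qed
  qed
qed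

lemma hbound_of_pointwise:
  assumes "\<And>s l. (s, l) \<in> dom u \<Longrightarrow> s + real l \<le> t + real k \<Longrightarrow> norm (hval u s l) \<le> c"
  shows "hbound u t k c"
  using assms by (auto simp: hbound_def jump_times_def)

section \<open>Projection to the blocks\<close>

definition block_signal ::
  "('n, 'c::finite, 'm::finite) interconnection \<Rightarrow> (real ^ 'c) hsignal \<Rightarrow> 'n \<Rightarrow> (real ^ 'c) hsignal" where
  "block_signal H x j = map_option (block_proj H j) \<circ> x"

lemma dom_block_signal [simp]: "dom (block_signal H x j) = dom x"
  by (auto simp: block_signal_def dom_def)

lemma hsection_block_signal [simp]: "hsection (block_signal H x j) k = hsection x k"
  unfolding hsection_def dom_block_signal ..

lemma hval_block_signal:
  "(t, k) \<in> dom x \<Longrightarrow> hval (block_signal H x j) t k = block_proj H j (hval x t k)"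
  by (auto simp: block_signal_def hval_def)

lemma linear_block_proj: "linear (block_proj H j)"
  by (rule linearI) (simp_all add: block_proj_def vec_eq_iff)

lemma norm_block_proj_le: "norm (block_proj H j x) \<le> norm x"
  by (rule norm_le_componentwise_cart) (simp add: block_proj_def)

lemma sum_block_proj: "(\<Sum>j\<in>UNIV. block_proj H j x) = x"
  for H :: "('n::finite, 'c::finite, 'm::finite) interconnection"
  by (simp add: vec_eq_iff block_proj_def)

lemma block_proj_block_space:
  "x \<in> block_space H j \<Longrightarrow> block_proj H i x = (if i = j then x else 0)"
  by (auto simp: vec_eq_iff block_proj_def block_space_def)

lemma block_proj_sum_block_space:
  fixes H :: "('n::finite, 'c::finite, 'm::finite) interconnection"
  assumes "\<And>j. f j \<in> block_space H j"
  shows "block_proj H i (\<Sum>j\<in>UNIV. f j) = f i"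
  by (simp add: linear_sum[OF linear_block_proj] block_proj_block_space[OF assms] sum.delta)

lemma state_set_subset_block_space:
  assumes "regular_interconnection H"
  shows "state_set H i \<subseteq> block_space H i"
  using assms by (auto simp: regular_interconnection_def dest!: spec[of _ i] openin_imp_subset)

lemma block_proj_overall_flow_map:
  assumes "regular_interconnection H" "p \<in> overall_flow_set H"
  shows "block_proj H i (overall_flow_map H p) = flow_map H i p"
  unfolding overall_flow_map_def
proof (rule block_proj_sum_block_space)
  show "flow_map H j p \<in> block_space H j" for j
    using assms unfolding regular_interconnection_def overall_flow_set_def by blast
qed

lemma jump_map_in_state_set:
  assumes "regular_interconnection H" "p \<in> jump_set H i"
  shows "jump_map H i p \<in> state_set H i"
  using assms unfolding regular_interconnection_def by blast

text \<open>With a common jump set all subsystems jump together, so the branch of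
  \<open>overall_jump_map\<close> that keeps a block fixed is never taken.\<close>

lemma block_proj_overall_jump_map:
  assumes reg: "regular_interconnection H" and D: "\<And>i. jump_set H i = overall_jump_set H"
    and p: "p \<in> overall_jump_set H"
  shows "block_proj H i (overall_jump_map H p) = jump_map H i p"
proof -
  have "overall_jump_map H p = (\<Sum>j\<in>UNIV. jump_map H j p)"
    unfolding overall_jump_map_def using p D by simp
  moreover have "jump_map H j p \<in> block_space H j" for j
    using jump_map_in_state_set[OF reg] state_set_subset_block_space[OF reg] p D by blast
  ultimately show ?thesis by (simp add: block_proj_sum_block_space)
qed

lemma hybrid_arc_block_signal:
  assumes x: "hybrid_arc x"
  shows "hybrid_arc (block_signal H x j)"
  unfolding hybrid_arc_def
proof (intro conjI allI impI)
  show "hybrid_signal (block_signal H x j)"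
    using x by (simp add: hybrid_arc_def hybrid_signal_def)
  fix k and a b :: real assume ab: "{a..b} \<subseteq> hsection (block_signal H x j) k"
  show "abs_continuous_on {a..b} (\<lambda>t. hval (block_signal H x j) t k)"
  proof (rule abs_continuous_on_dominated)
    show "abs_continuous_on {a..b} (\<lambda>t. hval x t k)" using x ab by (simp add: hybrid_arc_def)
    fix s t assume "s \<in> {a..b}" "t \<in> {a..b}"
    then have "s \<in> hsection x k" "t \<in> hsection x k" using ab by auto
    then show "norm (hval (block_signal H x j) t k - hval (block_signal H x j) s k) \<le> norm (hval x t k - hval x s k)"
      by (simp add: hsection_def hval_block_signal norm_block_proj_le flip: linear_diff[OF linear_block_proj])
  qed
qed

lemma stack_block_signal:
  fixes H :: "('n::finite, 'c::finite, 'm::finite) interconnection"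
  assumes "(t, k) \<in> dom x"
  shows "stack (block_signal H x) t k = hval x t k"
  by (simp add: stack_def hval_block_signal[OF assms] sum_block_proj)

lemma solution_pairD:
  assumes "solution_pair H x u"
  shows solution_pair_arc: "hybrid_arc x" and solution_pair_input: "hybrid_input u"
    and solution_pair_dom: "dom u = dom x" and solution_pair_htd: "hybrid_time_domain (dom x)"
    and solution_pair_zero: "(0, 0) \<in> dom x"
proof -
  show "hybrid_arc x" "hybrid_input u" "dom u = dom x"
    using assms by (simp_all add: solution_pair_def)
  then show "hybrid_time_domain (dom x)"
    by (simp add: hybrid_arc_def hybrid_signal_def)
  then show "(0, 0) \<in> dom x" by (rule htd_zero)
qed

text \<open>Block projections are linear and bounded, so they commute with derivatives, and stacking
  the blocks gives back \<open>x\<close>. The common jump set is needed wherever a jump or a start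
  in the jump set has to be one of subsystem \<open>i\<close>.\<close>

lemma sub_solution_pair_block_signal:
  assumes reg: "regular_interconnection H" and D: "\<And>i. jump_set H i = overall_jump_set H"
    and sol: "solution_pair H x u"
  shows "sub_solution_pair H i (block_signal H x) u"
  unfolding sub_solution_pair_def
proof (intro conjI allI impI)
  show arc: "hybrid_arc (block_signal H x j)" for j
    by (rule hybrid_arc_block_signal[OF solution_pair_arc[OF sol]])
  show "hybrid_input (block_signal H x j)" for j
    by (rule hybrid_arc_imp_hybrid_input[OF arc])
  have "ran (block_signal H x j) \<subseteq> block_proj H j ` ran x" for j
    by (auto simp: block_signal_def ran_def)
  moreover have "ran x \<subseteq> overall_state_set H" using sol by (simp add: solution_pair_def)
  ultimately have ran: "ran (block_signal H x j) \<subseteq> state_set H j" for j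
    unfolding overall_state_set_def by blast
  show "ran (block_signal H x i) \<subseteq> state_set H i" by (rule ran)
  show "ran (block_signal H x j) \<subseteq> state_set H j" for j by (rule ran)
  show "hybrid_input u" "ran u \<subseteq> input_set H"
    using sol by (auto simp: solution_pair_def)
  have dom: "dom (block_signal H x j) = dom u" for j
    using solution_pair_dom[OF sol] by simp
  show "dom (block_signal H x i) = dom u" by (rule dom)
  show "dom (block_signal H x j) = dom u" for j by (rule dom)
  show "(stack (block_signal H x) 0 0, hval u 0 0) \<in> flow_set H i \<union> jump_set H i"
    using sol D unfolding stack_block_signal[OF solution_pair_zero[OF sol]]
    by (auto simp: solution_pair_def overall_flow_set_def)
  fix k
  have "AE t in lebesgue. (t, k) \<in> dom x \<longrightarrow>
        (hval x t k, hval u t k) \<in> overall_flow_set H \<and>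
        ((\<lambda>s. hval x s k) has_vector_derivative overall_flow_map H (hval x t k, hval u t k))
          (at t within hsection x k)"
    using sol unfolding solution_pair_def by blast
  then show "AE t in lebesgue. (t, k) \<in> dom (block_signal H x i) \<longrightarrow>
        (stack (block_signal H x) t k, hval u t k) \<in> flow_set H i \<and>
        ((\<lambda>s. hval (block_signal H x i) s k) has_vector_derivative
          flow_map H i (stack (block_signal H x) t k, hval u t k)) (at t within hsection (block_signal H x i) k)"
  proof (rule eventually_mono, intro impI)
    fix t assume *: "(t, k) \<in> dom x \<longrightarrow> (hval x t k, hval u t k) \<in> overall_flow_set H \<and>
        ((\<lambda>s. hval x s k) has_vector_derivative overall_flow_map H (hval x t k, hval u t k))
          (at t within hsection x k)"
      and "(t, k) \<in> dom (block_signal H x i)"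
    then have tk: "(t, k) \<in> dom x" by simp
    let ?p = "(hval x t k, hval u t k)"
    from * tk have C: "?p \<in> overall_flow_set H"
      and d: "((\<lambda>s. hval x s k) has_vector_derivative overall_flow_map H ?p) (at t within hsection x k)"
      by blast+
    have "((\<lambda>s. block_proj H i (hval x s k)) has_vector_derivative flow_map H i ?p) (at t within hsection x k)"
      using bounded_linear.has_vector_derivative[OF linear_conv_bounded_linear[THEN iffD1, OF linear_block_proj] d, of H i]
      unfolding block_proj_overall_flow_map[OF reg C] .
    then have "((\<lambda>s. hval (block_signal H x i) s k) has_vector_derivative flow_map H i ?p) (at t within hsection x k)"
      by (rule has_vector_derivative_transform[rotated 2])
         (use tk in \<open>auto simp: hsection_def intro: hval_block_signal\<close>)
    then show "(stack (block_signal H x) t k, hval u t k) \<in> flow_set H i \<and>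
        ((\<lambda>s. hval (block_signal H x i) s k) has_vector_derivative
          flow_map H i (stack (block_signal H x) t k, hval u t k)) (at t within hsection (block_signal H x i) k)"
      unfolding stack_block_signal[OF tk] hsection_block_signal using C by (auto simp: overall_flow_set_def)
  qed
next
  fix t k assume "(t, k) \<in> dom (block_signal H x i) \<and> (t, Suc k) \<in> dom (block_signal H x i)"
  then have tk: "(t, k) \<in> dom x" "(t, Suc k) \<in> dom x" by auto
  with sol have J: "(hval x t k, hval u t k) \<in> overall_jump_set H"
    "hval x t (Suc k) = overall_jump_map H (hval x t k, hval u t k)"
    unfolding solution_pair_def by blast+
  then show "(stack (block_signal H x) t k, hval u t k) \<in> jump_set H i"
    using D by (simp add: stack_block_signal[OF tk(1)])
  show "hval (block_signal H x i) t (Suc k) = jump_map H i (stack (block_signal H x) t k, hval u t k)"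
    unfolding stack_block_signal[OF tk(1)] hval_block_signal[OF tk(2)] J(2)
    by (rule block_proj_overall_jump_map[OF reg D J(1)])
qed

text \<open>A solution pair that ends in the jump set can be continued by a jump, so maximality implies
  the following property. Unlike maximality it is inherited by the tails of a solution pair.\<close>

definition jump_complete ::
  "('n::finite, 'c::finite, 'm::finite) interconnection \<Rightarrow> (real ^ 'c) hsignal \<Rightarrow> (real ^ 'm) hsignal \<Rightarrow> bool" where
  "jump_complete H x u \<longleftrightarrow> (\<forall>t k. (t, k) \<in> dom x \<and> (hval x t k, hval u t k) \<in> overall_jump_set H \<and>
     (\<forall>s. (s, k) \<in> dom x \<longrightarrow> s \<le> t) \<longrightarrow> (t, Suc k) \<in> dom x)"

text \<open>The estimate holds for a maximal extension of the blocks. By \<open>jump_complete\<close> the extension does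
  not jump at \<open>(t, k)\<close> unless \<open>x\<close> does, so it has no additional jump whose value would enter the norms.\<close>

lemma sub_ISS_estimate:
  fixes H :: "('n::finite, 'c::finite, 'm::finite) interconnection"
  assumes card: "CARD('n) \<ge> 2" and reg: "regular_interconnection H"
    and D: "\<And>i. jump_set H i = overall_jump_set H"
    and Kinf0: "\<And>j. j \<noteq> i \<Longrightarrow> class_Kinf0 (\<gamma> i j)" and Ku: "class_Kinf0 \<gamma>u"
    and ISS: "\<And>xs u t k. maximal_sub_solution_pair H i xs u \<Longrightarrow> (t, k) \<in> dom (xs i) \<Longrightarrow>
      norm (hval (xs i) t k) \<le> Max {\<beta> (norm (hval (xs i) 0 0)) t (real k),
         Max ((\<lambda>j. \<gamma> i j (hnorm (xs j) t k)) ` (UNIV - {i})), \<gamma>u (hnorm u t k)}"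
    and sol: "solution_pair H x u" and jc: "jump_complete H x u" and tk: "(t, k) \<in> dom x"
    and b: "\<And>j. 0 \<le> b $ j" "\<And>j. hbound (block_signal H x j) t k (b $ j)"
    and c: "0 \<le> c" "hbound u t k c"
  shows "norm (block_proj H i (hval x t k)) \<le>
    max (\<beta> (norm (block_proj H i (hval x 0 0))) t (real k)) (max (Gamma_max \<gamma> b $ i) (\<gamma>u c))"
proof -
  note dom = solution_pair_dom[OF sol]
  have sub: "sub_solution_pair H i (block_signal H x) u"
    by (rule sub_solution_pair_block_signal[OF reg D sol])
  obtain ys v where max: "maximal_sub_solution_pair H i ys v"
    and le: "\<And>j. block_signal H x j \<subseteq>\<^sub>m ys j" "u \<subseteq>\<^sub>m v"
    using maximal_sub_solution_pair_exists[OF sub] by blast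
  have sol': "sub_solution_pair H i ys v"
    using max by (simp add: maximal_sub_solution_pair_def)
  have domy: "dom (ys j) = dom v" for j by (rule sub_solution_pair_dom[OF sol'])
  have sigv: "hybrid_signal v" and inpv: "hybrid_input v"
    using sol' by (auto simp: sub_solution_pair_def hybrid_input_def)
  have sigx: "hybrid_signal x" using solution_pair_arc[OF sol] by (simp add: hybrid_arc_def)
  have sub': "dom x \<subseteq> dom v" using map_le_implies_dom_le[OF le(2)] dom by simp
  have last: "(t, Suc k) \<in> dom x" if "(t, k) \<in> jump_times v"
  proof -
    have "(t, k) \<in> dom v" "(t, Suc k) \<in> dom v" using that by (auto simp: jump_times_def)
    then have "(stack ys t k, hval v t k) \<in> jump_set H i"
      using sol' domy unfolding sub_solution_pair_def by blast
    moreover have "stack ys t k = hval x t k"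
      using stack_map_le[of "block_signal H x" ys t k, OF le(1)] stack_block_signal[OF tk] tk by simp
    moreover have "hval v t k = hval u t k"
      using hval_map_le[OF le(2)] tk dom by simp
    moreover have "s \<le> t" if "(s, k) \<in> dom x" for s
      using htd_step[of "dom v" s k t] sigv sub' that \<open>(t, Suc k) \<in> dom v\<close>
      by (auto simp: hybrid_signal_def)
    ultimately show ?thesis using jc tk D unfolding jump_complete_def by metis
  qed
  have hy: "hnorm (ys j) t k \<le> b $ j" if "j \<noteq> i" for j
  proof (rule hnorm_le[OF _ b(1)])
    show "hybrid_input (ys j)" using sol' that by (simp add: sub_solution_pair_def)
    then have "hybrid_signal (ys j)" by (simp add: hybrid_input_def)
    then show "hbound (ys j) t k (b $ j)"
      using b(2)[of j] tk last sigx domy[of j]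
      by (intro hbound_map_le[OF _ _ le(1)]) (auto simp: hybrid_signal_def jump_times_def)
  qed
  have hv: "hnorm v t k \<le> c"
    using hbound_map_le[OF _ sigv le(2) _ _ c(2)] last tk dom sigx
    by (intro hnorm_le[OF inpv c(1)]) (auto simp: hybrid_signal_def)
  have "(t, k) \<in> dom (ys i)" using tk sub' domy by blast
  note est = ISS[OF max this]
  have e1: "hval (ys i) t k = block_proj H i (hval x t k)"
    using hval_map_le[OF le(1), of t k i] tk by (simp add: hval_block_signal)
  have e2: "hval (ys i) 0 0 = block_proj H i (hval x 0 0)"
    using hval_map_le[OF le(1), of 0 0 i] solution_pair_zero[OF sol] by (simp add: hval_block_signal)
  have "Max ((\<lambda>j. \<gamma> i j (hnorm (ys j) t k)) ` (UNIV - {i})) \<le> Gamma_max \<gamma> b $ i"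
    unfolding Gamma_max_def vec_lambda_beta
  proof (rule Max.boundedI)
    show "(\<lambda>j. \<gamma> i j (hnorm (ys j) t k)) ` (UNIV - {i}) \<noteq> {}"
      unfolding image_is_empty by (rule others_nonempty[OF card])
    fix y assume "y \<in> (\<lambda>j. \<gamma> i j (hnorm (ys j) t k)) ` (UNIV - {i})"
    then obtain j where j: "j \<noteq> i" "y = \<gamma> i j (hnorm (ys j) t k)" by blast
    have "y \<le> \<gamma> i j (b $ j)"
      unfolding j(2) by (rule class_Kinf0_mono[OF Kinf0[OF j(1)] hnorm_nonneg hy[OF j(1)]])
    also have "\<dots> \<le> Max ((\<lambda>j. \<gamma> i j (b $ j)) ` (UNIV - {i}))"
      using j(1) by (intro Max_ge) auto
    finally show "y \<le> Max ((\<lambda>j. \<gamma> i j (b $ j)) ` (UNIV - {i}))" .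
  qed simp
  moreover have "\<gamma>u (hnorm v t k) \<le> \<gamma>u c"
    by (rule class_Kinf0_mono[OF Ku hnorm_nonneg hv])
  ultimately have "max (Max ((\<lambda>j. \<gamma> i j (hnorm (ys j) t k)) ` (UNIV - {i}))) (\<gamma>u (hnorm v t k)) \<le>
      max (Gamma_max \<gamma> b $ i) (\<gamma>u c)"
    by (rule max.mono)
  moreover have "norm (block_proj H i (hval x t k)) \<le> max (\<beta> (norm (block_proj H i (hval x 0 0))) t (real k))
      (max (Max ((\<lambda>j. \<gamma> i j (hnorm (ys j) t k)) ` (UNIV - {i}))) (\<gamma>u (hnorm v t k)))"
    using est unfolding e1 e2 by (subst (asm) Max_insert; simp)
  ultimately show ?thesis by linarith
qed

section \<open>Continuation by a jump\<close>

text \<open>The entry into level \<open>Suc k\<close> would be a point of level \<open>k\<close> not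
  before \<open>t\<close>, hence \<open>t\<close> itself, which is excluded. So the new level is a
  single point.\<close>

lemma htd_append_jump:
  assumes E: "hybrid_time_domain E" and tk: "(t, k) \<in> E" and last: "\<And>s. (s, k) \<in> E \<Longrightarrow> s \<le> t"
    and fin: "(t, Suc k) \<notin> E"
  shows "hybrid_time_domain (insert (t, Suc k) E)" and "\<And>s. (s, Suc k) \<notin> E"
proof -
  show no: "(s, Suc k) \<notin> E" for s
  proof
    assume "(s, Suc k) \<in> E"
    then obtain a where a: "(a, k) \<in> E" "(a, Suc k) \<in> E" using htd_pred[OF E] by blast
    then have "a = t" using htd_step[OF E tk a(2)] last[OF a(1)] by simp
    with a fin show False by simp
  qed
  then have no': "(s, Suc (Suc k)) \<notin> E" for s
    using htd_pred[OF E] by blast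
  show "hybrid_time_domain (insert (t, Suc k) E)"
  proof (rule hybrid_time_domainI)
    show "(0, 0) \<in> insert (t, Suc k) E" using htd_zero[OF E] by simp
    show "0 \<le> s" if "(s, l) \<in> insert (t, Suc k) E" for s l
      using that tk htd_nonneg[OF E] by auto
    show "(r, l) \<in> insert (t, Suc k) E"
      if "(s, l) \<in> insert (t, Suc k) E" "(s', l) \<in> insert (t, Suc k) E" "s \<le> r" "r \<le> s'" for r s s' l
      using that no htd_convex[OF E, of s l s' r] by auto
    show "\<exists>r. (r, l) \<in> insert (t, Suc k) E \<and> (r, Suc l) \<in> insert (t, Suc k) E"
      if "(s, Suc l) \<in> insert (t, Suc k) E" for s l
      using that tk htd_pred[OF E, of s l] by auto
    show "s' \<le> s" if "(s', l) \<in> insert (t, Suc k) E" "(s, Suc l) \<in> insert (t, Suc k) E" for s s' l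
      using that no no' last htd_step[OF E, of s' l s] by auto
  qed
qed

lemma hval_upd: "hval (x((t, m) \<mapsto> z)) s l = (if (s, l) = (t, m) then z else hval x s l)"
  by (simp add: hval_def)

lemma hsection_upd: "hsection (x((t, m) \<mapsto> z)) l = (if l = m then insert t (hsection x l) else hsection x l)"
  by (auto simp: hsection_def)

lemma hybrid_arc_upd:
  assumes x: "hybrid_arc x" and sig: "hybrid_signal (x((t, m) \<mapsto> z))" and emp: "hsection x m = {}"
  shows "hybrid_arc (x((t, m) \<mapsto> z))"
  unfolding hybrid_arc_def
proof (intro conjI allI impI sig)
  fix l and a b :: real assume ab: "{a..b} \<subseteq> hsection (x((t, m) \<mapsto> z)) l"
  show "abs_continuous_on {a..b} (\<lambda>s. hval (x((t, m) \<mapsto> z)) s l)"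
  proof (cases "l = m")
    case True
    then have st: "s = t" if "s \<in> {a..b}" for s
      using subsetD[OF ab that] emp by (simp add: hsection_upd)
    show ?thesis
    proof (rule abs_continuous_on_dominated[OF _ abs_continuous_on_const[of _ "0 :: real"]])
      fix r s assume "r \<in> {a..b}" "s \<in> {a..b}"
      then have "r = t" "s = t" using st by blast+
      then show "norm (hval (x((t, m) \<mapsto> z)) s l - hval (x((t, m) \<mapsto> z)) r l) \<le> norm (0 - 0 :: real)"
        by simp
    qed
  next
    case False
    then show ?thesis using x ab by (simp add: hybrid_arc_def hsection_upd hval_upd)
  qed
qed

lemma hybrid_input_upd:
  assumes u: "hybrid_input u" and sig: "hybrid_signal (u((t, m) \<mapsto> z))" and emp: "hsection u m = {}"
  shows "hybrid_input (u((t, m) \<mapsto> z))"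
  unfolding hybrid_input_def
proof (intro conjI allI impI sig)
  fix l
  show "(\<lambda>s. hval (u((t, m) \<mapsto> z)) s l) \<in> borel_measurable (lebesgue_on (hsection (u((t, m) \<mapsto> z)) l))"
  proof (cases "l = m")
    case True
    then have "(\<lambda>s. hval (u((t, m) \<mapsto> z)) s l) \<in> borel_measurable (lebesgue_on {t})
        \<longleftrightarrow> (\<lambda>s. z) \<in> borel_measurable (lebesgue_on {t})"
      by (intro measurable_cong) (simp add: hval_upd)
    then show ?thesis using True emp by (simp add: hsection_upd)
  next
    case False
    then show ?thesis using u by (simp add: hybrid_input_def hsection_upd hval_upd)
  qed
  fix K assume K: "compact K \<and> K \<subseteq> hsection (u((t, m) \<mapsto> z)) l"
  show "\<exists>c. AE s in lebesgue_on K. norm (hval (u((t, m) \<mapsto> z)) s l) \<le> c"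
  proof (cases "l = m")
    case True
    then have "K \<subseteq> {t}" using K emp by (simp add: hsection_upd)
    then show ?thesis using True by (intro exI[of _ "norm z"] AE_I2) (auto simp: hval_upd)
  next
    case False
    then show ?thesis using u K by (simp add: hybrid_input_def hsection_upd hval_upd)
  qed
qed

lemma overall_jump_map_in_state_set:
  assumes reg: "regular_interconnection H" and D: "\<And>i. jump_set H i = overall_jump_set H"
    and p: "p \<in> overall_jump_set H"
  shows "overall_jump_map H p \<in> overall_state_set H"
  unfolding overall_state_set_def
  using block_proj_overall_jump_map[OF reg D p] jump_map_in_state_set[OF reg] p D by simp

text \<open>The new level is a null set, so no flow condition arises on it. The input is continued
  by its last value, which is known to lie in \<open>input_set H\<close>.\<close>

lemma solution_pair_append_jump:
  assumes reg: "regular_interconnection H" and D: "\<And>i. jump_set H i = overall_jump_set H"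
    and sol: "solution_pair H x u" and tk: "(t, k) \<in> dom x" and last: "\<And>s. (s, k) \<in> dom x \<Longrightarrow> s \<le> t"
    and jump: "(hval x t k, hval u t k) \<in> overall_jump_set H" and fin: "(t, Suc k) \<notin> dom x"
  shows "solution_pair H (x((t, Suc k) \<mapsto> overall_jump_map H (hval x t k, hval u t k)))
    (u((t, Suc k) \<mapsto> hval u t k))" (is "solution_pair H ?x ?u")
proof -
  note E = solution_pair_htd[OF sol] and dom = solution_pair_dom[OF sol]
  have E': "hybrid_time_domain (insert (t, Suc k) (dom x))" and no: "\<And>s. (s, Suc k) \<notin> dom x"
    by (rule htd_append_jump[OF E tk last fin]; assumption)+
  have emp: "hsection x (Suc k) = {}" "hsection u (Suc k) = {}"
    using no unfolding hsection_def dom by blast+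
  have sig: "hybrid_signal ?x" "hybrid_signal ?u"
    using E' by (simp_all add: hybrid_signal_def dom)
  have no': "(s, Suc (Suc k)) \<notin> dom x" for s
    using htd_pred[OF E] no by blast
  show ?thesis
    unfolding solution_pair_def
  proof (intro conjI allI impI)
    show "hybrid_arc ?x" by (rule hybrid_arc_upd[OF solution_pair_arc[OF sol] sig(1) emp(1)])
    show "hybrid_input ?u" by (rule hybrid_input_upd[OF solution_pair_input[OF sol] sig(2) emp(2)])
    have "ran x \<subseteq> overall_state_set H" using sol by (simp add: solution_pair_def)
    then show "ran ?x \<subseteq> overall_state_set H"
      using overall_jump_map_in_state_set[OF reg D jump] by (auto simp: ran_def)
    have "ran u \<subseteq> input_set H" using sol by (simp add: solution_pair_def)
    moreover have "hval u t k \<in> ran u" using tk unfolding dom[symmetric] by (auto simp: hval_def intro: ranI)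
    ultimately show "ran ?u \<subseteq> input_set H" by (auto simp: ran_def)
    show "dom ?x = dom ?u" using dom by simp
    show "(hval ?x 0 0, hval ?u 0 0) \<in> overall_flow_set H \<union> overall_jump_set H"
      using sol unfolding solution_pair_def hval_upd by simp
  next
    fix l
    show "AE s in lebesgue. (s, l) \<in> dom ?x \<longrightarrow> (hval ?x s l, hval ?u s l) \<in> overall_flow_set H \<and>
        ((\<lambda>s. hval ?x s l) has_vector_derivative overall_flow_map H (hval ?x s l, hval ?u s l))
          (at s within hsection ?x l)"
    proof (cases "l = Suc k")
      case True
      have "AE s in lebesgue. s \<notin> {t}" by (rule countable_imp_AE_lebesgue_not_in) simp
      then show ?thesis by (rule eventually_mono) (use True no in auto)
    next
      case False
      have "AE s in lebesgue. (s, l) \<in> dom x \<longrightarrow> (hval x s l, hval u s l) \<in> overall_flow_set H \<and>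
        ((\<lambda>s. hval x s l) has_vector_derivative overall_flow_map H (hval x s l, hval u s l))
          (at s within hsection x l)"
        using sol unfolding solution_pair_def by blast
      then show ?thesis using False by (simp add: hval_upd hsection_upd)
    qed
  next
    fix s l assume "(s, l) \<in> dom ?x \<and> (s, Suc l) \<in> dom ?x"
    then have "(s, l) = (t, Suc k) \<or> (s, l) \<in> dom x" "(s, Suc l) = (t, Suc k) \<or> (s, Suc l) \<in> dom x"
      by (auto split: if_splits)
    then consider "s = t" "l = k" | "(s, l) \<in> dom x" "(s, Suc l) \<in> dom x" "l \<noteq> k"
      using no[of s] no'[of s] by (metis Pair_inject Suc_inject)
    then have "(hval ?x s l, hval ?u s l) \<in> overall_jump_set H \<and>
      hval ?x s (Suc l) = overall_jump_map H (hval ?x s l, hval ?u s l)"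
    proof cases
      case 1
      then show ?thesis using jump by (simp add: hval_upd)
    next
      case 2
      then have "l \<noteq> Suc k" using no by blast
      then show ?thesis using sol 2 unfolding solution_pair_def by (simp add: hval_upd)
    qed
    then show "(hval ?x s l, hval ?u s l) \<in> overall_jump_set H"
      "hval ?x s (Suc l) = overall_jump_map H (hval ?x s l, hval ?u s l)" by blast+
  qed
qed

lemma maximal_solution_pair_imp_jump_complete:
  assumes reg: "regular_interconnection H" and D: "\<And>i. jump_set H i = overall_jump_set H"
    and max: "maximal_solution_pair H x u"
  shows "jump_complete H x u"
  unfolding jump_complete_def
proof (intro allI impI)
  fix t k
  assume *: "(t, k) \<in> dom x \<and> (hval x t k, hval u t k) \<in> overall_jump_set H \<and>
     (\<forall>s. (s, k) \<in> dom x \<longrightarrow> s \<le> t)"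
  have sol: "solution_pair H x u" using max by (simp add: maximal_solution_pair_def)
  show "(t, Suc k) \<in> dom x"
  proof (rule ccontr)
    assume fin: "(t, Suc k) \<notin> dom x"
    let ?x = "x((t, Suc k) \<mapsto> overall_jump_map H (hval x t k, hval u t k))" and ?u = "u((t, Suc k) \<mapsto> hval u t k)"
    have "solution_pair H ?x ?u"
      using * fin by (intro solution_pair_append_jump[OF reg D sol]) auto
    moreover have "(t, Suc k) \<notin> dom u" using fin solution_pair_dom[OF sol] by simp
    then have "x \<subseteq>\<^sub>m ?x" "u \<subseteq>\<^sub>m ?u" "dom u \<subset> dom ?u"
      using fin by (auto simp: map_le_def)
    ultimately show False using max unfolding maximal_solution_pair_def by blast
  qed
qed

section \<open>Tails of solutions\<close>

text \<open>The restart at (t0, k0). The condition on \<open>t\<close> cuts off the part of level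
  \<open>k0\<close> before \<open>t0\<close>; earlier levels are out of reach because
  \<open>k\<close> is a natural number.\<close>

definition hshift :: "real \<Rightarrow> nat \<Rightarrow> 'a hsignal \<Rightarrow> 'a hsignal" where
  "hshift t0 k0 x = (\<lambda>(t, k). if 0 \<le> t then x (t0 + t, k0 + k) else None)"

lemma dom_hshift_iff: "(t, k) \<in> dom (hshift t0 k0 x) \<longleftrightarrow> 0 \<le> t \<and> (t0 + t, k0 + k) \<in> dom x"
  by (auto simp: hshift_def dom_def)

lemma hval_hshift: "0 \<le> t \<Longrightarrow> hval (hshift t0 k0 x) t k = hval x (t0 + t) (k0 + k)"
  by (simp add: hval_def hshift_def)

lemma jump_times_hshift_iff:
  "(t, k) \<in> jump_times (hshift t0 k0 x) \<longleftrightarrow> 0 \<le> t \<and> (t0 + t, k0 + k) \<in> jump_times x"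
  by (auto simp: jump_times_def dom_hshift_iff simp del: domIff)

lemma hsection_hshift: "hsection (hshift t0 k0 x) k = {t. 0 \<le> t \<and> t0 + t \<in> hsection x (k0 + k)}"
  unfolding hsection_def dom_hshift_iff by simp

lemma ran_hshift_subset: "ran (hshift t0 k0 x) \<subseteq> ran x"
  by (auto simp: hshift_def ran_def split: if_splits)

lemma hybrid_signal_hshift:
  assumes x: "hybrid_signal x" and t0: "(t0, k0) \<in> dom x"
  shows "hybrid_signal (hshift t0 k0 x)"
proof -
  have E: "hybrid_time_domain (dom x)" using x by (simp add: hybrid_signal_def)
  have "hybrid_time_domain (dom (hshift t0 k0 x))"
  proof (rule hybrid_time_domainI)
    show "(0, 0) \<in> dom (hshift t0 k0 x)" using t0 by (simp add: dom_hshift_iff del: domIff)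
    show "0 \<le> t" if "(t, k) \<in> dom (hshift t0 k0 x)" for t k
      using that by (simp add: dom_hshift_iff del: domIff)
    show "(r, k) \<in> dom (hshift t0 k0 x)"
      if "(s, k) \<in> dom (hshift t0 k0 x)" "(t, k) \<in> dom (hshift t0 k0 x)" "s \<le> r" "r \<le> t" for r s t k
      using that htd_convex[OF E, of "t0 + s" "k0 + k" "t0 + t" "t0 + r"]
      by (simp add: dom_hshift_iff del: domIff)
    show "\<exists>s. (s, k) \<in> dom (hshift t0 k0 x) \<and> (s, Suc k) \<in> dom (hshift t0 k0 x)"
      if "(t, Suc k) \<in> dom (hshift t0 k0 x)" for t k
    proof -
      have "(t0 + t, Suc (k0 + k)) \<in> dom x" using that by (simp add: dom_hshift_iff del: domIff)
      from htd_pred[OF E this] obtain s where s: "(s, k0 + k) \<in> dom x" "(s, Suc (k0 + k)) \<in> dom x" by blast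
      have "t0 \<le> s" using htd_less[OF E t0 s(2)] by simp
      with s show ?thesis by (intro exI[of _ "s - t0"]) (simp add: dom_hshift_iff del: domIff)
    qed
    show "t \<le> s" if "(t, k) \<in> dom (hshift t0 k0 x)" "(s, Suc k) \<in> dom (hshift t0 k0 x)" for s t k
      using that htd_step[OF E, of "t0 + t" "k0 + k" "t0 + s"] by (simp add: dom_hshift_iff del: domIff)
  qed
  then show ?thesis by (simp add: hybrid_signal_def)
qed

lemma hybrid_arc_hshift:
  assumes x: "hybrid_arc x" and t0: "(t0, k0) \<in> dom x"
  shows "hybrid_arc (hshift t0 k0 x)"
  unfolding hybrid_arc_def
proof (intro conjI allI impI)
  show "hybrid_signal (hshift t0 k0 x)"
    using x t0 by (intro hybrid_signal_hshift) (simp_all add: hybrid_arc_def)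
  fix k and a b :: real assume ab: "{a..b} \<subseteq> hsection (hshift t0 k0 x) k"
  then have nn: "0 \<le> t" if "t \<in> {a..b}" for t
    using that unfolding hsection_hshift by blast
  have "(+) t0 ` {a..b} \<subseteq> hsection x (k0 + k)"
    using ab unfolding hsection_hshift by blast
  then have "abs_continuous_on ((+) t0 ` {a..b}) (\<lambda>t. hval x t (k0 + k))"
    using x by (simp add: hybrid_arc_def)
  then have "abs_continuous_on {a..b} (\<lambda>t. hval x (t0 + t) (k0 + k))"
    by (rule abs_continuous_on_translation)
  then show "abs_continuous_on {a..b} (\<lambda>t. hval (hshift t0 k0 x) t k)"
    by (rule abs_continuous_on_cong[rotated]) (simp add: hval_hshift nn)
qed

lemma hybrid_input_hshift:
  assumes u: "hybrid_input u" and t0: "(t0, k0) \<in> dom u"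
  shows "hybrid_input (hshift t0 k0 u)"
  unfolding hybrid_input_def
proof (intro conjI allI impI)
  have hs: "hybrid_signal u" using u by (simp add: hybrid_input_def)
  show hs': "hybrid_signal (hshift t0 k0 u)" using hs t0 by (rule hybrid_signal_hshift)
  fix k
  let ?S = "hsection (hshift t0 k0 u) k"
  have nn: "0 \<le> t" and mem: "t0 + t \<in> hsection u (k0 + k)" if "t \<in> ?S" for t
    using that unfolding hsection_hshift by auto
  have "(\<lambda>t. t0 + t) \<in> lebesgue \<rightarrow>\<^sub>M lebesgue"
    using lebesgue_affine_measurable[of "\<lambda>_. 1" t0] by simp
  then have "(\<lambda>t. t0 + t) \<in> lebesgue_on ?S \<rightarrow>\<^sub>M lebesgue_on (hsection u (k0 + k))"
    by (intro measurable_restrict_space2 measurable_restrict_space1) (auto simp: space_restrict_space dest: mem)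
  moreover have "(\<lambda>t. hval u t (k0 + k)) \<in> borel_measurable (lebesgue_on (hsection u (k0 + k)))"
    using u by (simp add: hybrid_input_def)
  ultimately have "(\<lambda>t. hval u (t0 + t) (k0 + k)) \<in> borel_measurable (lebesgue_on ?S)"
    by (rule measurable_compose)
  moreover have "(\<lambda>t. hval (hshift t0 k0 u) t k) \<in> borel_measurable (lebesgue_on ?S)
      \<longleftrightarrow> (\<lambda>t. hval u (t0 + t) (k0 + k)) \<in> borel_measurable (lebesgue_on ?S)"
    by (intro measurable_cong hval_hshift nn) simp
  ultimately show "(\<lambda>t. hval (hshift t0 k0 u) t k) \<in> borel_measurable (lebesgue_on ?S)" by simp
  fix K assume K: "compact K \<and> K \<subseteq> ?S"
  have "compact ((+) t0 ` K)" using K by (intro compact_translation) simp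
  moreover have "(+) t0 ` K \<subseteq> hsection u (k0 + k)" using K mem by blast
  ultimately obtain c where "AE t in lebesgue_on ((+) t0 ` K). norm (hval u t (k0 + k)) \<le> c"
    using u unfolding hybrid_input_def by meson
  moreover have "(+) t0 ` K \<in> sets lebesgue" "K \<in> sets lebesgue"
    using K \<open>compact ((+) t0 ` K)\<close> by (auto intro: lmeasurable_compact fmeasurableD)
  ultimately have "AE t in lebesgue. t \<in> (+) t0 ` K \<longrightarrow> norm (hval u t (k0 + k)) \<le> c"
    by (subst (asm) AE_restrict_space_iff) auto
  then have "AE t in lebesgue. t0 + t \<in> (+) t0 ` K \<longrightarrow> norm (hval u (t0 + t) (k0 + k)) \<le> c"
    by (rule AE_lebesgue_translation)
  then have "AE t in lebesgue. t \<in> K \<longrightarrow> norm (hval (hshift t0 k0 u) t k) \<le> c"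
    by (rule eventually_mono) (use K nn in \<open>auto simp: hval_hshift\<close>)
  then show "\<exists>c. AE t in lebesgue_on K. norm (hval (hshift t0 k0 u) t k) \<le> c"
    using \<open>K \<in> sets lebesgue\<close> by (subst AE_restrict_space_iff) auto
qed

text \<open>A point of the tail is a jump time exactly if it is one of the original signal, and the
  tail has no further points, so bounds are inherited.\<close>

lemma hbound_hshift:
  assumes b: "hbound u (t0 + t) (k0 + k) c"
  shows "hbound (hshift t0 k0 u) t k c"
  unfolding hbound_def
proof (intro conjI allI ballI)
  fix l
  have "AE s in lebesgue. (s, k0 + l) \<in> dom u - jump_times u \<and> s + real (k0 + l) \<le> t0 + t + real (k0 + k) \<longrightarrow>
      norm (hval u s (k0 + l)) \<le> c"
    using b unfolding hbound_def by blast
  from AE_lebesgue_translation[OF this, of t0]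
  show "AE s in lebesgue. (s, l) \<in> dom (hshift t0 k0 u) - jump_times (hshift t0 k0 u) \<and>
      s + real l \<le> t + real k \<longrightarrow> norm (hval (hshift t0 k0 u) s l) \<le> c"
    by (rule eventually_mono) (auto simp: dom_hshift_iff jump_times_hshift_iff hval_hshift simp del: domIff)
next
  fix p assume p: "p \<in> jump_times (hshift t0 k0 u)"
  show "case p of (s, l) \<Rightarrow> s + real l \<le> t + real k \<longrightarrow> norm (hval (hshift t0 k0 u) s l) \<le> c"
  proof (clarify)
    fix s l assume "p = (s, l)" and le: "s + real l \<le> t + real k"
    with p have "0 \<le> s" "(t0 + s, k0 + l) \<in> jump_times u" by (simp_all add: jump_times_hshift_iff)
    then show "norm (hval (hshift t0 k0 u) s l) \<le> c"
      using b le by (force simp: hbound_def hval_hshift)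
  qed
qed

text \<open>The assumption \<open>start\<close> supplies the initial condition, which the other
  clauses do not provide at every point: the flow condition may fail on a null set.\<close>

lemma solution_pair_hshift:
  assumes sol: "solution_pair H x u" and t0: "(t0, k0) \<in> dom x"
    and start: "(hval x t0 k0, hval u t0 k0) \<in> overall_flow_set H \<union> overall_jump_set H"
  shows "solution_pair H (hshift t0 k0 x) (hshift t0 k0 u)"
  unfolding solution_pair_def
proof (intro conjI allI impI)
  note dom = solution_pair_dom[OF sol]
  show "hybrid_arc (hshift t0 k0 x)" by (rule hybrid_arc_hshift[OF solution_pair_arc[OF sol] t0])
  show "hybrid_input (hshift t0 k0 u)"
    by (rule hybrid_input_hshift[OF solution_pair_input[OF sol]]) (use t0 dom in simp)
  have "ran x \<subseteq> overall_state_set H" "ran u \<subseteq> input_set H"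
    using sol by (simp_all add: solution_pair_def)
  then show "ran (hshift t0 k0 x) \<subseteq> overall_state_set H" "ran (hshift t0 k0 u) \<subseteq> input_set H"
    using ran_hshift_subset[of t0 k0 x] ran_hshift_subset[of t0 k0 u] by simp_all
  show "dom (hshift t0 k0 x) = dom (hshift t0 k0 u)"
    using dom by (intro set_eqI) (simp add: dom_hshift_iff split_paired_all del: domIff)
  show "(hval (hshift t0 k0 x) 0 0, hval (hshift t0 k0 u) 0 0) \<in> overall_flow_set H \<union> overall_jump_set H"
    using start by (simp add: hval_hshift)
next
  fix k
  have "AE t in lebesgue. (t, k0 + k) \<in> dom x \<longrightarrow>
      (hval x t (k0 + k), hval u t (k0 + k)) \<in> overall_flow_set H \<and>
      ((\<lambda>s. hval x s (k0 + k)) has_vector_derivative overall_flow_map H (hval x t (k0 + k), hval u t (k0 + k)))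
          (at t within hsection x (k0 + k))"
    using sol unfolding solution_pair_def by blast
  from AE_lebesgue_translation[OF this, of t0]
  show "AE t in lebesgue. (t, k) \<in> dom (hshift t0 k0 x) \<longrightarrow>
      (hval (hshift t0 k0 x) t k, hval (hshift t0 k0 u) t k) \<in> overall_flow_set H \<and>
      ((\<lambda>s. hval (hshift t0 k0 x) s k) has_vector_derivative
        overall_flow_map H (hval (hshift t0 k0 x) t k, hval (hshift t0 k0 u) t k))
        (at t within hsection (hshift t0 k0 x) k)"
  proof (rule eventually_mono, intro impI)
    fix t
    let ?p = "(hval x (t0 + t) (k0 + k), hval u (t0 + t) (k0 + k))" and ?S = "hsection (hshift t0 k0 x) k"
    assume *: "(t0 + t, k0 + k) \<in> dom x \<longrightarrow> ?p \<in> overall_flow_set H \<and>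
        ((\<lambda>s. hval x s (k0 + k)) has_vector_derivative overall_flow_map H ?p)
          (at (t0 + t) within hsection x (k0 + k))"
      and tk: "(t, k) \<in> dom (hshift t0 k0 x)"
    then have t: "0 \<le> t" and C: "?p \<in> overall_flow_set H"
      and d: "((\<lambda>s. hval x s (k0 + k)) has_vector_derivative overall_flow_map H ?p)
          (at (t0 + t) within hsection x (k0 + k))"
      by (auto simp: dom_hshift_iff simp del: domIff)
    \<comment> \<open>The tail may lose points to the left of \<open>t\<close>, so the derivative is
      restricted to the smaller set before the chain rule is applied.\<close>
    have "(+) t0 ` ?S \<subseteq> hsection x (k0 + k)" unfolding hsection_hshift by blast
    then have "((\<lambda>s. hval x s (k0 + k)) has_vector_derivative overall_flow_map H ?p)
          (at (t0 + t) within (+) t0 ` ?S)"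
      by (rule has_vector_derivative_within_subset[OF d])
    moreover have "((+) t0 has_vector_derivative 1) (at t within ?S)"
      by (auto intro!: derivative_eq_intros)
    ultimately have "((\<lambda>s. hval x s (k0 + k)) \<circ> (+) t0 has_vector_derivative 1 *\<^sub>R overall_flow_map H ?p) (at t within ?S)"
      by (intro vector_diff_chain_within)
    then have "((\<lambda>s. hval x (t0 + s) (k0 + k)) has_vector_derivative overall_flow_map H ?p) (at t within ?S)"
      by (simp add: o_def)
    then have "((\<lambda>s. hval (hshift t0 k0 x) s k) has_vector_derivative overall_flow_map H ?p) (at t within ?S)"
      by (rule has_vector_derivative_transform[rotated 2])
         (use tk in \<open>auto simp: hsection_def dom_hshift_iff hval_hshift simp del: domIff\<close>)
    with C show "(hval (hshift t0 k0 x) t k, hval (hshift t0 k0 u) t k) \<in> overall_flow_set H \<and>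
      ((\<lambda>s. hval (hshift t0 k0 x) s k) has_vector_derivative
        overall_flow_map H (hval (hshift t0 k0 x) t k, hval (hshift t0 k0 u) t k)) (at t within ?S)"
      unfolding hval_hshift[OF t] by blast
  qed
next
  fix t k assume "(t, k) \<in> dom (hshift t0 k0 x) \<and> (t, Suc k) \<in> dom (hshift t0 k0 x)"
  then have t: "0 \<le> t" and J: "(t0 + t, k0 + k) \<in> dom x \<and> (t0 + t, Suc (k0 + k)) \<in> dom x"
    by (simp_all add: dom_hshift_iff del: domIff)
  from J have "(hval x (t0 + t) (k0 + k), hval u (t0 + t) (k0 + k)) \<in> overall_jump_set H \<and>
      hval x (t0 + t) (Suc (k0 + k)) = overall_jump_map H (hval x (t0 + t) (k0 + k), hval u (t0 + t) (k0 + k))"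
    using sol unfolding solution_pair_def by blast
  then show "(hval (hshift t0 k0 x) t k, hval (hshift t0 k0 u) t k) \<in> overall_jump_set H"
    "hval (hshift t0 k0 x) t (Suc k) = overall_jump_map H (hval (hshift t0 k0 x) t k, hval (hshift t0 k0 u) t k)"
    by (simp_all add: hval_hshift[OF t])
qed

lemma jump_complete_hshift:
  assumes jc: "jump_complete H x u"
  shows "jump_complete H (hshift t0 k0 x) (hshift t0 k0 u)"
  unfolding jump_complete_def
proof (intro allI impI)
  fix t k
  assume *: "(t, k) \<in> dom (hshift t0 k0 x) \<and>
    (hval (hshift t0 k0 x) t k, hval (hshift t0 k0 u) t k) \<in> overall_jump_set H \<and>
    (\<forall>s. (s, k) \<in> dom (hshift t0 k0 x) \<longrightarrow> s \<le> t)"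
  then have t: "0 \<le> t" "(t0 + t, k0 + k) \<in> dom x" by (simp_all add: dom_hshift_iff del: domIff)
  have "s \<le> t0 + t" if "(s, k0 + k) \<in> dom x" for s
  proof (cases "t0 \<le> s")
    case True
    then have "(s - t0, k) \<in> dom (hshift t0 k0 x)" using that by (simp add: dom_hshift_iff del: domIff)
    then have "s - t0 \<le> t" using * by blast
    then show ?thesis by simp
  qed (use t in simp)
  then have "(t0 + t, Suc (k0 + k)) \<in> dom x"
    using jc * t unfolding jump_complete_def hval_hshift[OF t(1)] by blast
  then show "(t, Suc k) \<in> dom (hshift t0 k0 x)"
    using t(1) by (simp add: dom_hshift_iff del: domIff)
qed

text \<open>A jump increases \<open>s + l\<close> by exactly 1, so no window of length 1 is skipped.\<close>

lemma htd_point_in_window: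
  assumes E: "hybrid_time_domain E" and tk: "(t, k) \<in> E" and T: "0 \<le> T" "T \<le> t + real k"
  obtains s l where "(s, l) \<in> E" "T \<le> s + real l" "s + real l \<le> T + 1"
proof -
  define l where "l = (LEAST l. \<exists>s. (s, l) \<in> E \<and> T \<le> s + real l)"
  have "\<exists>s. (s, k) \<in> E \<and> T \<le> s + real k" using tk T by blast
  then have "\<exists>s. (s, l) \<in> E \<and> T \<le> s + real l" unfolding l_def by (rule LeastI)
  then obtain s where s: "(s, l) \<in> E" "T \<le> s + real l" by blast
  have less: "s + real m < T" if "(s, m) \<in> E" "m < l" for s m
    using not_less_Least[of m "\<lambda>l. \<exists>s. (s, l) \<in> E \<and> T \<le> s + real l"] that unfolding l_def by force
  obtain a where a: "(a, l) \<in> E" "l = 0 \<and> a = 0 \<or> (\<exists>m. l = Suc m \<and> (a, m) \<in> E)"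
    using htd_least[OF E s(1)] by blast
  \<comment> \<open>By minimality of \<open>l\<close>, the point from which the jump to level
    \<open>l\<close> occurs still has sum below \<open>T\<close>; the jump adds 1.\<close>
  have up: "a + real l \<le> T + 1"
    using a(2)
  proof (elim disjE exE conjE)
    fix m assume "l = Suc m" "(a, m) \<in> E"
    then show ?thesis using less[of a m] by simp
  qed (use T in simp)
  show ?thesis
  proof (cases "T \<le> a + real l")
    case True
    then show ?thesis using that a(1) up by blast
  next
    case False
    then have "(T - real l, l) \<in> E" using htd_convex[OF E a(1) s(1), of "T - real l"] s(2) by simp
    then show ?thesis using that[of "T - real l" l] by simp
  qed
qed

lemma AE_lebesgue_obtain:
  fixes a b :: real
  assumes "AE t in lebesgue. P t" "a < b"
  obtains t where "a < t" "t < b" "P t"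
proof (rule ccontr)
  assume "\<not> thesis"
  then have "box a b \<subseteq> {t. \<not> P t}" using that by (auto simp: mem_box)
  moreover have "negligible {t. \<not> P t}"
    using assms(1) by (simp add: completion.AE_iff_null_sets negligible_iff_null_sets)
  ultimately have "negligible (box a b)" using negligible_subset by blast
  with assms(2) negligible_interval(2)[of a b] show False by simp
qed

text \<open>Take a point (s, l) with sum in [T, T + 1]. If its level continues beyond
  \<open>s\<close>, almost every time soon after lies in the flow set; otherwise the solution jumps
  at (s, l). The second unit of the window is room for moving along the flow.\<close>

lemma restart_point_exists:
  assumes sol: "solution_pair H x u" and tk: "(t, k) \<in> dom x" and T: "0 \<le> T" "T + 2 \<le> t + real k"
  obtains t0 k0 where "(t0, k0) \<in> dom x" "t0 \<le> t" "k0 \<le> k" "T \<le> t0 + real k0" "t0 + real k0 \<le> T + 2"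
    "(hval x t0 k0, hval u t0 k0) \<in> overall_flow_set H \<union> overall_jump_set H"
proof -
  note E = solution_pair_htd[OF sol] and result = that
  obtain s l where sl: "(s, l) \<in> dom x" "T \<le> s + real l" "s + real l \<le> T + 1"
    by (rule htd_point_in_window[OF E tk T(1)]) (use T(2) in auto)
  have le: "s \<le> t" "l \<le> k" using htd_order[OF E sl(1) tk] sl(3) T(2) by auto
  have flow: thesis if b: "(b, l) \<in> dom x" "s < b" for b
  proof -
    have "AE r in lebesgue. (r, l) \<in> dom x \<longrightarrow> (hval x r l, hval u r l) \<in> overall_flow_set H"
      using sol unfolding solution_pair_def by (auto elim!: allE[of _ l] eventually_mono)
    \<comment> \<open>The bound \<open>min b (s + 1)\<close> keeps \<open>r\<close> inside the level
      and its sum below T + 2.\<close>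
    then obtain r where r: "s < r" "r < min b (s + 1)"
      "(r, l) \<in> dom x \<longrightarrow> (hval x r l, hval u r l) \<in> overall_flow_set H"
      by (rule AE_lebesgue_obtain[of _ s "min b (s + 1)"]) (use b in auto)
    then have rl: "(r, l) \<in> dom x" using htd_convex[OF E sl(1) b(1), of r] by simp
    have "r \<le> t" using htd_order(1)[OF E rl tk] r(2) sl(3) T(2) by simp
    then show thesis using result[OF rl _ le(2)] r sl rl by auto
  qed
  show thesis
  proof (cases "l = k")
    case True
    \<comment> \<open>Because s + l \<le> T + 1 < t + k, the point found is not the end
      point.\<close>
    then have "s < t" using sl(3) T(2) by simp
    then show thesis using flow[of t] tk True by simp
  next
    case False
    then obtain b where b: "(b, l) \<in> dom x" "(b, Suc l) \<in> dom x"
      using htd_jump[OF E tk, of l] le(2) by auto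
    show thesis
    proof (cases "b = s")
      case True
      then have "(hval x s l, hval u s l) \<in> overall_jump_set H"
        using sol b unfolding solution_pair_def by blast
      then show thesis using result[OF sl(1) le sl(2)] sl(3) by simp
    next
      case False
      then have "s < b" using htd_step[OF E sl(1) b(2)] by simp
      then show thesis using flow b(1) by blast
    qed
  qed
qed

section \<open>The small-gain argument\<close>

lemma hbound_earlier:
  assumes "hbound u t k c" "s + real l \<le> t + real k"
  shows "hbound u s l c"
  using assms(1) unfolding hbound_def
proof (elim conjE, intro conjI allI)
  fix m
  assume "\<forall>l. AE s in lebesgue. (s, l) \<in> dom u - jump_times u \<and> s + real l \<le> t + real k \<longrightarrow> norm (hval u s l) \<le> c"
  then show "AE r in lebesgue. (r, m) \<in> dom u - jump_times u \<and> r + real m \<le> s + real l \<longrightarrow> norm (hval u r m) \<le> c"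
    by (elim allE[of _ m] eventually_mono) (use assms(2) in auto)
next
  assume "\<forall>(s, l)\<in>jump_times u. s + real l \<le> t + real k \<longrightarrow> norm (hval u s l) \<le> c"
  then show "\<forall>(r, m)\<in>jump_times u. r + real m \<le> s + real l \<longrightarrow> norm (hval u r m) \<le> c"
    using assms(2) by fastforce
qed

text \<open>Maxima and compositions of the gains are nondecreasing but may be constant. Adding the
  identity makes them strictly increasing and unbounded and only enlarges an upper bound.\<close>

lemma class_Kinf_add_self:
  assumes "continuous_on {0..} f" and mono: "\<And>a b. 0 \<le> a \<Longrightarrow> a \<le> b \<Longrightarrow> f a \<le> f b" and "f 0 = 0"
  shows "class_Kinf (\<lambda>s. f s + s)"
  unfolding class_Kinf_def class_K_def
proof (intro conjI allI)
  show "continuous_on {0..} (\<lambda>s. f s + s)" using assms(1) by (intro continuous_intros)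
  show "strict_mono_on {0..} (\<lambda>s. f s + s)"
    by (intro strict_mono_onI add_le_less_mono mono) auto
  show "f 0 + 0 = 0" using assms(3) by simp
  fix M
  show "\<exists>s\<ge>0. M < f s + s"
    using mono[of 0 "\<bar>M\<bar> + 1"] assms(3) by (intro exI[of _ "\<bar>M\<bar> + 1"]) auto
qed

lemma class_KLLD:
  assumes "class_KLL \<beta>"
  shows class_KLL_class_K: "\<And>t r. 0 \<le> t \<Longrightarrow> 0 \<le> r \<Longrightarrow> class_K (\<lambda>s. \<beta> s t r)"
    and class_KLL_antimono: "\<And>s t r t' r'. 0 \<le> s \<Longrightarrow> 0 \<le> t \<Longrightarrow> t \<le> t' \<Longrightarrow> 0 \<le> r \<Longrightarrow> r \<le> r' \<Longrightarrow> \<beta> s t' r' \<le> \<beta> s t r"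
    and class_KLL_decay: "\<And>s \<epsilon>. 0 \<le> s \<Longrightarrow> 0 < \<epsilon> \<Longrightarrow> \<exists>T\<ge>0. \<forall>t\<ge>0. \<forall>r\<ge>0. T \<le> t + r \<longrightarrow> \<beta> s t r \<le> \<epsilon>"
proof -
  have K: "class_KL (\<lambda>s t. \<beta> s t r)" "class_KL (\<lambda>s t. \<beta> s r t)" if "0 \<le> r" for r
    using assms that by (simp_all add: class_KLL_def)
  show "class_K (\<lambda>s. \<beta> s t r)" if "0 \<le> t" "0 \<le> r" for t r
    using K(1)[OF that(2)] that(1) by (simp add: class_KL_def)
  show anti: "\<beta> s t' r' \<le> \<beta> s t r" if "0 \<le> s" "0 \<le> t" "t \<le> t'" "0 \<le> r" "r \<le> r'" for s t r t' r'
  proof -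
    have "\<beta> s t' r' \<le> \<beta> s t' r"
      using K(2)[of t'] that unfolding class_KL_def monotone_on_def by auto
    also have "\<dots> \<le> \<beta> s t r"
      using K(1)[of r] that unfolding class_KL_def monotone_on_def by auto
    finally show ?thesis .
  qed
  show "\<exists>T\<ge>0. \<forall>t\<ge>0. \<forall>r\<ge>0. T \<le> t + r \<longrightarrow> \<beta> s t r \<le> \<epsilon>" if "0 \<le> s" "0 < \<epsilon>" for s \<epsilon>
  proof -
    have "((\<lambda>t. \<beta> s t 0) \<longlongrightarrow> 0) at_top" "((\<lambda>r. \<beta> s 0 r) \<longlongrightarrow> 0) at_top"
      using K[of 0] that by (simp_all add: class_KL_def)
    then have "\<forall>\<^sub>F t in at_top. \<beta> s t 0 < \<epsilon>" "\<forall>\<^sub>F r in at_top. \<beta> s 0 r < \<epsilon>"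
      using that(2) by (auto dest: order_tendstoD(2))
    then obtain T1 T2 where T: "\<And>t. T1 \<le> t \<Longrightarrow> \<beta> s t 0 < \<epsilon>" "\<And>r. T2 \<le> r \<Longrightarrow> \<beta> s 0 r < \<epsilon>"
      unfolding eventually_at_top_linorder by blast
    \<comment> \<open>The class KLL gives a limit in each argument separately. If the sum is large,
      one of the two arguments is large, and monotonicity allows replacing the other by 0.\<close>
    have "\<beta> s t r \<le> \<epsilon>" if tr: "0 \<le> t" "0 \<le> r" "max 0 T1 + max 0 T2 \<le> t + r" for t r
    proof (cases "T1 \<le> t")
      case True
      then show ?thesis using T(1)[of t] anti[of s t t 0 r] tr \<open>0 \<le> s\<close> by simp
    next
      case False
      then have "T2 \<le> r" using tr(3) by auto
      then show ?thesis using T(2)[of r] anti[of s 0 t r r] tr \<open>0 \<le> s\<close> by simp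
    qed
    then show ?thesis by (intro exI[of _ "max 0 T1 + max 0 T2"]) auto
  qed
qed

lemma class_KL_scale:
  assumes \<beta>: "class_KL \<beta>" and c: "0 < c"
  shows "class_KL (\<lambda>s t. c * \<beta> s t)"
  unfolding class_KL_def
proof (intro conjI allI impI)
  show "class_K (\<lambda>s. c * \<beta> s t)" if "0 \<le> t" for t
  proof -
    have K: "continuous_on {0..} (\<lambda>s. \<beta> s t)" "strict_mono_on {0..} (\<lambda>s. \<beta> s t)" "\<beta> 0 t = 0"
      using \<beta> that unfolding class_KL_def class_K_def by auto
    show ?thesis
      unfolding class_K_def
      by (intro conjI continuous_intros K(1) strict_mono_onI mult_strict_left_mono[OF _ c])
         (use strict_mono_onD[OF K(2)] K(3) in auto)
  qed
  fix s :: real assume s: "0 \<le> s"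
  show "antimono_on {0..} (\<lambda>t. c * \<beta> s t)"
    using \<beta> s c unfolding class_KL_def monotone_on_def by auto
  have "(\<beta> s \<longlongrightarrow> 0) at_top" using \<beta> s by (simp add: class_KL_def)
  from tendsto_mult_left[OF this, of c] show "((\<lambda>t. c * \<beta> s t) \<longlongrightarrow> 0) at_top" by simp
qed

lemma Max_range_mono:
  fixes f g :: "'i::finite \<Rightarrow> real"
  assumes "\<And>i. f i \<le> g i"
  shows "Max (range f) \<le> Max (range g)"
proof (rule Max.boundedI)
  fix y assume "y \<in> range f"
  then obtain i where "y = f i" by blast
  moreover have "g i \<le> Max (range g)" by (intro Max_ge) auto
  ultimately show "y \<le> Max (range g)" using assms[of i] by linarith
qed auto

section \<open>Stability and attractivity under the small-gain condition\<close>

text \<open>The transient bounds are fixed as one family, so that maxima over the subsystems can be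
  formed.\<close>

locale small_gain_interconnection =
  fixes H :: "('n::finite, 'c::finite, 'm::finite) interconnection"
    and \<gamma> :: "'n \<Rightarrow> 'n \<Rightarrow> real \<Rightarrow> real" and \<gamma>u :: "'n \<Rightarrow> real \<Rightarrow> real"
    and \<beta> :: "'n \<Rightarrow> real \<Rightarrow> real \<Rightarrow> real \<Rightarrow> real"
  assumes card: "CARD('n) \<ge> 2" and reg: "regular_interconnection H"
    and D: "\<And>i. jump_set H i = overall_jump_set H"
    and Kinf0: "\<And>i j. j \<noteq> i \<Longrightarrow> class_Kinf0 (\<gamma> i j)" and Ku: "\<And>i. class_Kinf0 (\<gamma>u i)"
    and KLL: "\<And>i. class_KLL (\<beta> i)"
    and ISS: "\<And>i xs u t k. maximal_sub_solution_pair H i xs u \<Longrightarrow> (t, k) \<in> dom (xs i) \<Longrightarrow>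
      norm (hval (xs i) t k) \<le> Max {\<beta> i (norm (hval (xs i) 0 0)) t (real k),
         Max ((\<lambda>j. \<gamma> i j (hnorm (xs j) t k)) ` (UNIV - {i})), \<gamma>u i (hnorm u t k)}"
    and small_gain: "\<And>s. (\<forall>i. s $ i \<ge> 0) \<Longrightarrow> s \<noteq> 0 \<Longrightarrow> \<exists>i. Gamma_max \<gamma> s $ i < s $ i"
begin

definition input_gain :: "real \<Rightarrow> real" where
  "input_gain w = Max (range (\<lambda>i. \<gamma>u i w))"

definition overshoot :: "real \<Rightarrow> real" where
  "overshoot r = Max (range (\<lambda>i. \<beta> i r 0 0))"

definition closed_gain :: "real \<Rightarrow> real ^ 'n" where
  "closed_gain r = gain_iter \<gamma> (CARD('n)) r"

lemma input_gain_ge: "\<gamma>u i w \<le> input_gain w"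
  unfolding input_gain_def by (intro Max_ge) auto

lemma input_gain_mono: "0 \<le> a \<Longrightarrow> a \<le> b \<Longrightarrow> input_gain a \<le> input_gain b"
  unfolding input_gain_def by (intro Max_range_mono class_Kinf0_mono[OF Ku])

lemma input_gain_0: "input_gain 0 = 0"
  by (simp add: input_gain_def class_Kinf0_zero[OF Ku])

lemma input_gain_continuous: "continuous_on {0..} input_gain"
  unfolding input_gain_def[abs_def] by (intro continuous_on_Max class_Kinf0_continuous[OF Ku]) auto

lemma \<beta>_class_K: "class_K (\<lambda>s. \<beta> i s 0 0)"
  by (rule class_KLL_class_K[OF KLL]) auto

lemma overshoot_ge: "\<beta> i r 0 0 \<le> overshoot r"
  unfolding overshoot_def by (intro Max_ge) auto

lemma overshoot_mono: "0 \<le> a \<Longrightarrow> a \<le> b \<Longrightarrow> overshoot a \<le> overshoot b"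
  unfolding overshoot_def by (intro Max_range_mono class_K_mono[OF \<beta>_class_K])

lemma overshoot_0: "overshoot 0 = 0"
  using \<beta>_class_K by (simp add: overshoot_def class_K_def)

lemma overshoot_continuous: "continuous_on {0..} overshoot"
  unfolding overshoot_def[abs_def] using \<beta>_class_K by (intro continuous_on_Max) (auto simp: class_K_def)

lemma input_gain_nonneg: "0 \<le> w \<Longrightarrow> 0 \<le> input_gain w"
  using input_gain_mono[of 0 w] input_gain_0 by simp

lemma overshoot_nonneg: "0 \<le> w \<Longrightarrow> 0 \<le> overshoot w"
  using overshoot_mono[of 0 w] overshoot_0 by simp

lemma closed_gain_ge: "r \<le> closed_gain r $ i"
  unfolding closed_gain_def by (rule gain_iter_ge[OF card Kinf0])

lemma closed_gain_nonneg: "0 \<le> r \<Longrightarrow> 0 \<le> closed_gain r $ i"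
  using closed_gain_ge order_trans by blast

lemma closed_gain_mono: "0 \<le> a \<Longrightarrow> a \<le> b \<Longrightarrow> closed_gain a $ i \<le> closed_gain b $ i"
  unfolding closed_gain_def by (rule gain_iter_mono[OF card Kinf0])

lemma closed_gain_0: "closed_gain 0 = 0"
  unfolding closed_gain_def by (rule gain_iter_zero[OF card Kinf0])

lemma closed_gain_continuous: "continuous_on {0..} (\<lambda>r. closed_gain r $ i)"
  unfolding closed_gain_def by (rule gain_iter_continuous[OF card Kinf0])

lemma Gamma_max_closed_gain_le: "0 \<le> r \<Longrightarrow> Gamma_max \<gamma> (closed_gain r) $ i \<le> closed_gain r $ i"
  unfolding closed_gain_def by (rule Gamma_max_gain_iter_le[OF card Kinf0 small_gain])

text \<open>This separates the contributions of the initial value and of the input; it holds because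
  \<open>closed_gain\<close> is nondecreasing in its single argument.\<close>

lemma closed_gain_max:
  "0 \<le> a \<Longrightarrow> 0 \<le> b \<Longrightarrow> closed_gain (max a b) $ i = max (closed_gain a $ i) (closed_gain b $ i)"
  using closed_gain_mono[of a b i] closed_gain_mono[of b a i] by (cases "a \<le> b") (auto simp: max_def)

lemma estimate:
  assumes "solution_pair H x u" "jump_complete H x u" "(t, k) \<in> dom x"
    and "\<And>j. 0 \<le> b $ j" "\<And>j. hbound (block_signal H x j) t k (b $ j)" "0 \<le> c" "hbound u t k c"
  shows "norm (block_proj H i (hval x t k)) \<le>
    max (\<beta> i (norm (block_proj H i (hval x 0 0))) t (real k)) (max (Gamma_max \<gamma> b $ i) (\<gamma>u i c))"
proof (rule sub_ISS_estimate[OF card reg D Kinf0 Ku _ assms])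
  show "norm (hval (xs i) t k) \<le> Max {\<beta> i (norm (hval (xs i) 0 0)) t (real k),
         Max ((\<lambda>j. \<gamma> i j (hnorm (xs j) t k)) ` (UNIV - {i})), \<gamma>u i (hnorm u t k)}"
    if "maximal_sub_solution_pair H i xs u" "(t, k) \<in> dom (xs i)" for xs u t k
    by (rule ISS[OF that])
qed

text \<open>The norms up to (t, k) also bound the signals up to every earlier point. So a single
  vector \<open>M\<close> serves in the estimates at all these points, which then bound
  \<open>M\<close> itself.\<close>

lemma global_stability:
  assumes sol: "solution_pair H x u" and jc: "jump_complete H x u" and tk: "(t, k) \<in> dom x"
  shows "norm (block_proj H i (hval x t k)) \<le>
    closed_gain (max (overshoot (norm (hval x 0 0))) (input_gain (hnorm u t k))) $ i"
proof -
  define w where "w = hnorm u t k"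
  define r where "r = max (overshoot (norm (hval x 0 0))) (input_gain w)"
  define M :: "real ^ 'n" where "M = (\<chi> j. hnorm (block_signal H x j) t k)"
  have w: "0 \<le> w" "hbound u t k w"
    using hnorm_nonneg hbound_hnorm[OF solution_pair_input[OF sol]] tk solution_pair_dom[OF sol]
    by (simp_all add: w_def)
  have r: "0 \<le> r" using overshoot_nonneg by (simp add: r_def le_max_iff_disj)
  have M0: "0 \<le> M $ j" for j by (simp add: M_def hnorm_nonneg)
  have inp: "hybrid_input (block_signal H x j)" for j
    by (rule hybrid_arc_imp_hybrid_input[OF hybrid_arc_block_signal[OF solution_pair_arc[OF sol]]])
  have Mb: "hbound (block_signal H x j) t k (M $ j)" for j
    unfolding M_def vec_lambda_beta using tk by (intro hbound_hnorm[OF inp]) simp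
  have pt: "norm (block_proj H j (hval x s l)) \<le> max r (Gamma_max \<gamma> M $ j)"
    if sl: "(s, l) \<in> dom x" "s + real l \<le> t + real k" for s l j
  proof -
    have "norm (block_proj H j (hval x s l)) \<le>
      max (\<beta> j (norm (block_proj H j (hval x 0 0))) s (real l)) (max (Gamma_max \<gamma> M $ j) (\<gamma>u j w))"
      by (rule estimate[OF sol jc sl(1) M0 hbound_earlier[OF Mb sl(2)] w(1) hbound_earlier[OF w(2) sl(2)]])
    moreover have "\<beta> j (norm (block_proj H j (hval x 0 0))) s (real l) \<le> r"
    proof -
      have "\<beta> j (norm (block_proj H j (hval x 0 0))) s (real l) \<le> \<beta> j (norm (block_proj H j (hval x 0 0))) 0 0"
        using htd_nonneg[OF solution_pair_htd[OF sol] sl(1)] by (intro class_KLL_antimono[OF KLL]) auto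
      also have "\<dots> \<le> \<beta> j (norm (hval x 0 0)) 0 0"
        by (intro class_K_mono[OF \<beta>_class_K] norm_block_proj_le) simp
      also have "\<dots> \<le> overshoot (norm (hval x 0 0))" by (rule overshoot_ge)
      finally show ?thesis by (simp add: r_def)
    qed
    moreover have "\<gamma>u j w \<le> r" using input_gain_ge[of j w] by (simp add: r_def)
    ultimately show ?thesis by linarith
  qed
  have M1: "M $ j \<le> max r (Gamma_max \<gamma> M $ j)" for j
    unfolding M_def vec_lambda_beta
  proof (rule hnorm_le[OF inp])
    show "hbound (block_signal H x j) t k (max r (Gamma_max \<gamma> (\<chi> j. hnorm (block_signal H x j) t k) $ j))"
      by (rule hbound_of_pointwise) (use pt in \<open>simp add: hval_block_signal M_def del: domIff\<close>)
  qed (use r in simp)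
  have MQ: "M $ j \<le> closed_gain r $ j" for j
    unfolding closed_gain_def by (rule small_gain_bound[OF card Kinf0 small_gain r M0 M1])
  \<comment> \<open>An essential supremum says nothing about the value at (t, k) itself, so the
    estimate is applied once more there.\<close>
  have "norm (block_proj H i (hval x t k)) \<le> max r (Gamma_max \<gamma> M $ i)"
    by (rule pt[OF tk]) simp
  moreover have "Gamma_max \<gamma> M $ i \<le> Gamma_max \<gamma> (closed_gain r) $ i"
    by (rule Gamma_max_mono[OF card Kinf0 M0 MQ])
  with Gamma_max_closed_gain_le[OF r, of i] have "Gamma_max \<gamma> M $ i \<le> closed_gain r $ i" by linarith
  ultimately show ?thesis
    using closed_gain_ge[of r i] unfolding r_def w_def by linarith
qed

text \<open>Restart at a point whose sum lies between T and T + 2. The tail sees only values bounded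
  by \<open>b\<close>, and at least \<open>L\<close> has passed up to (s, l), so the transient,
  which starts from at most \<open>b0\<close>, is below \<delta>.\<close>

lemma window_step:
  assumes sol: "solution_pair H x u" and jc: "jump_complete H x u"
    and u: "hbound u t k w" "0 \<le> w" and T: "0 \<le> T"
    and b: "\<And>i. 0 \<le> b $ i" "\<And>i. b $ i \<le> b0"
    and window: "\<And>s l i. (s, l) \<in> dom x \<Longrightarrow> T \<le> s + real l \<Longrightarrow> s + real l \<le> t + real k \<Longrightarrow>
      norm (block_proj H i (hval x s l)) \<le> b $ i"
    and L: "0 \<le> L" "\<And>i \<tau> \<kappa>. 0 \<le> \<tau> \<Longrightarrow> 0 \<le> \<kappa> \<Longrightarrow> L \<le> \<tau> + \<kappa> \<Longrightarrow> \<beta> i b0 \<tau> \<kappa> \<le> \<delta>"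
    and sl: "(s, l) \<in> dom x" "T + 2 + L \<le> s + real l" "s + real l \<le> t + real k"
  shows "norm (block_proj H i (hval x s l)) \<le> max \<delta> (max (Gamma_max \<gamma> b $ i) (\<gamma>u i w))"
proof -
  obtain t0 k0 where t0: "(t0, k0) \<in> dom x" "t0 \<le> s" "k0 \<le> l" "T \<le> t0 + real k0" "t0 + real k0 \<le> T + 2"
    and start: "(hval x t0 k0, hval u t0 k0) \<in> overall_flow_set H \<union> overall_jump_set H"
    by (rule restart_point_exists[OF sol sl(1) T]) (use sl(2) L(1) in auto)
  define X U where "X = hshift t0 k0 x" and "U = hshift t0 k0 u"
  have sol': "solution_pair H X U" and jc': "jump_complete H X U"
    unfolding X_def U_def using solution_pair_hshift[OF sol t0(1) start] jump_complete_hshift[OF jc] by auto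
  have tk': "(s - t0, l - k0) \<in> dom X"
    using sl(1) t0 by (simp add: X_def dom_hshift_iff del: domIff)
  have bX: "hbound (block_signal H X j) (s - t0) (l - k0) (b $ j)" for j
  proof (rule hbound_of_pointwise)
    fix \<tau> m assume "(\<tau>, m) \<in> dom (block_signal H X j)" and le: "\<tau> + real m \<le> s - t0 + real (l - k0)"
    then have X: "(\<tau>, m) \<in> dom X" by simp
    then have \<tau>: "0 \<le> \<tau>" "(t0 + \<tau>, k0 + m) \<in> dom x" by (simp_all add: X_def dom_hshift_iff del: domIff)
    have "norm (block_proj H j (hval x (t0 + \<tau>) (k0 + m))) \<le> b $ j"
      using \<tau> le t0 sl by (intro window) (auto simp: of_nat_diff)
    then show "norm (hval (block_signal H X j) \<tau> m) \<le> b $ j"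
      unfolding hval_block_signal[OF X] using \<tau> by (simp add: X_def hval_hshift)
  qed
  have bU: "hbound U (s - t0) (l - k0) w"
    unfolding U_def using t0(2,3) hbound_earlier[OF u(1) sl(3)] by (intro hbound_hshift) simp
  have "norm (block_proj H i (hval X (s - t0) (l - k0))) \<le>
    max (\<beta> i (norm (block_proj H i (hval X 0 0))) (s - t0) (real (l - k0))) (max (Gamma_max \<gamma> b $ i) (\<gamma>u i w))"
    by (rule estimate[OF sol' jc' tk' b(1) bX u(2) bU])
  moreover have "hval X (s - t0) (l - k0) = hval x s l"
    using t0 by (simp add: X_def hval_hshift)
  moreover have "\<beta> i (norm (block_proj H i (hval X 0 0))) (s - t0) (real (l - k0)) \<le> \<delta>"
  proof -
    have "norm (block_proj H i (hval X 0 0)) \<le> b0"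
      using window[OF t0(1,4), of i] t0 sl b(2)[of i] by (simp add: X_def hval_hshift)
    then have "\<beta> i (norm (block_proj H i (hval X 0 0))) (s - t0) (real (l - k0)) \<le> \<beta> i b0 (s - t0) (real (l - k0))"
      using t0 by (intro class_K_mono[OF class_KLL_class_K[OF KLL]]) auto
    also have "\<dots> \<le> \<delta>" using t0 sl by (intro L(2)) (auto simp: of_nat_diff)
    finally show ?thesis .
  qed
  ultimately show ?thesis by (auto simp: le_max_iff_disj)
qed

text \<open>Every choice below depends only on \<open>R\<close> and \<epsilon>, not on the solution;
  this gives the uniformity needed for a class KL bound.\<close>

lemma uniform_attractivity:
  assumes R: "0 \<le> R" and \<epsilon>: "0 < \<epsilon>"
  obtains T where "\<And>x u t k i. solution_pair H x u \<Longrightarrow> jump_complete H x u \<Longrightarrow> (t, k) \<in> dom x \<Longrightarrow>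
    norm (hval x 0 0) \<le> R \<Longrightarrow> T \<le> t + real k \<Longrightarrow>
    norm (block_proj H i (hval x t k)) \<le> max \<epsilon> (closed_gain (input_gain (hnorm u t k)) $ i)"
proof -
  \<comment> \<open>The transients of the restarts are driven only below some \<delta>, whose
    remaining effect is \<open>closed_gain \<delta>\<close>. Continuity at 0 makes this less than
    \<epsilon>.\<close>
  have "\<forall>\<^sub>F d in at_right 0. \<forall>i\<in>UNIV. closed_gain d $ i < \<epsilon>"
  proof (intro eventually_ball_finite ballI)
    fix i
    have "((\<lambda>d. closed_gain d $ i) \<longlongrightarrow> closed_gain 0 $ i) (at 0 within {0..})"
      using closed_gain_continuous[of i] by (simp add: continuous_on)
    then have "((\<lambda>d. closed_gain d $ i) \<longlongrightarrow> 0) (at_right 0)"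
      by (rule tendsto_within_subset[THEN filterlim_cong[THEN iffD1, rotated 3]])
         (auto simp: closed_gain_0)
    then show "\<forall>\<^sub>F d in at_right 0. closed_gain d $ i < \<epsilon>"
      using \<epsilon> by (rule order_tendstoD(2))
  qed simp
  moreover have "\<forall>\<^sub>F d :: real in at_right 0. 0 < d" by (rule eventually_at_right_less)
  ultimately have "\<forall>\<^sub>F d in at_right 0. 0 < d \<and> (\<forall>i. closed_gain d $ i < \<epsilon>)"
    by eventually_elim simp
  then obtain \<delta> where \<delta>: "0 < \<delta>" "\<And>i. closed_gain \<delta> $ i < \<epsilon>"
    using eventually_happens'[OF trivial_limit_at_right_real] by blast
  \<comment> \<open>\<open>V\<close> bounds the blocks as long as the input contributes no more than
    \<open>overshoot R\<close>. The maximum with \<delta> keeps the limiting bound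
    \<open>closed_gain \<rho>\<close> below it.\<close>
  define V where "V = closed_gain (max \<delta> (overshoot R))"
  define b0 where "b0 = Max (range (($) V))"
  have V0: "0 \<le> V $ i" for i unfolding V_def using \<delta> by (intro closed_gain_nonneg) simp
  have Vb0: "V $ i \<le> b0" for i unfolding b0_def by (intro Max_ge) auto
  have "0 \<le> b0" using V0 Vb0 order_trans by blast
  have V: "Gamma_max \<gamma> V $ i \<le> V $ i" for i
    unfolding V_def using \<delta> by (intro Gamma_max_closed_gain_le) simp
  define G where "G m = (Gamma_max \<gamma> ^^ m) V" for m
  have G0: "0 \<le> G m $ i" for m i
    unfolding G_def by (induction m arbitrary: i) (use V0 Gamma_max_nonneg[OF card Kinf0] in auto)
  have GV: "G m $ i \<le> V $ i" for m i
  proof (induction m arbitrary: i)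
    case (Suc m)
    have "G (Suc m) $ i \<le> Gamma_max \<gamma> V $ i"
      using Gamma_max_mono[OF card Kinf0 G0 Suc] by (simp add: G_def)
    with V[of i] show ?case by linarith
  qed (simp add: G_def)
  have "\<forall>\<^sub>F m in sequentially. \<forall>i\<in>UNIV. G m $ i < \<epsilon>"
  proof (intro eventually_ball_finite ballI)
    fix i
    show "\<forall>\<^sub>F m in sequentially. G m $ i < \<epsilon>"
      unfolding G_def
      using Gamma_max_funpow_tendsto_0[OF card Kinf0 small_gain V0 V] \<epsilon> by (rule order_tendstoD(2))
  qed simp
  then obtain m where m: "\<And>i. G m $ i < \<epsilon>"
    using eventually_happens'[OF sequentially_bot] by blast
  \<comment> \<open>\<open>b0\<close> bounds all the vectors used below, so one decay time serves
    for every restart.\<close>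
  have "\<exists>L\<ge>0. \<forall>\<tau>\<ge>0. \<forall>\<kappa>\<ge>0. L \<le> \<tau> + \<kappa> \<longrightarrow> \<beta> i b0 \<tau> \<kappa> \<le> \<delta>" for i
    by (rule class_KLL_decay[OF KLL \<open>0 \<le> b0\<close> \<delta>(1)])
  then obtain L' where L': "\<And>i. 0 \<le> L' i" "\<And>i \<tau> \<kappa>. 0 \<le> \<tau> \<Longrightarrow> 0 \<le> \<kappa> \<Longrightarrow> L' i \<le> \<tau> + \<kappa> \<Longrightarrow> \<beta> i b0 \<tau> \<kappa> \<le> \<delta>"
    by metis
  define L where "L = Max (range L')"
  have "L' i \<le> L" for i unfolding L_def by (intro Max_ge) auto
  then have L: "0 \<le> L" "\<And>i \<tau> \<kappa>. 0 \<le> \<tau> \<Longrightarrow> 0 \<le> \<kappa> \<Longrightarrow> L \<le> \<tau> + \<kappa> \<Longrightarrow> \<beta> i b0 \<tau> \<kappa> \<le> \<delta>"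
    using L' order_trans by blast+
  show ?thesis
  \<comment> \<open>Each of the \<open>m\<close> improvements takes at most 2 to find a restart
    point and \<open>L\<close> for the transient.\<close>
  proof (rule that[of "real m * (2 + L)"])
    fix x u t k i
    assume sol: "solution_pair H x u" and jc: "jump_complete H x u" and tk: "(t, k) \<in> dom x"
      and x0: "norm (hval x 0 0) \<le> R" and T: "real m * (2 + L) \<le> t + real k"
    define w where "w = hnorm u t k"
    have w: "0 \<le> w" "hbound u t k w"
      using hnorm_nonneg hbound_hnorm[OF solution_pair_input[OF sol]] tk solution_pair_dom[OF sol]
      by (simp_all add: w_def)
    have gw: "0 \<le> input_gain w" by (rule input_gain_nonneg[OF w(1)])
    have ox: "0 \<le> overshoot (norm (hval x 0 0))" "overshoot (norm (hval x 0 0)) \<le> overshoot R"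
      using overshoot_nonneg overshoot_mono[OF _ x0] by simp_all
    show "norm (block_proj H i (hval x t k)) \<le> max \<epsilon> (closed_gain (input_gain (hnorm u t k)) $ i)"
    \<comment> \<open>If the input dominates \<open>overshoot R\<close>, global stability already
      gives the claim at all times.\<close>
    proof (cases "input_gain w \<le> overshoot R")
      case False
      then have "max (overshoot (norm (hval x 0 0))) (input_gain w) = input_gain w" using ox by simp
      then show ?thesis using global_stability[OF sol jc tk, of i] unfolding w_def by simp
    next
      case True
      define \<rho> where "\<rho> = max \<delta> (input_gain w)"
      have \<rho>: "0 \<le> \<rho>" "\<rho> \<le> max \<delta> (overshoot R)" using \<delta>(1) True by (auto simp: \<rho>_def)
      \<comment> \<open>The part \<open>closed_gain \<rho>\<close> does not grow under
        \<open>Gamma_max\<close> and lies above \<delta> and the input gains, so it absorbs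
        everything that a step adds. Only the part \<open>G q\<close> has to decrease.\<close>
      define B :: "nat \<Rightarrow> real ^ 'n" where "B q = (\<chi> i. max (G q $ i) (closed_gain \<rho> $ i))" for q
      have B: "0 \<le> B q $ i" "B q $ i \<le> b0" for q i
      proof -
        show "0 \<le> B q $ i" using G0[of q i] by (simp add: B_def le_max_iff_disj)
        have "closed_gain \<rho> $ i \<le> V $ i" unfolding V_def by (rule closed_gain_mono[OF \<rho>])
        then show "B q $ i \<le> b0" using GV[of q i] Vb0[of i] by (simp add: B_def)
      qed
      have win: "norm (block_proj H i (hval x s l)) \<le> B q $ i"
        if "(s, l) \<in> dom x" "real q * (2 + L) \<le> s + real l" "s + real l \<le> t + real k" for s l i q
        using that
      proof (induction q arbitrary: s l i)
        case 0
        \<comment> \<open>Global stability at (s, l) involves the input norm there, which is at most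
          \<open>w\<close>, so the case assumption still applies.\<close>
        have "hbound u s l w" by (rule hbound_earlier[OF w(2) 0(3)])
        then have "hnorm u s l \<le> w"
          by (intro hnorm_le[OF solution_pair_input[OF sol] w(1)])
        then have "input_gain (hnorm u s l) \<le> overshoot R"
          using input_gain_mono[OF hnorm_nonneg, of u s l w] True by linarith
        then have "closed_gain (max (overshoot (norm (hval x 0 0))) (input_gain (hnorm u s l))) $ i \<le> V $ i"
          unfolding V_def using ox by (intro closed_gain_mono) auto
        then show ?case
          using global_stability[OF sol jc 0(1), of i] by (simp add: B_def G_def le_max_iff_disj)
      next
        case (Suc q)
        have "norm (block_proj H i (hval x s l)) \<le> max \<delta> (max (Gamma_max \<gamma> (B q) $ i) (\<gamma>u i w))"
        proof (rule window_step[OF sol jc w(2,1) _ B _ L Suc.prems(1) _ Suc.prems(3)])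
          show "0 \<le> real q * (2 + L)" using L(1) by simp
          show "real q * (2 + L) + 2 + L \<le> s + real l" using Suc.prems(2) by (simp add: algebra_simps)
        qed (rule Suc.IH)
        also have "\<dots> \<le> B (Suc q) $ i"
        proof -
          have "Gamma_max \<gamma> (B q) $ i \<le> max (Gamma_max \<gamma> (G q) $ i) (Gamma_max \<gamma> (closed_gain \<rho>) $ i)"
            unfolding B_def by (rule Gamma_max_max[OF card Kinf0 G0 closed_gain_nonneg[OF \<rho>(1)]])
          also have "\<dots> \<le> B (Suc q) $ i"
            using Gamma_max_closed_gain_le[OF \<rho>(1), of i] by (auto simp: B_def G_def)
          finally have "Gamma_max \<gamma> (B q) $ i \<le> B (Suc q) $ i" .
          moreover have "\<rho> \<le> B (Suc q) $ i"
            using closed_gain_ge[of \<rho> i] by (simp add: B_def le_max_iff_disj)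
          moreover have "\<delta> \<le> \<rho>" "\<gamma>u i w \<le> \<rho>" using input_gain_ge[of i w] by (simp_all add: \<rho>_def)
          ultimately show ?thesis by simp
        qed
        finally show ?case .
      qed
      have "norm (block_proj H i (hval x t k)) \<le> B m $ i" by (rule win[OF tk T]) simp
      also have "\<dots> \<le> max \<epsilon> (closed_gain (input_gain w) $ i)"
        \<comment> \<open>After \<open>m\<close> steps \<open>G m\<close> is below \<epsilon>;
          \<open>closed_gain \<rho>\<close> splits into its value at \<delta>, also below
          \<epsilon>, and its value at the input gain.\<close>
        unfolding B_def \<rho>_def using m[of i] \<delta> gw
        by (simp add: closed_gain_max) (meson less_imp_le max.coboundedI1 \<delta>(2))
      finally show ?thesis by (simp add: w_def)
    qed
  qed
qed

lemma overall_ISS: "overall_ISS H"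
proof -
  define gain where "gain r = Max (range (\<lambda>i. closed_gain r $ i))" for r
  have gain_ge: "closed_gain r $ i \<le> gain r" for r i unfolding gain_def by (intro Max_ge) auto
  have gain_mono: "gain a \<le> gain b" if "0 \<le> a" "a \<le> b" for a b
    unfolding gain_def by (intro Max_range_mono closed_gain_mono that)
  have gain_cont: "continuous_on {0..} gain"
    unfolding gain_def[abs_def] by (intro continuous_on_Max closed_gain_continuous) auto
  have gain_0: "gain 0 = 0" by (simp add: gain_def closed_gain_0)
  define \<sigma> where "\<sigma> r = gain (overshoot r) + r" for r
  have "class_Kinf \<sigma>"
    unfolding \<sigma>_def
  proof (rule class_Kinf_add_self)
    show "continuous_on {0..} (\<lambda>r. gain (overshoot r))"
      by (rule continuous_on_compose2[OF gain_cont overshoot_continuous]) (use overshoot_nonneg in auto)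
  qed (simp_all add: gain_mono overshoot_mono overshoot_nonneg gain_0 overshoot_0)
  then have \<sigma>: "class_K \<sigma>" by (simp add: class_Kinf_def)
  \<comment> \<open>Only values exceeding the contribution of the input are recorded, so that \<open>P\<close> is attractive to 0.\<close>
  define P where "P r \<tau> y \<longleftrightarrow> (\<exists>x u t k i. solution_pair H x u \<and> jump_complete H x u \<and> (t, k) \<in> dom x \<and>
    r = norm (hval x 0 0) \<and> \<tau> = t + real k \<and> y = norm (block_proj H i (hval x t k)) \<and>
    closed_gain (input_gain (hnorm u t k)) $ i < y)" for r \<tau> y
  obtain \<beta>' where \<beta>': "class_KL \<beta>'" "\<And>r \<tau> y. P r \<tau> y \<Longrightarrow> y \<le> \<beta>' r \<tau>"
  proof (rule class_KL_from_uniform_attractivity[OF \<sigma>, of P])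
    fix r \<tau> y assume "P r \<tau> y"
    then obtain x u t k i where sol: "solution_pair H x u" "jump_complete H x u" "(t, k) \<in> dom x"
      and e: "r = norm (hval x 0 0)" "\<tau> = t + real k" "y = norm (block_proj H i (hval x t k))"
      and gt: "closed_gain (input_gain (hnorm u t k)) $ i < y"
      unfolding P_def by blast
    have "0 \<le> r" by (simp add: e)
    have "y \<le> max (closed_gain (overshoot r) $ i) (closed_gain (input_gain (hnorm u t k)) $ i)"
      using global_stability[OF sol, of i] overshoot_nonneg[OF \<open>0 \<le> r\<close>] input_gain_nonneg[OF hnorm_nonneg]
      by (simp add: e closed_gain_max)
    \<comment> \<open>A recorded value exceeds the input contribution, so the other term of the
      maximum must bound it.\<close>
    then have "y \<le> gain (overshoot r)" using gt gain_ge[of "overshoot r" i] by linarith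
    then show "0 \<le> r \<and> 0 \<le> \<tau> \<and> 0 \<le> y \<and> y \<le> \<sigma> r"
      using \<open>0 \<le> r\<close> htd_nonneg[OF solution_pair_htd[OF sol(1)] sol(3)] by (simp add: e \<sigma>_def add_increasing2)
  next
    fix r \<epsilon> :: real assume "0 \<le> r" "0 < \<epsilon>"
    then obtain T where T: "\<And>x u t k i. solution_pair H x u \<Longrightarrow> jump_complete H x u \<Longrightarrow> (t, k) \<in> dom x \<Longrightarrow>
      norm (hval x 0 0) \<le> r \<Longrightarrow> T \<le> t + real k \<Longrightarrow>
      norm (block_proj H i (hval x t k)) \<le> max \<epsilon> (closed_gain (input_gain (hnorm u t k)) $ i)"
      using uniform_attractivity by blast
    have "y \<le> \<epsilon>" if P: "P r' \<tau> y" and le: "r' \<le> r" "T \<le> \<tau>" for r' \<tau> y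
    proof -
      obtain x u t k i where sol: "solution_pair H x u" "jump_complete H x u" "(t, k) \<in> dom x"
        and e: "r' = norm (hval x 0 0)" "\<tau> = t + real k" "y = norm (block_proj H i (hval x t k))"
        and gt: "closed_gain (input_gain (hnorm u t k)) $ i < y"
        using P unfolding P_def by blast
      show ?thesis using T[OF sol, of i] le gt unfolding e by linarith
    qed
    then show "\<exists>T. \<forall>r' \<tau> y. P r' \<tau> y \<and> r' \<le> r \<and> T \<le> \<tau> \<longrightarrow> y \<le> \<epsilon>" by blast
  qed blast
  \<comment> \<open>The norm of the state is estimated by the sum of the norms of its n blocks; this
    is the factor in both bounds.\<close>
  let ?n = "real CARD('n)"
  define g where "g w = ?n * gain (input_gain w) + w" for w
  have "class_Kinf g"
    unfolding g_def
  proof (rule class_Kinf_add_self)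
    show "continuous_on {0..} (\<lambda>w. ?n * gain (input_gain w))"
      by (intro continuous_intros continuous_on_compose2[OF gain_cont input_gain_continuous])
         (use input_gain_nonneg in auto)
  qed (simp_all add: gain_mono input_gain_mono input_gain_nonneg gain_0 input_gain_0 mult_left_mono)
  then have g: "class_Kinf0 g" by (simp add: class_Kinf0_def)
  have b: "class_KLL (\<lambda>s t k. ?n * \<beta>' s (t + k))"
    by (rule class_KLL_of_class_KL[OF class_KL_scale[OF \<beta>'(1)]]) simp
  show ?thesis
    unfolding overall_ISS_def
  proof (rule exI[of _ "\<lambda>s t k. ?n * \<beta>' s (t + k)"], rule exI[of _ g], intro conjI allI impI b g)
    fix x0 x u assume *: "maximal_solution_pair H x u \<and> hval x 0 0 = x0"
    then have sol: "solution_pair H x u" and jc: "jump_complete H x u"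
      using maximal_solution_pair_imp_jump_complete[OF reg D] by (auto simp: maximal_solution_pair_def)
    have x0: "x0 = hval x 0 0" using * by simp
    have "norm (hval x t k) \<le> max (?n * \<beta>' (norm x0) (t + real k)) (g (hnorm u t k))"
      if tk: "(t, k) \<in> dom x" for t k
    proof -
      let ?m = "max (\<beta>' (norm x0) (t + real k)) (gain (input_gain (hnorm u t k)))"
      have "norm (block_proj H i (hval x t k)) \<le> ?m" for i
      proof (cases "closed_gain (input_gain (hnorm u t k)) $ i < norm (block_proj H i (hval x t k))")
        case True
        then have "P (norm x0) (t + real k) (norm (block_proj H i (hval x t k)))"
          unfolding P_def x0 using sol jc tk by blast
        from \<beta>'(2)[OF this] show ?thesis by simp
      next
        \<comment> \<open>Values not recorded in \<open>P\<close> are at most the contribution of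
          the input.\<close>
        case False
        then show ?thesis using gain_ge[of "input_gain (hnorm u t k)" i] by linarith
      qed
      then have "(\<Sum>i\<in>UNIV. norm (block_proj H i (hval x t k))) \<le> ?n * ?m"
        by (intro sum_bounded_above) simp
      moreover have "norm (hval x t k) \<le> (\<Sum>i\<in>UNIV. norm (block_proj H i (hval x t k)))"
        using norm_sum[of "\<lambda>i. block_proj H i (hval x t k)" UNIV] by (simp add: sum_block_proj)
      moreover have "?n * ?m \<le> max (?n * \<beta>' (norm x0) (t + real k)) (g (hnorm u t k))"
        unfolding g_def max_mult_distrib_left using hnorm_nonneg[of u t k] by auto
      ultimately show ?thesis by linarith
    qed
    then show "\<forall>(t, k)\<in>dom x. norm (hval x t k) \<le> max (?n * \<beta>' (norm x0) (t + real k)) (g (hnorm u t k))"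
      by blast
  qed
qed

end

theorem theorem3p4:
  fixes H :: "('n::finite, 'c::finite, 'm::finite) interconnection"
    and \<gamma> :: "'n \<Rightarrow> 'n \<Rightarrow> real \<Rightarrow> real"
    and \<gamma>u :: "'n \<Rightarrow> real \<Rightarrow> real"
  assumes "CARD('n) \<ge> 2"
    and "regular_interconnection H"
    and "\<And>i. jump_set H i = overall_jump_set H"
    and "\<And>x \<epsilon>. x \<in> overall_state_set H \<Longrightarrow> \<epsilon> > 0 \<Longrightarrow>
           convex {overall_flow_map H (x, v) | v.
             v \<in> input_set H \<inter> cball 0 \<epsilon> \<and> (x, v) \<in> overall_flow_set H}"
    and "\<And>i. sub_ISS H i (\<gamma> i) (\<gamma>u i)"
    and "\<And>i s. s \<ge> 0 \<Longrightarrow> \<gamma> i i s = 0"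
    and "\<And>s. (\<forall>i. s $ i \<ge> 0) \<Longrightarrow> s \<noteq> 0 \<Longrightarrow> \<exists>i. Gamma_max \<gamma> s $ i < s $ i"
  shows "overall_ISS H"
proof -
  have "\<exists>\<beta>. class_KLL \<beta> \<and> (\<forall>xs u t k. maximal_sub_solution_pair H i xs u \<longrightarrow> (t, k) \<in> dom (xs i) \<longrightarrow>
      norm (hval (xs i) t k) \<le> Max {\<beta> (norm (hval (xs i) 0 0)) t (real k),
         Max ((\<lambda>j. \<gamma> i j (hnorm (xs j) t k)) ` (UNIV - {i})), \<gamma>u i (hnorm u t k)})"
    (is "\<exists>\<beta>. ?P i \<beta>") for i
  proof -
    obtain \<beta> where \<beta>: "class_KLL \<beta>"
      and est: "\<forall>xi0 xs u. maximal_sub_solution_pair H i xs u \<and> hval (xs i) 0 0 = xi0 \<longrightarrow>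
        (\<forall>(t, k)\<in>dom (xs i). norm (hval (xs i) t k) \<le> Max {\<beta> (norm xi0) t (real k),
           Max ((\<lambda>j. \<gamma> i j (hnorm (xs j) t k)) ` (UNIV - {i})), \<gamma>u i (hnorm u t k)})"
      using assms(5)[of i] unfolding sub_ISS_def by (elim conjE exE)
    show ?thesis
    proof (intro exI[of _ \<beta>] conjI allI impI \<beta>)
      fix xs u t k assume "maximal_sub_solution_pair H i xs u" and tk: "(t, k) \<in> dom (xs i)"
      with est have "\<forall>(t, k)\<in>dom (xs i). norm (hval (xs i) t k) \<le> Max {\<beta> (norm (hval (xs i) 0 0)) t (real k),
          Max ((\<lambda>j. \<gamma> i j (hnorm (xs j) t k)) ` (UNIV - {i})), \<gamma>u i (hnorm u t k)}"
        by simp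
      from bspec[OF this tk] show "norm (hval (xs i) t k) \<le> Max {\<beta> (norm (hval (xs i) 0 0)) t (real k),
          Max ((\<lambda>j. \<gamma> i j (hnorm (xs j) t k)) ` (UNIV - {i})), \<gamma>u i (hnorm u t k)}"
        by simp
    qed
  qed
  \<comment> \<open>ISS provides a transient bound for each subsystem separately; choice combines
    them into the family that the locale expects.\<close>
  then have "\<exists>\<beta>. \<forall>i. ?P i (\<beta> i)" by (intro choice allI)
  then obtain \<beta> where "\<forall>i. ?P i (\<beta> i)" by (elim exE) (rule that)
  then have \<beta>: "?P i (\<beta> i)" for i by (rule spec)
  interpret small_gain_interconnection H \<gamma> \<gamma>u \<beta>
  proof
    show "class_KLL (\<beta> i)" for i using \<beta>[of i] by (rule conjunct1)
    show "norm (hval (xs i) t k) \<le> Max {\<beta> i (norm (hval (xs i) 0 0)) t (real k),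
         Max ((\<lambda>j. \<gamma> i j (hnorm (xs j) t k)) ` (UNIV - {i})), \<gamma>u i (hnorm u t k)}"
      if "maximal_sub_solution_pair H i xs u" "(t, k) \<in> dom (xs i)" for i xs u t k
      using conjunct2[OF \<beta>[of i], rule_format, OF that] .
  qed (use assms in \<open>simp_all add: sub_ISS_def\<close>)
  show ?thesis by (rule overall_ISS)
qed

end
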